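(* Let $k$ be an algebraically closed field of characteristic zero, $R=k[x_0,\ldots,x_N]$, $S=k[x_1,\ldots,x_N]$. Let $X\subset\mathbb{P}^N$ be a reduced projective scheme with a homogeneous defining ideal $I\subset R$, and let $q=(1:0:\cdots:0)\in X$. Let $K_i(I)\subset S$ be the $i$-th partial elimination ideal of $I$ and $J=I\cap S=K_0(I)$. (a) If $I$ satisfies property $\mathbf{N}_{d,1}$, then $K_i(I)$ stabilizes at least at $i=d-1$, i.e. $K_i(I)=K_{d-1}(I)$ for all $i\ge d-1$, to an ideal defining the tangent cone $TC_qX$ of $X$ at $q$. So if $q$ is a smooth point of $X$, then $K_{d-1}(I)$ is an ideal generated by linear forms which defines the tangent space $T_qX$. (b) In particular, if $I$ is generated by quadrics and $q$ is a smooth point of $X$, then $K_i(I)$ stabilizes at $i=1$ to an ideal $I_L=(\ell_1,\ldots,\ell_e)$ generated by linear forms, $e=\mathrm{codim}(X,\mathbb{P}^N)$, which defines the tangent space $T_qX$, i.e. $$J=K_0(I)\subset I_L=K_1(I)=\cdots=K_i(I)=\cdots\subset S,$$ and the (infinitely generated) graded $S$-module $I/J$ has a minimal graded free resolution over $S$ of the form $$0\to \bigoplus_{m\ge 1}S(-e-m)^{b_e}\to\cdots\to\bigoplus_{m\ge 1}S(-2-m)^{b_2}\to\bigoplus_{m\ge 1}S(-1-m)^{b_1}\to I/J\to 0,$$ where $b_i=\binom{e}{i}$.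
   Context: A homogeneous ideal $I\subset R$ is a defining ideal of $X$ if it defines $X$ scheme-theoretically, i.e. its sheafification $\widetilde I$ equals the ideal sheaf $\mathcal{I}_X$ ($I$ need not be saturated). $I$ satisfies property $\mathbf{N}_{d,p}$ if $\dim_k\mathrm{Tor}_i^R(R/I,k)_{i+j}=0$ for all $0\le i\le p$ and $j\ge d$; so $\mathbf{N}_{d,1}$ means that $I$ is generated in degrees $\le d$. Partial elimination ideals: for a nonzero homogeneous $f\in R$ let $d_0(f)$ be the exponent of $x_0$ in the leading term of $f$ for the degree lexicographic order with $x_0$ largest (i.e. the degree of $f$ in $x_0$). Put $\widetilde K_i(I)=\bigoplus_{m\ge0}\{f\in I_m\mid d_0(f)\le i\}$ (zero included). Each $f\in\widetilde K_i(I)$ is uniquely $f=x_0^i\bar f+g$ with $\bar f\in S$ and $d_0(g)<i$; $K_i(I)$ is the ideal of $S$ generated by the image of $\widetilde K_i(I)$ under $f\mapsto\bar f$. The tangent cone and tangent space at $q$ are regarded as subschemes of the affine space $\mathrm{Spec}\,S$, i.e. of the chart $x_0=1$ of $\mathbb{P}^N$ with origin $q$ (equivalently, as their closures in $\mathbb{P}^N$). A smooth point $q\in X$ here is one at which the tangent space has dimension $\dim X$, i.e. codimension $\mathrm{codim}(X,\mathbb{P}^N)=N-\dim X$.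
   Formalization: A smooth point q must satisfy, besides dim T_qX = dim X, also dim_q X = dim X; otherwise the claim fails (X = two lines crossing at q plus a disjoint plane in P^5). The parenthetical remark that I/J is infinitely generated is not included. *)

theory Defs
  imports
    "HOL-Library.Poly_Mapping"
    "HOL-Library.Extended_Nat"
    "HOL-Library.Function_Algebras"
    "HOL-Computational_Algebra.Polynomial"
    "HOL-Algebra.Ideal"
begin

section \<open>Polynomials in the variables \<open>x\<^sub>i\<close>, \<open>i \<in> V\<close>\<close>

text \<open>Monomials are exponent vectors with finite support. With \<open>N\<close> fixed,
  \<open>R = k[x\<^sub>0,\<dots>,x\<^sub>N]\<close> is \<open>polys {0..N}\<close> and \<open>S = k[x\<^sub>1,\<dots>,x\<^sub>N]\<close> is \<open>polys {1..N}\<close>, so that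
  \<open>S\<close> is literally a subset of \<open>R\<close>.\<close>

type_synonym 'k mpoly = "(nat \<Rightarrow>\<^sub>0 nat) \<Rightarrow>\<^sub>0 'k"

definition polys :: "nat set \<Rightarrow> ('k::field) mpoly set" where
  "polys V = {p. \<forall>m\<in>Poly_Mapping.keys p. Poly_Mapping.keys m \<subseteq> V}"

definition poly_ring :: "nat set \<Rightarrow> ('k::field) mpoly ring" where
  "poly_ring V = \<lparr>carrier = polys V, monoid.mult = (*), one = 1, ring.zero = 0, add = (+)\<rparr>"

definition var :: "nat \<Rightarrow> ('k::field) mpoly" where
  "var i = Poly_Mapping.single (Poly_Mapping.single i 1) 1"

definition mdeg :: "(nat \<Rightarrow>\<^sub>0 nat) \<Rightarrow> nat" where
  "mdeg m = (\<Sum>i\<in>Poly_Mapping.keys m. Poly_Mapping.lookup m i)"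

text \<open>The degree \<open>n\<close> piece of \<open>k[x\<^sub>i : i \<in> V](-s)\<close>.\<close>

definition graded :: "nat set \<Rightarrow> nat \<Rightarrow> nat \<Rightarrow> ('k::field) mpoly set" where
  "graded V s n = {p \<in> polys V. \<forall>m\<in>Poly_Mapping.keys p. mdeg m + s = n}"

abbreviation forms :: "nat set \<Rightarrow> nat \<Rightarrow> ('k::field) mpoly set" where
  "forms V n \<equiv> graded V 0 n"

definition hom_part :: "nat \<Rightarrow> ('k::field) mpoly \<Rightarrow> 'k mpoly" where
  "hom_part n p =
     (\<Sum>m\<in>{m \<in> Poly_Mapping.keys p. mdeg m = n}.
        Poly_Mapping.single m (Poly_Mapping.lookup p m))"

definition eval_mpoly :: "(nat \<Rightarrow> 'k) \<Rightarrow> ('k::field) mpoly \<Rightarrow> 'k" where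
  "eval_mpoly a p =
     (\<Sum>m\<in>Poly_Mapping.keys p.
        Poly_Mapping.lookup p m * (\<Prod>i\<in>Poly_Mapping.keys m. a i ^ Poly_Mapping.lookup m i))"

definition homogeneous_ideal :: "nat set \<Rightarrow> ('k::field) mpoly set \<Rightarrow> bool" where
  "homogeneous_ideal V I \<longleftrightarrow> ideal I (poly_ring V) \<and> (\<forall>f\<in>I. \<forall>n. hom_part n f \<in> I)"


section \<open>Reduced closed subschemes of projective space\<close>

text \<open>Over an algebraically closed field a reduced closed subscheme of \<open>\<P>\<^sup>N\<close> is the same
  thing as a Zariski closed set of \<open>k\<close>-points, its ideal sheaf consisting of the functions
  vanishing on that set. A set of points is represented by the set of all homogeneous coordinate
  vectors of its points; coordinates with index beyond \<open>N\<close> are \<open>0\<close>.\<close>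

definition proj_coords :: "nat \<Rightarrow> (nat \<Rightarrow> 'k::field) set" where
  "proj_coords N = {a. (\<exists>i\<le>N. a i \<noteq> 0) \<and> (\<forall>i>N. a i = 0)}"

definition proj_zeros :: "nat \<Rightarrow> ('k::field) mpoly set \<Rightarrow> (nat \<Rightarrow> 'k) set" where
  "proj_zeros N G = {a \<in> proj_coords N. \<forall>g\<in>G. eval_mpoly a g = 0}"

definition proj_closed :: "nat \<Rightarrow> (nat \<Rightarrow> 'k::field) set \<Rightarrow> bool" where
  "proj_closed N X \<longleftrightarrow> (\<exists>G \<subseteq> (\<Union>n. forms {0..N} n). X = proj_zeros N G)"

definition origin_pt :: "nat \<Rightarrow> 'k::field" where
  "origin_pt = (\<lambda>i. if i = 0 then 1 else 0)"

text \<open>The affine chart \<open>x\<^sub>i = 1\<close> has coordinate ring \<open>polys ({0..N} - {i})\<close>.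
  \<open>chart_ideal\<close> gives the sections of the ideal sheaf of \<open>X\<close> over this chart, and the image of
  \<open>I\<close> under \<open>dehom i\<close> (substitution of \<open>1\<close> for \<open>x\<^sub>i\<close>) gives the sections of the sheafification
  of \<open>I\<close>: under \<open>x\<^sub>j / x\<^sub>i \<mapsto> x\<^sub>j\<close> the degree \<open>0\<close> part of the localisation of \<open>I\<close> at \<open>x\<^sub>i\<close>
  becomes \<open>dehom i ` I\<close>.\<close>

definition chart_ideal :: "nat \<Rightarrow> (nat \<Rightarrow> 'k::field) set \<Rightarrow> nat \<Rightarrow> 'k mpoly set" where
  "chart_ideal N X i =
     {p \<in> polys ({0..N} - {i}). \<forall>a\<in>X. a i = 1 \<longrightarrow> eval_mpoly a p = 0}"

definition dehom :: "nat \<Rightarrow> ('k::field) mpoly \<Rightarrow> 'k mpoly" where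
  "dehom i p =
     (\<Sum>m\<in>Poly_Mapping.keys p.
        Poly_Mapping.single (Poly_Mapping.update i 0 m) (Poly_Mapping.lookup p m))"

definition defining_ideal :: "nat \<Rightarrow> (nat \<Rightarrow> 'k::field) set \<Rightarrow> 'k mpoly set \<Rightarrow> bool" where
  "defining_ideal N X I \<longleftrightarrow>
     homogeneous_ideal {0..N} I \<and> (\<forall>i\<le>N. dehom i ` I = chart_ideal N X i)"


section \<open>Dimension\<close>

definition irreducible_closed :: "nat \<Rightarrow> (nat \<Rightarrow> 'k::field) set \<Rightarrow> bool" where
  "irreducible_closed N Z \<longleftrightarrow> proj_closed N Z \<and> Z \<noteq> {} \<and>
     (\<forall>Z1 Z2. proj_closed N Z1 \<longrightarrow> proj_closed N Z2 \<longrightarrow> Z = Z1 \<union> Z2 \<longrightarrow> Z = Z1 \<or> Z = Z2)"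

definition chain_dim :: "'a set set \<Rightarrow> enat" where
  "chain_dim \<C> = Sup {enat n | n. \<exists>Z. (\<forall>i\<le>n. Z i \<in> \<C>) \<and> (\<forall>i<n. Z i \<subset> Z (Suc i))}"

definition scheme_dim :: "nat \<Rightarrow> (nat \<Rightarrow> 'k::field) set \<Rightarrow> enat" where
  "scheme_dim N X = chain_dim {Z. irreducible_closed N Z \<and> Z \<subseteq> X}"

text \<open>The dimension of \<open>X\<close> at a closed point \<open>q\<close>, i.e. the dimension of the local ring of \<open>X\<close>
  at \<open>q\<close>.\<close>

definition local_dim :: "nat \<Rightarrow> (nat \<Rightarrow> 'k::field) set \<Rightarrow> (nat \<Rightarrow> 'k) \<Rightarrow> enat" where
  "local_dim N X q = chain_dim {Z. irreducible_closed N Z \<and> Z \<subseteq> X \<and> q \<in> Z}"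

definition codim :: "nat \<Rightarrow> (nat \<Rightarrow> 'k::field) set \<Rightarrow> nat" where
  "codim N X = N - the_enat (scheme_dim N X)"


section \<open>Tangent cone and tangent space at \<open>q = (1:0:\<dots>:0)\<close>\<close>

text \<open>Both are given by their ideals in \<open>S\<close>, the coordinate ring of the chart \<open>x\<^sub>0 = 1\<close>, whose
  origin is \<open>q\<close>.\<close>

definition initial_form :: "('k::field) mpoly \<Rightarrow> 'k mpoly" where
  "initial_form f = hom_part (Min (mdeg ` Poly_Mapping.keys f)) f"

definition tangent_cone_ideal :: "nat \<Rightarrow> (nat \<Rightarrow> 'k::field) set \<Rightarrow> 'k mpoly set" where
  "tangent_cone_ideal N X =
     genideal (poly_ring {1..N}) {initial_form f | f. f \<in> chart_ideal N X 0 \<and> f \<noteq> 0}"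

text \<open>\<open>hom_part 1 f\<close> is the differential of \<open>f\<close> at the origin.\<close>

definition tangent_space_ideal :: "nat \<Rightarrow> (nat \<Rightarrow> 'k::field) set \<Rightarrow> 'k mpoly set" where
  "tangent_space_ideal N X =
     genideal (poly_ring {1..N}) (hom_part 1 ` chart_ideal N X 0)"

definition tangent_space :: "nat \<Rightarrow> (nat \<Rightarrow> 'k::field) set \<Rightarrow> (nat \<Rightarrow> 'k) set" where
  "tangent_space N X = {v. (\<forall>i. i \<notin> {1..N} \<longrightarrow> v i = 0) \<and>
     (\<forall>f\<in>chart_ideal N X 0. eval_mpoly v (hom_part 1 f) = 0)}"

definition tangent_dim :: "nat \<Rightarrow> (nat \<Rightarrow> 'k::field) set \<Rightarrow> nat" where
  "tangent_dim N X = vector_space.dim (\<lambda>c v i. c * v i) (tangent_space N X)"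

text \<open>The tangent space has dimension \<open>dim X\<close>. The second conjunct is automatic when \<open>X\<close> is
  equidimensional; without it a singular point on a component of small dimension could qualify
  (take the node of a plane curve, together with a plane disjoint from the curve).\<close>

definition smooth_at_origin :: "nat \<Rightarrow> (nat \<Rightarrow> 'k::field) set \<Rightarrow> bool" where
  "smooth_at_origin N X \<longleftrightarrow>
     enat (tangent_dim N X) = scheme_dim N X \<and> local_dim N X origin_pt = scheme_dim N X"


section \<open>Property \<open>N\<^bsub>d,p\<^esub>\<close>\<close>

text \<open>\<open>Tor\<^sub>i\<^sup>R(R/I,k)\<close> is the homology of \<open>R/I \<otimes> K\<close>, where \<open>K\<close> is the Koszul resolution of \<open>k\<close>
  over \<open>R\<close>. An element of \<open>R \<otimes> \<Lambda>\<^sup>i k\<^sup>N\<^sup>+\<^sup>1\<close> is given by its coefficients \<open>c A\<close> at the basis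
  vectors \<open>e\<^sub>A\<close> (\<open>A \<subseteq> {0..N}\<close>, \<open>card A = i\<close>), each \<open>e\<^sub>A\<close> having degree \<open>i\<close>; elements of \<open>R/I\<close> are
  represented by elements of \<open>R\<close>, with equality read modulo \<open>I\<close>. \<open>koszul_diff\<close> is the
  differential \<open>e\<^sub>A \<mapsto> \<Sum>\<^bsub>a \<in> A\<^esub> \<plusminus> x\<^sub>a e\<^bsub>A - {a}\<^esub>\<close>, written in coefficients.\<close>

definition koszul_diff :: "nat \<Rightarrow> (nat set \<Rightarrow> ('k::field) mpoly) \<Rightarrow> nat set \<Rightarrow> 'k mpoly" where
  "koszul_diff N c B =
     (\<Sum>a\<in>{0..N} - B. (- 1) ^ card {b \<in> B. b < a} * var a * c (insert a B))"

text \<open>\<open>Tor\<^sub>i\<^sup>R(R/I,k)\<^bsub>i+j\<^esub> = 0\<close>: a cycle has coefficients of degree \<open>j\<close>, and is required to be the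
  boundary of a chain with coefficients of degree \<open>j - 1\<close>.\<close>

definition tor_vanishes :: "nat \<Rightarrow> ('k::field) mpoly set \<Rightarrow> nat \<Rightarrow> nat \<Rightarrow> bool" where
  "tor_vanishes N I i j \<longleftrightarrow>
     (\<forall>c. (\<forall>A. A \<subseteq> {0..N} \<and> card A = i \<longrightarrow> c A \<in> forms {0..N} j) \<and>
          (\<forall>B. B \<subseteq> {0..N} \<and> Suc (card B) = i \<longrightarrow> koszul_diff N c B \<in> I)
      \<longrightarrow> (\<exists>b. (\<forall>A. A \<subseteq> {0..N} \<and> card A = Suc i \<longrightarrow> b A \<in> graded {0..N} 1 j) \<and>
               (\<forall>A. A \<subseteq> {0..N} \<and> card A = i \<longrightarrow> c A - koszul_diff N b A \<in> I)))"

definition property_N :: "nat \<Rightarrow> ('k::field) mpoly set \<Rightarrow> nat \<Rightarrow> nat \<Rightarrow> bool" where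
  "property_N N I d p \<longleftrightarrow> (\<forall>i\<le>p. \<forall>j\<ge>d. tor_vanishes N I i j)"

definition generated_by_quadrics :: "nat \<Rightarrow> ('k::field) mpoly set \<Rightarrow> bool" where
  "generated_by_quadrics N I \<longleftrightarrow> (\<exists>Q \<subseteq> forms {0..N} 2. I = genideal (poly_ring {0..N}) Q)"


section \<open>Partial elimination ideals\<close>

text \<open>Meaningful for nonzero polynomials only.\<close>

definition d0 :: "('k::field) mpoly \<Rightarrow> nat" where
  "d0 f = Max ((\<lambda>m. Poly_Mapping.lookup m 0) ` Poly_Mapping.keys f)"

definition pre_elim :: "('k::field) mpoly set \<Rightarrow> nat \<Rightarrow> 'k mpoly set" where
  "pre_elim I i = {f. \<forall>m. hom_part m f \<in> I \<and> (hom_part m f = 0 \<or> d0 (hom_part m f) \<le> i)}"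

text \<open>The coefficient \<open>f' \<in> S\<close> in \<open>f = x\<^sub>0\<^sup>i f' + g\<close>, where \<open>d0 g < i\<close>.\<close>

definition x0_coeff :: "nat \<Rightarrow> ('k::field) mpoly \<Rightarrow> 'k mpoly" where
  "x0_coeff i f =
     (\<Sum>m\<in>{m \<in> Poly_Mapping.keys f. Poly_Mapping.lookup m 0 = i}.
        Poly_Mapping.single (Poly_Mapping.update 0 0 m) (Poly_Mapping.lookup f m))"

definition partial_elim :: "nat \<Rightarrow> ('k::field) mpoly set \<Rightarrow> nat \<Rightarrow> 'k mpoly set" where
  "partial_elim N I i = genideal (poly_ring {1..N}) (x0_coeff i ` pre_elim I i)"


section \<open>Graded free modules and minimal resolutions\<close>

text \<open>The free \<open>polys V\<close>-module with basis \<open>B\<close>, as finitely supported families.\<close>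

definition free_mod :: "nat set \<Rightarrow> 'b set \<Rightarrow> ('b \<Rightarrow>\<^sub>0 ('k::field) mpoly) set" where
  "free_mod V B = {u. Poly_Mapping.keys u \<subseteq> B \<and> (\<forall>b. Poly_Mapping.lookup u b \<in> polys V)}"

text \<open>Its degree \<open>n\<close> piece, the basis element \<open>b\<close> having degree \<open>\<delta> b\<close>.\<close>

definition free_graded ::
    "nat set \<Rightarrow> 'b set \<Rightarrow> ('b \<Rightarrow> nat) \<Rightarrow> nat \<Rightarrow> ('b \<Rightarrow>\<^sub>0 ('k::field) mpoly) set" where
  "free_graded V B \<delta> n = {u \<in> free_mod V B. \<forall>b. Poly_Mapping.lookup u b \<in> graded V (\<delta> b) n}"

definition free_scale :: "('k::field) mpoly \<Rightarrow> ('b \<Rightarrow>\<^sub>0 'k mpoly) \<Rightarrow> ('b \<Rightarrow>\<^sub>0 'k mpoly)" where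
  "free_scale p u = Poly_Mapping.map ((*) p) u"

text \<open>Homomorphisms of degree \<open>0\<close> from a graded free module into a module with scalar
  multiplication \<open>sc\<close> and graded pieces \<open>M n\<close>.\<close>

definition graded_hom ::
    "nat set \<Rightarrow> 'b set \<Rightarrow> ('b \<Rightarrow> nat) \<Rightarrow> (('k::field) mpoly \<Rightarrow> 'm \<Rightarrow> 'm) \<Rightarrow> (nat \<Rightarrow> 'm set) \<Rightarrow>
      (('b \<Rightarrow>\<^sub>0 'k mpoly) \<Rightarrow> 'm::ab_group_add) \<Rightarrow> bool" where
  "graded_hom V B \<delta> sc M f \<longleftrightarrow>
     (\<forall>u\<in>free_mod V B. \<forall>v\<in>free_mod V B. f (u + v) = f u + f v) \<and>
     (\<forall>p\<in>polys V. \<forall>u\<in>free_mod V B. f (free_scale p u) = sc p (f u)) \<and>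
     (\<forall>n. f ` free_graded V B \<delta> n \<subseteq> M n)"

text \<open>Let \<open>J \<subseteq> I\<close> be \<open>polys V\<close>-submodules of the ring of all polynomials, \<open>I\<close> graded by total
  degree. The predicate says that
  \<open>\<dots> \<rightarrow> F\<^sub>3 \<rightarrow> F\<^sub>2 \<rightarrow> F\<^sub>1 \<rightarrow> I/J \<rightarrow> 0\<close> is a minimal graded free resolution of \<open>I/J\<close>, where \<open>F\<^sub>i\<close> is
  free on \<open>B i\<close> with degrees \<open>\<delta> i\<close>; homological indices start at \<open>1\<close>. The differential
  \<open>F\<^sub>i\<^sub>+\<^sub>1 \<rightarrow> F\<^sub>i\<close> is \<open>\<phi> i\<close>, and the augmentation is \<open>\<epsilon>: F\<^sub>1 \<rightarrow> I\<close> followed by the projection to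
  \<open>I/J\<close> (every graded homomorphism from the free module \<open>F\<^sub>1\<close> to \<open>I/J\<close> is of this form). Minimality:
  the image of every differential lies in the irrelevant ideal times the target.\<close>

definition minimal_graded_free_resolution ::
    "nat set \<Rightarrow> ('k::field) mpoly set \<Rightarrow> 'k mpoly set \<Rightarrow> (nat \<Rightarrow> 'b set) \<Rightarrow> (nat \<Rightarrow> 'b \<Rightarrow> nat) \<Rightarrow>
      (('b \<Rightarrow>\<^sub>0 'k mpoly) \<Rightarrow> 'k mpoly) \<Rightarrow> (nat \<Rightarrow> ('b \<Rightarrow>\<^sub>0 'k mpoly) \<Rightarrow> ('b \<Rightarrow>\<^sub>0 'k mpoly)) \<Rightarrow> bool"
    where
  "minimal_graded_free_resolution V I J B \<delta> \<epsilon> \<phi> \<longleftrightarrow>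
     graded_hom V (B 1) (\<delta> 1) (*) (\<lambda>n. I \<inter> forms UNIV n) \<epsilon> \<and>
     (\<forall>i\<ge>1. graded_hom V (B (Suc i)) (\<delta> (Suc i)) free_scale (free_graded V (B i) (\<delta> i)) (\<phi> i)) \<and>
     I = {\<epsilon> u + g | u g. u \<in> free_mod V (B 1) \<and> g \<in> J} \<and>
     {u \<in> free_mod V (B 1). \<epsilon> u \<in> J} = \<phi> 1 ` free_mod V (B 2) \<and>
     (\<forall>i\<ge>1. {u \<in> free_mod V (B (Suc i)). \<phi> i u = 0} = \<phi> (Suc i) ` free_mod V (B (Suc (Suc i)))) \<and>
     (\<forall>i\<ge>1. \<forall>u\<in>free_mod V (B (Suc i)). \<forall>b. Poly_Mapping.lookup (Poly_Mapping.lookup (\<phi> i u) b) 0 = 0)"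

end

theory Submission
  imports Defs
begin

text \<open>A generator of \<open>I\<close> of degree at most \<open>d\<close> vanishes at \<open>q\<close>, so its \<open>x\<^sub>0\<close>-degree is at most \<open>d - 1\<close>;
  hence every \<open>f \<in> I\<close> is \<open>x\<^sub>0 w + s\<close> with \<open>w, s \<in> I\<close> and \<open>s\<close> of \<open>x\<^sub>0\<close>-degree at most \<open>d - 1\<close>, which
  gives the stabilisation. Leading coefficients in \<open>x\<^sub>0\<close> are initial forms of dehomogenisations, so
  the stable ideal is that of the tangent cone.

  Let \<open>n\<close> be the dimension of the tangent space at a smooth point. A chain of \<open>n + 1\<close> irreducible
  closed sets through \<open>q\<close> gives a chain of primes \<open>P\<^sub>n \<subset> \<dots> \<subset> P\<^sub>0\<close> of \<open>S\<close> inside the maximal ideal \<open>M\<close>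
  of \<open>q\<close>, and by an Artin--Rees argument \<open>S / (P\<^sub>n + M\<^sup>c\<^sup>t)\<close> has dimension at least the binomial
  coefficient of \<open>t\<close> over \<open>n\<close>. An initial form outside the ideal of linear parts would bound this
  dimension by a constant times \<open>t\<^sup>n\<^sup>-\<^sup>1\<close>. So the tangent cone is the tangent space.

  For quadrics, \<open>I/J\<close> is filtered by \<open>x\<^sub>0\<close>-degree with graded pieces \<open>I\<^sub>L(-m)\<close>, each resolved by a
  Koszul complex. The Koszul differentials lift along the filtration; the correction terms lower \<open>m\<close>
  and therefore have entries of degree at least \<open>2\<close>, so the resulting resolution is minimal.\<close>

section \<open>Polynomials as finitely supported functions\<close>

text \<open>Smoothness is given only by lengths of chains of closed sets and the dimension of a
  vector space, so regularity at \<open>q\<close> must be extracted from these two numbers. Both are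
  compared with the growth of S/(A + M^t), where A is the ideal of the chart. S is never localised:
  M^t already makes everything away from the origin invisible. A chain bounds this growth from below
  only, a relation among the non-pivot variables from above only, and that is enough for a
  contradiction. Artin-Rees loses a constant at each prime; measuring along c t instead of t absorbs
  it and costs only a constant factor in the upper bound. For the resolution, I/J has infinitely
  many generators. The invariant carried along is that the leading blocks of the current syzygy
  module are exactly the Koszul cycles: it dictates the next generators, forces the next
  differential to have the right image, and holds again for its kernel. Induction on the level works
  because an element meets finitely many levels, and level 0 is zero in the free modules and J in
  I.\<close>

abbreviation "lookup \<equiv> Poly_Mapping.lookup"
abbreviation "keys \<equiv> Poly_Mapping.keys"
abbreviation "single \<equiv> Poly_Mapping.single"

lemma keys_plus_nat: "keys (a + b) = keys a \<union> keys (b :: 'a \<Rightarrow>\<^sub>0 nat)"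
  by (auto simp: in_keys_iff lookup_add)

lemma mdeg_superset: "finite A \<Longrightarrow> keys m \<subseteq> A \<Longrightarrow> mdeg m = (\<Sum>i\<in>A. lookup m i)"
  unfolding mdeg_def by (rule sum.mono_neutral_left) (auto simp: in_keys_iff)

lemma mdeg_add: "mdeg (a + b) = mdeg a + mdeg b"
proof -
  have "mdeg (a + b) = (\<Sum>i\<in>keys a \<union> keys b. lookup (a + b) i)"
    by (rule mdeg_superset) (auto simp: keys_plus_nat)
  moreover have "mdeg a = (\<Sum>i\<in>keys a \<union> keys b. lookup a i)" by (rule mdeg_superset) auto
  moreover have "mdeg b = (\<Sum>i\<in>keys a \<union> keys b. lookup b i)" by (rule mdeg_superset) auto
  ultimately show ?thesis by (simp add: lookup_add sum.distrib)
qed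

lemma mdeg_0 [simp]: "mdeg 0 = 0"
  by (simp add: mdeg_def)

lemma mdeg_single [simp]: "mdeg (single i n) = n"
  by (cases "n = 0") (auto simp: mdeg_def)

lemma mdeg_eq_0_iff: "mdeg m = 0 \<longleftrightarrow> m = 0"
  by (auto simp: mdeg_def in_keys_iff intro!: poly_mapping_eqI)

lemma lookup_le_mdeg: "lookup m i \<le> mdeg m"
proof (cases "i \<in> keys m")
  case True
  then show ?thesis unfolding mdeg_def by (intro member_le_sum) auto
qed (simp add: in_keys_iff)

lemma exponent_diff_add:
  assumes "\<And>i. lookup a i \<le> lookup b i"
  shows "b = a + (b - a :: 'a \<Rightarrow>\<^sub>0 nat)"
  by (rule poly_mapping_eqI) (simp add: lookup_add lookup_minus assms)

lemma mdeg_1E: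
  assumes "mdeg m = 1"
  obtains i where "m = single i 1"
proof -
  have "m \<noteq> 0" using assms by auto
  then obtain i where i: "lookup m i \<noteq> 0" by (metis lookup_zero poly_mapping_eqI)
  have "m = single i 1 + (m - single i 1)"
    by (rule exponent_diff_add) (use i in \<open>auto simp: lookup_single when_def\<close>)
  then have "mdeg (m - single i 1) = 0" using assms
    by (metis add_cancel_right_right mdeg_add mdeg_single)
  then have "m = single i 1"
    using \<open>m = single i 1 + (m - single i 1)\<close> by (simp add: mdeg_eq_0_iff)
  then show ?thesis using that by blast
qed

lemma sum_monomials:
  fixes p :: "'a \<Rightarrow>\<^sub>0 'b::comm_monoid_add"
  assumes "finite A" "keys p \<subseteq> A"
  shows "(\<Sum>m\<in>A. single m (lookup p m)) = p"
proof (rule poly_mapping_eqI)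
  fix k
  have "lookup (\<Sum>m\<in>A. single m (lookup p m)) k = (\<Sum>m\<in>A. if m = k then lookup p m else 0)"
    by (simp add: lookup_sum lookup_single when_def)
  also have "\<dots> = lookup p k" using assms by (auto simp: sum.delta' in_keys_iff)
  finally show "lookup (\<Sum>m\<in>A. single m (lookup p m)) k = lookup p k" .
qed

lemma poly_mapping_monomial_induct [case_names zero add]:
  fixes p :: "'a \<Rightarrow>\<^sub>0 'b::comm_monoid_add"
  assumes "P 0" "\<And>m c p. m \<notin> keys p \<Longrightarrow> c \<noteq> 0 \<Longrightarrow> P p \<Longrightarrow> P (single m c + p)"
  shows "P p"
proof -
  have "P (\<Sum>m\<in>A. single m (lookup p m))" if "finite A" "A \<subseteq> keys p" for A
    using that
  proof (induction A)
    case (insert x A)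
    let ?q = "\<Sum>m\<in>A. single m (lookup p m)"
    have "keys ?q \<subseteq> A" using keys_sum[of "\<lambda>m. single m (lookup p m)" A] by (auto split: if_splits)
    then have "x \<notin> keys ?q" using insert by auto
    then have "P (single x (lookup p x) + ?q)" using insert by (intro assms(2)) (auto simp: in_keys_iff)
    then show ?case using insert by simp
  qed (simp add: assms)
  from this[OF finite_keys[of p]] show ?thesis by (simp add: sum_monomials)
qed

lemma lookup_single_times_add:
  fixes p :: "('a \<Rightarrow>\<^sub>0 nat) \<Rightarrow>\<^sub>0 'k::comm_ring_1"
  shows "lookup (single m c * p) (m + k) = c * lookup p k"
  by (induction p rule: poly_mapping_monomial_induct)
    (auto simp: distrib_left lookup_add mult_single lookup_single when_def)

lemma keys_single_times:
  fixes p :: "('a \<Rightarrow>\<^sub>0 nat) \<Rightarrow>\<^sub>0 'k::idom"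
  assumes "c \<noteq> 0"
  shows "keys (single m c * p) = (+) m ` keys p"
proof
  show "keys (single m c * p) \<subseteq> (+) m ` keys p" using keys_mult[of "single m c" p] assms by auto
  show "(+) m ` keys p \<subseteq> keys (single m c * p)"
    using assms by (auto simp: in_keys_iff lookup_single_times_add)
qed

lemma mult_const_lookup:
  fixes p :: "('a \<Rightarrow>\<^sub>0 nat) \<Rightarrow>\<^sub>0 'k::comm_ring_1"
  shows "lookup (single 0 c * p) m = c * lookup p m"
  using lookup_single_times_add[of 0 c p m] by simp

subsection \<open>Ring homomorphisms given on monomials\<close>

text \<open>Evaluation, dehomogenisation and linear substitution all have this shape, with
  \<open>f\<close> acting on coefficients and \<open>th\<close> on monomials. Multiplicativity is
  thus proved once, from \<open>ring_map f\<close> and \<open>exp_map th\<close>.\<close>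

definition lin_ext :: "('k::zero \<Rightarrow> 'r) \<Rightarrow> ((nat \<Rightarrow>\<^sub>0 nat) \<Rightarrow> 'r) \<Rightarrow> ((nat \<Rightarrow>\<^sub>0 nat) \<Rightarrow>\<^sub>0 'k) \<Rightarrow> 'r::comm_ring_1"
  where "lin_ext f th p = (\<Sum>m\<in>keys p. f (lookup p m) * th m)"

definition ring_map :: "('k::comm_ring_1 \<Rightarrow> 'r::comm_ring_1) \<Rightarrow> bool" where
  "ring_map f \<longleftrightarrow> f 0 = 0 \<and> f 1 = 1 \<and> (\<forall>x y. f (x + y) = f x + f y) \<and> (\<forall>x y. f (x * y) = f x * f y)"

definition exp_map :: "((nat \<Rightarrow>\<^sub>0 nat) \<Rightarrow> 'r::comm_ring_1) \<Rightarrow> bool" where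
  "exp_map th \<longleftrightarrow> th 0 = 1 \<and> (\<forall>x y. th (x + y) = th x * th y)"

lemma ring_map_id [simp]: "ring_map (\<lambda>x. x)"
  by (simp add: ring_map_def)

lemma ring_map_const [simp]: "ring_map (single 0 :: 'k::comm_ring_1 \<Rightarrow> ('k::comm_ring_1) mpoly)"
  by (auto simp: ring_map_def single_add mult_single)

lemma lin_ext_superset:
  assumes "ring_map f" "finite A" "keys p \<subseteq> A"
  shows "lin_ext f th p = (\<Sum>m\<in>A. f (lookup p m) * th m)"
  unfolding lin_ext_def
  by (rule sum.mono_neutral_left) (use assms in \<open>auto simp: in_keys_iff ring_map_def\<close>)

lemma lin_ext_0 [simp]: "lin_ext f th 0 = 0"
  by (simp add: lin_ext_def)

lemma lin_ext_add:
  assumes "ring_map f"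
  shows "lin_ext f th (p + q) = lin_ext f th p + lin_ext f th q"
proof -
  let ?A = "keys p \<union> keys q"
  have "lin_ext f th (p + q) = (\<Sum>m\<in>?A. f (lookup (p + q) m) * th m)"
    by (rule lin_ext_superset[OF assms]) (auto intro!: subsetD[OF keys_add])
  moreover have "lin_ext f th p = (\<Sum>m\<in>?A. f (lookup p m) * th m)"
    by (rule lin_ext_superset[OF assms]) auto
  moreover have "lin_ext f th q = (\<Sum>m\<in>?A. f (lookup q m) * th m)"
    by (rule lin_ext_superset[OF assms]) auto
  ultimately show ?thesis using assms
    by (simp add: lookup_add ring_map_def distrib_right sum.distrib)
qed

lemma lin_ext_single: "ring_map f \<Longrightarrow> lin_ext f th (single m c) = f c * th m"
  by (cases "c = 0") (auto simp: lin_ext_def ring_map_def)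

lemma lin_ext_mult:
  assumes "ring_map f" "exp_map th"
  shows "lin_ext f th (p * q) = lin_ext f th p * lin_ext f th q"
proof (induction p rule: poly_mapping_monomial_induct)
  case (add m c p)
  have "lin_ext f th (single m c * q) = lin_ext f th (single m c) * lin_ext f th q"
  proof (induction q rule: poly_mapping_monomial_induct)
    case (add m' c' q)
    then show ?case using assms
      by (simp add: distrib_left lin_ext_add mult_single lin_ext_single exp_map_def ring_map_def algebra_simps)
  qed simp
  then show ?case using add assms by (simp add: distrib_right lin_ext_add)
qed simp

lemma lin_ext_sum: "ring_map f \<Longrightarrow> lin_ext f th (\<Sum>x\<in>A. p x) = (\<Sum>x\<in>A. lin_ext f th (p x))"
  by (induction A rule: infinite_finite_induct) (auto simp: lin_ext_add)

lemma lin_ext_uminus: "ring_map f \<Longrightarrow> lin_ext f th (- p) = - lin_ext f th p"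
  using lin_ext_add[of f th p "- p"] by (simp add: eq_neg_iff_add_eq_0 add.commute)

lemma lin_ext_diff: "ring_map f \<Longrightarrow> lin_ext f th (p - q) = lin_ext f th p - lin_ext f th q"
  using lin_ext_add[of f th p "- q"] by (simp add: lin_ext_uminus)

definition exp_prod :: "(nat \<Rightarrow> 'r::comm_ring_1) \<Rightarrow> (nat \<Rightarrow>\<^sub>0 nat) \<Rightarrow> 'r" where
  "exp_prod a m = (\<Prod>i\<in>keys m. a i ^ lookup m i)"

lemma exp_prod_superset:
  "finite A \<Longrightarrow> keys m \<subseteq> A \<Longrightarrow> exp_prod a m = (\<Prod>i\<in>A. a i ^ lookup m i)"
  unfolding exp_prod_def by (rule prod.mono_neutral_left) (auto simp: in_keys_iff)

lemma exp_map_exp_prod [simp]: "exp_map (exp_prod a)"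
  unfolding exp_map_def
proof (intro conjI allI)
  fix x y :: "nat \<Rightarrow>\<^sub>0 nat"
  have "exp_prod a (x + y) = (\<Prod>i\<in>keys x \<union> keys y. a i ^ lookup (x + y) i)"
    by (rule exp_prod_superset) (auto simp: keys_plus_nat)
  moreover have "exp_prod a x = (\<Prod>i\<in>keys x \<union> keys y. a i ^ lookup x i)"
    by (rule exp_prod_superset) auto
  moreover have "exp_prod a y = (\<Prod>i\<in>keys x \<union> keys y. a i ^ lookup y i)"
    by (rule exp_prod_superset) auto
  ultimately show "exp_prod a (x + y) = exp_prod a x * exp_prod a y"
    by (simp add: lookup_add power_add prod.distrib)
qed (simp add: exp_prod_def)

lemma exp_prod_single [simp]: "exp_prod a (single i n) = a i ^ n"
  by (cases "n = 0") (auto simp: exp_prod_def)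

lemma exp_prod_add: "exp_prod a (x + y) = exp_prod a x * exp_prod a y"
  using exp_map_exp_prod[of a] by (simp add: exp_map_def)

lemma exp_prod_0 [simp]: "exp_prod a 0 = 1"
  by (simp add: exp_prod_def)

lemma eval_mpoly_eq: "eval_mpoly a = lin_ext (\<lambda>x. x) (exp_prod a)"
  by (auto simp: eval_mpoly_def lin_ext_def exp_prod_def fun_eq_iff)

lemma update_add: "Poly_Mapping.update i 0 (x + y) = Poly_Mapping.update i 0 x + Poly_Mapping.update i (0::nat) y"
  by (rule poly_mapping_eqI) (simp add: lookup_update lookup_add)

lemma exp_map_update [simp]: "exp_map (\<lambda>m. single (Poly_Mapping.update i (0::nat) m) 1)"
proof -
  have "Poly_Mapping.update i 0 (0 :: nat \<Rightarrow>\<^sub>0 nat) = 0"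
    by (rule poly_mapping_eqI) (simp add: lookup_update)
  then show ?thesis by (auto simp: exp_map_def update_add mult_single)
qed

lemma dehom_eq: "dehom i = lin_ext (single 0) (\<lambda>m. single (Poly_Mapping.update i 0 m) 1)"
  by (auto simp: dehom_def lin_ext_def fun_eq_iff mult_single)

lemma eval_add: "eval_mpoly a (p + q) = eval_mpoly a p + eval_mpoly a q"
  by (simp add: eval_mpoly_eq lin_ext_add)

lemma eval_diff: "eval_mpoly a (p - q) = eval_mpoly a p - eval_mpoly a q"
  by (simp add: eval_mpoly_eq lin_ext_diff)

lemma eval_sum: "eval_mpoly a (sum f A) = (\<Sum>x\<in>A. eval_mpoly a (f x))"
  by (simp add: eval_mpoly_eq lin_ext_sum)

lemma eval_mult: "eval_mpoly a (p * q) = eval_mpoly a p * eval_mpoly a q"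
  by (simp add: eval_mpoly_eq lin_ext_mult)

lemma eval_single: "eval_mpoly a (single m c) = c * exp_prod a m"
  by (simp add: eval_mpoly_eq lin_ext_single)

lemma eval_0 [simp]: "eval_mpoly a 0 = 0"
  by (simp add: eval_mpoly_eq)

lemma eval_var [simp]: "eval_mpoly a (var i) = a i"
  by (simp add: var_def eval_single)

lemma dehom_add: "dehom i (p + q) = dehom i p + dehom i q"
  by (simp add: dehom_eq lin_ext_add)

lemma dehom_sum: "dehom i (sum f A) = (\<Sum>x\<in>A. dehom i (f x))"
  by (simp add: dehom_eq lin_ext_sum)

lemma dehom_mult: "dehom i (p * q) = dehom i p * dehom i q"
  by (simp add: dehom_eq lin_ext_mult)

lemma dehom_single: "dehom i (single m c) = single (Poly_Mapping.update i 0 m) c"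
  by (simp add: dehom_eq lin_ext_single mult_single)

lemma dehom_0 [simp]: "dehom i 0 = 0"
  by (simp add: dehom_eq)

lemma eval_dehom:
  assumes "a i = 1"
  shows "eval_mpoly a (dehom i p) = eval_mpoly a p"
proof (induction p rule: poly_mapping_monomial_induct)
  case (add m c p)
  let ?A = "insert i (keys m)"
  have "exp_prod a (Poly_Mapping.update i 0 m) = (\<Prod>j\<in>?A. a j ^ lookup (Poly_Mapping.update i 0 m) j)"
    by (rule exp_prod_superset) (auto simp: keys_update)
  also have "\<dots> = (\<Prod>j\<in>?A. a j ^ lookup m j)"
    using assms by (intro prod.cong) (auto simp: lookup_update)
  also have "\<dots> = exp_prod a m" by (rule exp_prod_superset[symmetric]) auto
  finally show ?case using add by (simp add: dehom_add eval_add dehom_single eval_single)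
qed simp

subsection \<open>Subrings of polynomials in a set of variables\<close>

lemma polysI: "(\<And>m. m \<in> keys p \<Longrightarrow> keys m \<subseteq> V) \<Longrightarrow> p \<in> polys V"
  by (auto simp: polys_def)

lemma polys_keysD: "p \<in> polys V \<Longrightarrow> m \<in> keys p \<Longrightarrow> keys m \<subseteq> V"
  by (auto simp: polys_def)

lemma polys_mono: "V \<subseteq> W \<Longrightarrow> p \<in> polys V \<Longrightarrow> p \<in> polys W"
  by (auto simp: polys_def)

lemma polys_0 [simp]: "0 \<in> polys V"
  by (simp add: polys_def)

lemma polys_1 [simp]: "1 \<in> polys V"
  by (simp add: polys_def)

lemma polys_add [simp]: "p \<in> polys V \<Longrightarrow> q \<in> polys V \<Longrightarrow> p + q \<in> polys V"
  using keys_add[of p q] by (auto simp: polys_def)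

lemma polys_uminus [simp]: "p \<in> polys V \<Longrightarrow> - p \<in> polys V"
  by (auto simp: polys_def in_keys_iff)

lemma polys_diff [simp]: "p \<in> polys V \<Longrightarrow> q \<in> polys V \<Longrightarrow> p - q \<in> polys V"
  using polys_add[of p V "- q"] by simp

lemma polys_mult [simp]: "p \<in> polys V \<Longrightarrow> q \<in> polys V \<Longrightarrow> p * q \<in> polys V"
  using keys_mult[of p q] by (fastforce simp: polys_def keys_plus_nat)

lemma polys_sum: "(\<And>x. x \<in> A \<Longrightarrow> f x \<in> polys V) \<Longrightarrow> sum f A \<in> polys V"
  by (induction A rule: infinite_finite_induct) auto

lemma polys_single: "keys m \<subseteq> V \<Longrightarrow> single m c \<in> polys V"
  by (auto simp: polys_def)

lemma polys_const [simp]: "single 0 c \<in> polys V"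
  by (rule polys_single) simp

lemma polys_var [simp]: "i \<in> V \<Longrightarrow> var i \<in> polys V"
  unfolding var_def by (rule polys_single) simp

lemma polys_induct [consumes 1, case_names zero add]:
  assumes "p \<in> polys V" "P 0"
    and "\<And>m c p. keys m \<subseteq> V \<Longrightarrow> p \<in> polys V \<Longrightarrow> P p \<Longrightarrow> P (single m c + p)"
  shows "P p"
proof -
  have "p \<in> polys V \<longrightarrow> P p"
  proof (induction p rule: poly_mapping_monomial_induct)
    case (add m c p)
    show ?case
    proof
      assume *: "single m c + p \<in> polys V"
      \<comment> \<open>Nothing cancels, because \<open>m\<close> is not in the support of
        \<open>p\<close>; so both summands inherit the restriction on the variables.\<close>
      have "keys (single m c + p) = insert m (keys p)"
        using add by (auto simp: in_keys_iff lookup_add lookup_single when_def split: if_splits)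
      with * have "keys m \<subseteq> V" "p \<in> polys V" by (auto simp: polys_def)
      then show "P (single m c + p)" using add assms(3) by blast
    qed
  qed (simp add: assms)
  then show ?thesis using assms(1) by blast
qed

lemma monomial_induct [consumes 1, case_names zero add]:
  fixes m :: "nat \<Rightarrow>\<^sub>0 nat"
  assumes "keys m \<subseteq> V" "P 0"
    and "\<And>i m. i \<in> V \<Longrightarrow> keys m \<subseteq> V \<Longrightarrow> P m \<Longrightarrow> P (single i 1 + m)"
  shows "P m"
  using assms(1)
proof (induction "mdeg m" arbitrary: m)
  case 0
  then show ?case using assms(2) by (simp add: mdeg_eq_0_iff)
next
  case (Suc d)
  then have "m \<noteq> 0" by auto
  then obtain i where i: "lookup m i \<noteq> 0" by (metis lookup_zero poly_mapping_eqI)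
  have eq: "m = single i 1 + (m - single i 1)"
    by (rule exponent_diff_add) (use i in \<open>auto simp: lookup_single when_def\<close>)
  have k: "keys m = insert i (keys (m - single i 1))"
    by (subst eq) (simp add: keys_plus_nat)
  have "mdeg m = Suc (mdeg (m - single i 1))"
    by (subst eq) (simp add: mdeg_add)
  then have "P (m - single i 1)" using Suc k by auto
  then show ?case using assms(3)[of i "m - single i 1"] Suc.prems k eq by simp
qed

lemma polys_ring_induct [consumes 1, case_names const var add mult]:
  assumes "p \<in> polys V"
    and "\<And>c. P (single 0 c)" "\<And>i. i \<in> V \<Longrightarrow> P (var i)"
    and "\<And>p q. p \<in> polys V \<Longrightarrow> q \<in> polys V \<Longrightarrow> P p \<Longrightarrow> P q \<Longrightarrow> P (p + q)"
    and "\<And>p q. p \<in> polys V \<Longrightarrow> q \<in> polys V \<Longrightarrow> P p \<Longrightarrow> P q \<Longrightarrow> P (p * q)"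
  shows "P p"
  using assms(1)
proof (induction p rule: polys_induct)
  case zero
  then show ?case using assms(2)[of 0] by simp
next
  case (add m c p)
  have "P (single m 1)" using add(1)
  proof (induction m rule: monomial_induct)
    case zero
    then show ?case using assms(2)[of 1] by simp
  next
    case (add i m)
    then have "P (var i * single m 1)" by (intro assms) (auto intro: polys_single)
    then show ?case by (simp add: var_def mult_single)
  qed
  then have "P (single 0 c * single m 1)" using add by (intro assms) (auto intro: polys_single)
  then show ?case using add by (intro assms(4)) (auto simp: mult_single intro: polys_single)
qed

subsection \<open>Homogeneous parts\<close>

lemma lookup_hom_part: "lookup (hom_part n p) m = (if mdeg m = n then lookup p m else 0)"
proof -
  have "lookup (hom_part n p) m = (\<Sum>k\<in>{k \<in> keys p. mdeg k = n}. if k = m then lookup p k else 0)"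
    by (simp add: hom_part_def lookup_sum lookup_single when_def)
  then show ?thesis by (auto simp: sum.delta' in_keys_iff)
qed

lemma hom_part_add: "hom_part n (p + q) = hom_part n p + hom_part n q"
  by (rule poly_mapping_eqI) (simp add: lookup_hom_part lookup_add)

lemma hom_part_0 [simp]: "hom_part n 0 = 0"
  by (rule poly_mapping_eqI) (simp add: lookup_hom_part)

lemma hom_part_diff: "hom_part n (p - q) = hom_part n p - hom_part n q"
  by (rule poly_mapping_eqI) (simp add: lookup_hom_part lookup_minus)

lemma hom_part_sum: "hom_part n (sum f A) = (\<Sum>x\<in>A. hom_part n (f x))"
  by (induction A rule: infinite_finite_induct) (auto simp: hom_part_add)

lemma keys_hom_part: "keys (hom_part n p) = {m \<in> keys p. mdeg m = n}"
  by (auto simp: in_keys_iff lookup_hom_part split: if_splits)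

lemma hom_part_forms: "p \<in> polys V \<Longrightarrow> hom_part n p \<in> forms V n"
  by (auto simp: graded_def polys_def keys_hom_part)

lemma hom_part_polys: "p \<in> polys V \<Longrightarrow> hom_part n p \<in> polys V"
  by (auto simp: polys_def keys_hom_part)

lemma sum_hom_parts:
  assumes "finite A" "mdeg ` keys p \<subseteq> A"
  shows "(\<Sum>n\<in>A. hom_part n p) = p"
proof (rule poly_mapping_eqI)
  fix m
  have "lookup (\<Sum>n\<in>A. hom_part n p) m = (\<Sum>n\<in>A. if mdeg m = n then lookup p m else 0)"
    by (simp add: lookup_sum lookup_hom_part)
  also have "\<dots> = lookup p m" using assms by (cases "lookup p m = 0") (auto simp: in_keys_iff subset_iff)
  finally show "lookup (\<Sum>n\<in>A. hom_part n p) m = lookup p m" .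
qed

lemma forms_keysD: "p \<in> graded V s n \<Longrightarrow> m \<in> keys p \<Longrightarrow> mdeg m + s = n"
  by (auto simp: graded_def)

lemma graded_polys: "p \<in> graded V s n \<Longrightarrow> p \<in> polys V"
  by (auto simp: graded_def)

lemma graded_0 [simp]: "0 \<in> graded V s n"
  by (auto simp: graded_def)

lemma graded_add [simp]: "p \<in> graded V s n \<Longrightarrow> q \<in> graded V s n \<Longrightarrow> p + q \<in> graded V s n"
  using keys_add[of p q] by (auto simp: graded_def)

lemma graded_uminus [simp]: "p \<in> graded V s n \<Longrightarrow> - p \<in> graded V s n"
  by (auto simp: graded_def in_keys_iff)

lemma graded_diff [simp]: "p \<in> graded V s n \<Longrightarrow> q \<in> graded V s n \<Longrightarrow> p - q \<in> graded V s n"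
  using graded_add[of p V s n "- q"] by simp

lemma graded_sum: "(\<And>x. x \<in> A \<Longrightarrow> f x \<in> graded V s n) \<Longrightarrow> sum f A \<in> graded V s n"
  by (induction A rule: infinite_finite_induct) auto

lemma graded_mult:
  assumes "p \<in> graded V s m" "q \<in> graded V t n"
  shows "p * q \<in> graded V (s + t) (m + n)"
proof -
  have "mdeg k + (s + t) = m + n" if k: "k \<in> keys (p * q)" for k
  proof -
    obtain a b where ab: "a \<in> keys p" "b \<in> keys q" "k = a + b" using keys_mult[of p q] k by blast
    then have "mdeg a + s = m" "mdeg b + t = n" using assms by (auto simp: graded_def)
    then show ?thesis by (simp add: ab(3) mdeg_add)
  qed
  moreover have "p * q \<in> polys V" using assms by (intro polys_mult) (simp_all add: graded_def)
  ultimately show ?thesis unfolding graded_def by blast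
qed

lemma forms_mult: "p \<in> forms V m \<Longrightarrow> q \<in> forms V n \<Longrightarrow> p * q \<in> forms V (m + n)"
  using graded_mult[of p V 0 m q 0 n] by simp

lemma forms_var: "i \<in> V \<Longrightarrow> var i \<in> forms V 1"
  by (auto simp: graded_def var_def intro!: polys_single)

lemma forms_single: "keys m \<subseteq> V \<Longrightarrow> single m c \<in> forms V (mdeg m)"
  by (simp add: graded_def polys_single)

lemma graded_mono: "p \<in> graded V s n \<Longrightarrow> V \<subseteq> W \<Longrightarrow> p \<in> graded W s n"
  by (auto simp: graded_def polys_def)

lemma forms_const: "single 0 c \<in> forms V 0"
  by (auto simp: graded_def split: if_splits)

lemma hom_part_of_form: "p \<in> forms V n \<Longrightarrow> hom_part k p = (if k = n then p else 0)"
  by (auto simp: lookup_hom_part graded_def in_keys_iff intro!: poly_mapping_eqI)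

lemma hom_part_mult_form:
  assumes "p \<in> forms V s"
  shows "hom_part (s + n) (p * q) = p * hom_part n q"
proof (induction q rule: poly_mapping_monomial_induct)
  case (add m c q)
  have 1: "p * single m c \<in> forms UNIV (s + mdeg m)"
    using assms by (intro forms_mult forms_single) (auto intro: graded_mono)
  have 2: "single m c \<in> forms UNIV (mdeg m)" by (intro forms_single) auto
  show ?case
    by (simp add: distrib_left hom_part_add add hom_part_of_form[OF 1] hom_part_of_form[OF 2])
qed simp

lemma hom_part_mult_form_less:
  assumes "p \<in> forms V s" "n < s"
  shows "hom_part n (p * q) = 0"
proof (rule ccontr)
  assume "hom_part n (p * q) \<noteq> 0"
  then obtain k where "k \<in> keys (hom_part n (p * q))" by (metis keys_eq_empty ex_in_conv)
  then have k: "k \<in> keys (p * q)" "mdeg k = n" by (auto simp: keys_hom_part)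
  then obtain a b where "a \<in> keys p" "b \<in> keys q" "k = a + b" using keys_mult[of p q] by auto
  then show False using assms k by (auto simp: graded_def mdeg_add)
qed

subsection \<open>Ideals\<close>

lemma cring_poly_ring: "cring (poly_ring V)"
proof (rule cringI)
  show "abelian_group (poly_ring V)"
  proof (rule abelian_groupI)
    fix x assume "x \<in> carrier (poly_ring V)"
    then show "\<exists>y\<in>carrier (poly_ring V). y \<oplus>\<^bsub>poly_ring V\<^esub> x = \<zero>\<^bsub>poly_ring V\<^esub>"
      by (intro bexI[of _ "- x"]) (auto simp: poly_ring_def)
  qed (auto simp: poly_ring_def add_ac)
  show "comm_monoid (poly_ring V)"
    by (rule comm_monoidI) (auto simp: poly_ring_def mult_ac)
qed (auto simp: poly_ring_def distrib_right)

lemma ideal_poly_ring_iff: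
  fixes I :: "('k::field) mpoly set"
  shows "ideal I (poly_ring V) \<longleftrightarrow> I \<subseteq> polys V \<and> 0 \<in> I \<and> (\<forall>a\<in>I. \<forall>b\<in>I. a + b \<in> I) \<and>
     (\<forall>a\<in>I. \<forall>p\<in>polys V. p * a \<in> I)" (is "?L \<longleftrightarrow> ?R")
proof
  interpret cring "poly_ring V" by (rule cring_poly_ring)
  assume ?L
  then interpret ideal I "poly_ring V" .
  show ?R
    using a_subset additive_subgroup.zero_closed[OF is_additive_subgroup] a_closed I_l_closed
    by (auto simp: poly_ring_def)
next
  interpret cring "poly_ring V" by (rule cring_poly_ring)
  assume R: ?R
  have inv: "- a \<in> I" if "a \<in> I" for a
  proof -
    have "(- 1) * a \<in> I" using R that polys_uminus[OF polys_1] by blast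
    then show ?thesis by simp
  qed
  have minv: "\<ominus>\<^bsub>poly_ring V\<^esub> a = - a" if "a \<in> polys V" for a :: "'k mpoly"
    using that by (intro minus_equality) (auto simp: poly_ring_def)
  show ?L
  proof (rule idealI)
    show "ring (poly_ring V)" by (rule cring.axioms(1)[OF cring_poly_ring])
    show "subgroup I (add_monoid (poly_ring V))"
    proof (rule add.subgroupI)
      fix a assume "a \<in> I"
      then show "\<ominus>\<^bsub>poly_ring V\<^esub> a \<in> I" using inv minv R by (auto simp: subset_iff)
    qed (use R in \<open>auto simp: poly_ring_def\<close>)
  qed (use R in \<open>auto simp: poly_ring_def mult.commute\<close>)
qed

lemma ideal_polys: "ideal I (poly_ring V) \<Longrightarrow> a \<in> I \<Longrightarrow> a \<in> polys V"
  by (auto simp: ideal_poly_ring_iff)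

lemma ideal_0: "ideal I (poly_ring V) \<Longrightarrow> 0 \<in> I"
  by (auto simp: ideal_poly_ring_iff)

lemma ideal_add: "ideal I (poly_ring V) \<Longrightarrow> a \<in> I \<Longrightarrow> b \<in> I \<Longrightarrow> a + b \<in> I"
  by (auto simp: ideal_poly_ring_iff)

lemma ideal_mult: "ideal I (poly_ring V) \<Longrightarrow> a \<in> I \<Longrightarrow> p \<in> polys V \<Longrightarrow> p * a \<in> I"
  by (auto simp: ideal_poly_ring_iff)

lemma ideal_mult_right: "ideal I (poly_ring V) \<Longrightarrow> a \<in> I \<Longrightarrow> p \<in> polys V \<Longrightarrow> a * p \<in> I"
  using ideal_mult[of I V a p] by (simp add: mult.commute)

lemma ideal_uminus:
  assumes "ideal I (poly_ring V)" "a \<in> I"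
  shows "- a \<in> I"
  using ideal_mult[OF assms, of "- 1"] polys_uminus[OF polys_1] by simp

lemma ideal_diff: "ideal I (poly_ring V) \<Longrightarrow> a \<in> I \<Longrightarrow> b \<in> I \<Longrightarrow> a - b \<in> I"
  using ideal_add[of I V a "- b"] ideal_uminus[of I V b] by simp

lemma ideal_sum: "ideal I (poly_ring V) \<Longrightarrow> (\<And>x. x \<in> A \<Longrightarrow> f x \<in> I) \<Longrightarrow> sum f A \<in> I"
  by (induction A rule: infinite_finite_induct) (auto simp: ideal_0 ideal_add)

abbreviation gen :: "nat set \<Rightarrow> ('k::field) mpoly set \<Rightarrow> 'k mpoly set" where
  "gen V G \<equiv> genideal (poly_ring V) G"

lemma gen_ideal: "G \<subseteq> polys V \<Longrightarrow> ideal (gen V G) (poly_ring V)"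
  using ring.genideal_ideal[OF cring.axioms(1)[OF cring_poly_ring], of G V]
  by (simp add: poly_ring_def)

lemma gen_incl: "G \<subseteq> polys V \<Longrightarrow> g \<in> G \<Longrightarrow> g \<in> gen V G"
  using ring.genideal_self[OF cring.axioms(1)[OF cring_poly_ring], of G V]
  by (auto simp: poly_ring_def)

lemma gen_minimal: "ideal I (poly_ring V) \<Longrightarrow> G \<subseteq> I \<Longrightarrow> gen V G \<subseteq> I"
  by (auto simp: genideal_def)

lemma gen_of_ideal: "ideal I (poly_ring V) \<Longrightarrow> gen V I = I"
  using gen_minimal[of I V I] gen_incl[of I V] ideal_polys by blast

text \<open>The coefficients are indexed by \<open>A\<close> and not by the image, so repeated
  values of \<open>f\<close> do no harm.\<close>

lemma gen_image:
  assumes fin: "finite A" and f: "\<And>x. x \<in> A \<Longrightarrow> f x \<in> polys V"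
  shows "gen V (f ` A) = {\<Sum>x\<in>A. c x * f x | c. \<forall>x. c x \<in> polys V}" (is "_ = ?R")
proof
  have "ideal ?R (poly_ring V)"
    unfolding ideal_poly_ring_iff
  proof (intro conjI ballI)
    show "?R \<subseteq> polys V" using f by (auto intro!: polys_sum)
    show "0 \<in> ?R" by (auto intro!: exI[of _ "\<lambda>_. 0"])
    show "a + b \<in> ?R" if ab: "a \<in> ?R" "b \<in> ?R" for a b
    proof -
      from ab obtain c d where "a = (\<Sum>x\<in>A. c x * f x)" "\<forall>x. c x \<in> polys V"
          "b = (\<Sum>x\<in>A. d x * f x)" "\<forall>x. d x \<in> polys V" by auto
      then show ?thesis
        by (intro CollectI exI[of _ "\<lambda>x. c x + d x"]) (auto simp: distrib_right sum.distrib)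
    qed
    show "p * a \<in> ?R" if ap: "a \<in> ?R" "p \<in> polys V" for a p
    proof -
      from ap obtain c where "a = (\<Sum>x\<in>A. c x * f x)" "\<forall>x. c x \<in> polys V" by auto
      then show ?thesis
        using ap by (intro CollectI exI[of _ "\<lambda>x. p * c x"]) (auto simp: sum_distrib_left mult.assoc)
    qed
  qed
  moreover have "f ` A \<subseteq> ?R"
  proof
    fix y assume "y \<in> f ` A"
    then obtain x where x: "x \<in> A" "y = f x" by auto
    have "(\<Sum>z\<in>A. (if z = x then 1 else 0) * f z) = f x"
      using x fin by (simp add: if_distrib[of "\<lambda>t. t * _"] sum.delta cong: if_cong)
    then show "y \<in> ?R" using x by (intro CollectI exI[of _ "\<lambda>z. if z = x then 1 else 0"]) auto
  qed
  ultimately show "gen V (f ` A) \<subseteq> ?R" by (rule gen_minimal)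
  have i: "ideal (gen V (f ` A)) (poly_ring V)" using f by (intro gen_ideal) auto
  have "f x \<in> gen V (f ` A)" if "x \<in> A" for x
    using f that by (intro gen_incl) auto
  then show "?R \<subseteq> gen V (f ` A)"
    by (auto intro!: ideal_sum[OF i] ideal_mult[OF i])
qed

declare One_nat_def [simp del] \<comment> \<open>it rewrites \<open>{1..N}\<close> to \<open>{Suc 0..N}\<close>\<close>

section \<open>Partial elimination ideals\<close>

text \<open>A bound instead of the degree \<open>d0\<close> itself: it makes sense for zero, where
  \<open>d0\<close> is the maximum of an empty set, and it is stable under sums.\<close>

definition x0_deg_le :: "nat \<Rightarrow> ('k::field) mpoly \<Rightarrow> bool" where
  "x0_deg_le i f \<longleftrightarrow> (\<forall>m\<in>keys f. lookup m 0 \<le> i)"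

lemma x0_deg_le_0 [simp]: "x0_deg_le i 0"
  by (simp add: x0_deg_le_def)

lemma x0_deg_le_add: "x0_deg_le i f \<Longrightarrow> x0_deg_le i g \<Longrightarrow> x0_deg_le i (f + g)"
  using keys_add[of f g] by (auto simp: x0_deg_le_def)

lemma x0_deg_le_uminus: "x0_deg_le i f \<Longrightarrow> x0_deg_le i (- f)"
  by (auto simp: x0_deg_le_def in_keys_iff)

lemma x0_deg_le_diff: "x0_deg_le i f \<Longrightarrow> x0_deg_le i g \<Longrightarrow> x0_deg_le i (f - g)"
  using x0_deg_le_add[of i f "- g"] x0_deg_le_uminus[of i g] by simp

lemma x0_deg_le_mono: "x0_deg_le i f \<Longrightarrow> i \<le> j \<Longrightarrow> x0_deg_le j f"
  by (force simp: x0_deg_le_def)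

lemma x0_deg_le_mult:
  assumes "x0_deg_le i f" "x0_deg_le j g"
  shows "x0_deg_le (i + j) (f * g)"
  unfolding x0_deg_le_def
proof
  fix m assume m: "m \<in> keys (f * g)"
  obtain a b where ab: "a \<in> keys f" "b \<in> keys g" "m = a + b" using keys_mult[of f g] m by blast
  then have "lookup a 0 \<le> i" "lookup b 0 \<le> j" using assms by (auto simp: x0_deg_le_def)
  then show "lookup m 0 \<le> i + j" by (simp add: ab lookup_add)
qed

lemma x0_deg_le_polys: "s \<in> polys V \<Longrightarrow> 0 \<notin> V \<Longrightarrow> x0_deg_le 0 s"
  unfolding x0_deg_le_def by (metis in_keys_iff le_refl polys_keysD subsetD)

lemma keys_without_x0: "keys (m :: nat \<Rightarrow>\<^sub>0 nat) \<subseteq> {0..N} \<Longrightarrow> lookup m 0 = 0 \<Longrightarrow> keys m \<subseteq> {1..N}"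
proof
  fix i :: nat assume *: "keys m \<subseteq> {0..N}" "lookup m 0 = 0" "i \<in> keys m"
  then have "i \<noteq> 0" by (metis in_keys_iff)
  then have "1 \<le> i" by simp
  then show "i \<in> {1..N}" using * by auto
qed

lemma polys_S_R: "p \<in> polys {1..N} \<Longrightarrow> p \<in> polys {0..N}"
  by (rule polys_mono[of "{1..N}"]) auto

lemma polys_x0_deg_le: 
  assumes "s \<in> polys {0..N}" "x0_deg_le 0 s"
  shows "s \<in> polys {1..N}"
proof (rule polysI)
  fix m assume m: "m \<in> keys s"
  then have "keys m \<subseteq> {0..N}" "lookup m 0 = 0"
    using assms polys_keysD[OF assms(1)] by (auto simp: x0_deg_le_def)
  then show "keys m \<subseteq> {1..N}" by (rule keys_without_x0)
qed

lemma x0_deg_le_hom_part: "x0_deg_le i f \<Longrightarrow> x0_deg_le i (hom_part n f)"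
  by (auto simp: x0_deg_le_def keys_hom_part)

lemma d0_le_iff: "f \<noteq> 0 \<Longrightarrow> d0 f \<le> i \<longleftrightarrow> x0_deg_le i f"
  by (simp add: d0_def x0_deg_le_def)

lemma x0_deg_le_ex: "\<exists>i. x0_deg_le i f"
  by (cases "f = 0") (auto simp: d0_le_iff[symmetric])

lemma lookup_x0_coeff:
  "lookup (x0_coeff i f) m = (if lookup m 0 = 0 then lookup f (m + single 0 i) else 0)"
proof -
  let ?A = "{k \<in> keys f. lookup k 0 = i}"
  have *: "Poly_Mapping.update 0 0 k = m \<longleftrightarrow> lookup m 0 = 0 \<and> k = m + single 0 i" if "lookup k 0 = i" for k
    using that by (auto simp: poly_mapping_eq_iff fun_eq_iff lookup_update lookup_add lookup_single when_def)
  have "lookup (x0_coeff i f) m = (\<Sum>k\<in>?A. if Poly_Mapping.update 0 0 k = m then lookup f k else 0)"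
    by (simp add: x0_coeff_def lookup_sum lookup_single when_def)
  also have "\<dots> = (\<Sum>k\<in>?A. if k = m + single 0 i then (if lookup m 0 = 0 then lookup f k else 0) else 0)"
    by (rule sum.cong) (auto simp: *)
  also have "\<dots> = (if lookup m 0 = 0 then lookup f (m + single 0 i) else 0)"
    by (auto simp: sum.delta in_keys_iff lookup_add)
  finally show ?thesis .
qed

lemma x0_coeff_add: "x0_coeff i (f + g) = x0_coeff i f + x0_coeff i g"
  by (rule poly_mapping_eqI) (simp add: lookup_x0_coeff lookup_add)

lemma x0_coeff_diff: "x0_coeff i (f - g) = x0_coeff i f - x0_coeff i g"
  by (rule poly_mapping_eqI) (simp add: lookup_x0_coeff lookup_minus)

lemma x0_coeff_0 [simp]: "x0_coeff i 0 = 0"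
  by (rule poly_mapping_eqI) (simp add: lookup_x0_coeff)

lemma x0_coeff_sum: "x0_coeff i (sum f A) = (\<Sum>x\<in>A. x0_coeff i (f x))"
  by (induction A rule: infinite_finite_induct) (auto simp: x0_coeff_add)

lemma x0_coeff_single: "x0_coeff i (single m c) = (if lookup m 0 = i then single (Poly_Mapping.update 0 0 m) c else 0)"
  by (cases "c = 0") (auto simp: x0_coeff_def Collect_conv_if)

lemma x0_coeff_eq_0: "x0_deg_le i f \<Longrightarrow> i < j \<Longrightarrow> x0_coeff j f = 0"
proof (rule poly_mapping_eqI)
  fix m assume *: "x0_deg_le i f" "i < j"
  have "m + single 0 j \<notin> keys f"
  proof
    assume "m + single 0 j \<in> keys f"
    then have "lookup (m + single 0 j) 0 \<le> i" using * by (auto simp: x0_deg_le_def)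
    then show False using * by (simp add: lookup_add)
  qed
  then show "lookup (x0_coeff j f) m = lookup 0 m" by (simp add: lookup_x0_coeff in_keys_iff)
qed

lemma x0_coeff_polys: "f \<in> polys {0..N} \<Longrightarrow> x0_coeff i f \<in> polys {1..N}"
proof (rule polysI)
  fix m assume f: "f \<in> polys {0..N}" and "m \<in> keys (x0_coeff i f)"
  then have m: "lookup m 0 = 0" "m + single 0 i \<in> keys f"
    by (auto simp: in_keys_iff lookup_x0_coeff split: if_splits)
  then have "keys (m + single 0 i) \<subseteq> {0..N}" using f by (auto simp: polys_def)
  then have "keys m \<subseteq> {0..N}" by (simp add: keys_plus_nat)
  then show "keys m \<subseteq> {1..N}" using m by (intro keys_without_x0)
qed

lemma x0_coeff_0_id: "s \<in> polys V \<Longrightarrow> 0 \<notin> V \<Longrightarrow> x0_coeff 0 s = s"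
proof (rule poly_mapping_eqI)
  fix m assume *: "s \<in> polys V" "0 \<notin> V"
  have "lookup s m = 0" if "lookup m 0 \<noteq> 0"
  proof (rule ccontr)
    assume "lookup s m \<noteq> 0"
    then have "keys m \<subseteq> V" using * polys_keysD by (simp add: in_keys_iff)
    then show False using that * by (meson in_keys_iff subsetD)
  qed
  then show "lookup (x0_coeff 0 s) m = lookup s m" by (simp add: lookup_x0_coeff)
qed

lemma x0_coeff_mult:
  assumes s: "s \<in> polys V" "0 \<notin> V"
  shows "x0_coeff i (s * f) = s * x0_coeff i f"
  using s(1)
proof (induction s rule: polys_induct)
  case (add m c s)
  have m: "lookup m 0 = 0" using add(1) s(2) by (auto simp: in_keys_iff)
  have "x0_coeff i (single m c * f) = single m c * x0_coeff i f"
  proof (induction f rule: poly_mapping_monomial_induct)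
    case (add m' c' f)
    have "Poly_Mapping.update 0 0 (m + m') = m + Poly_Mapping.update 0 0 m'"
      using m by (auto intro!: poly_mapping_eqI simp: lookup_update lookup_add)
    then show ?case using m
      by (simp add: distrib_left x0_coeff_add add mult_single x0_coeff_single lookup_add)
  qed simp
  then show ?case using add by (simp add: distrib_right x0_coeff_add)
qed simp

lemma keys_var_mult: "keys (var i * f) = (+) (single i 1) ` keys f"
  unfolding var_def by (rule keys_single_times) simp

lemma x0_coeff_var_mult: "x0_coeff (Suc i) (var 0 * f) = x0_coeff i f"
proof (rule poly_mapping_eqI)
  fix m :: "nat \<Rightarrow>\<^sub>0 nat"
  have eq: "m + single 0 (Suc i) = single 0 1 + (m + single 0 i)"
    by (rule poly_mapping_eqI) (simp add: lookup_add lookup_single when_def One_nat_def)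
  show "lookup (x0_coeff (Suc i) (var 0 * f)) m = lookup (x0_coeff i f) m"
    unfolding lookup_x0_coeff eq var_def lookup_single_times_add by simp
qed

lemma x0_deg_le_var_mult: "x0_deg_le (Suc i) (var 0 * f) \<longleftrightarrow> x0_deg_le i f"
  unfolding x0_deg_le_def keys_var_mult by (simp add: lookup_add)

lemma polys_split_x0:
  assumes "p \<in> polys {0..N}"
  obtains s q where "s \<in> polys {1..N}" "q \<in> polys {0..N}" "p = s + var 0 * q"
proof -
  have "\<exists>s q. s \<in> polys {1..N} \<and> q \<in> polys {0..N} \<and> p = s + var 0 * q"
    using assms
  proof (induction p rule: polys_induct)
    case zero
    show ?case by (rule exI[of _ 0], rule exI[of _ 0]) auto
  next
    case (add m c p)
    then obtain s q where sq: "s \<in> polys {1..N}" "q \<in> polys {0..N}" "p = s + var 0 * q" by blast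
    show ?case
    proof (cases "lookup m 0 = 0")
      case True
      have "keys m \<subseteq> {1..N}"
        using add(1) True by (intro keys_without_x0)
      then have "single m c + s \<in> polys {1..N}" using sq by (intro polys_add polys_single)
      then show ?thesis using sq by (metis add.assoc)
    next
      case False
      have eq: "m = single 0 1 + (m - single 0 1)"
        by (rule exponent_diff_add) (use False in \<open>auto simp: lookup_single when_def One_nat_def\<close>)
      have "keys (m - single 0 1) \<subseteq> {0..N}"
        using add(1) by (subst (asm) eq) (simp add: keys_plus_nat)
      then have "single (m - single 0 1) c + q \<in> polys {0..N}" using sq by (intro polys_add polys_single)
      moreover have "single m c + p = s + var 0 * (single (m - single 0 1) c + q)"
        by (subst eq) (simp add: sq var_def distrib_left mult_single)
      ultimately show ?thesis using sq by blast
    qed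
  qed
  then show ?thesis using that by blast
qed

lemma homogeneous_ideal_ideal: "homogeneous_ideal V I \<Longrightarrow> ideal I (poly_ring V)"
  by (simp add: homogeneous_ideal_def)

lemma homogeneous_ideal_hom_part: "homogeneous_ideal V I \<Longrightarrow> f \<in> I \<Longrightarrow> hom_part n f \<in> I"
  by (simp add: homogeneous_ideal_def)

text \<open>A polynomial is the sum of its homogeneous parts, which lie in \<open>I\<close> and have
  supports contained in that of the polynomial. So both conditions may be checked on the whole
  polynomial.\<close>

lemma pre_elim_eq:
  assumes I: "homogeneous_ideal V I"
  shows "pre_elim I i = {f \<in> I. x0_deg_le i f}"
proof (intro equalityI subsetI)
  fix f assume f: "f \<in> pre_elim I i"
  have "f = (\<Sum>n\<in>mdeg ` keys f. hom_part n f)" by (simp add: sum_hom_parts)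
  then have 1: "f \<in> I" using f ideal_sum[OF homogeneous_ideal_ideal[OF I], of "mdeg ` keys f" "\<lambda>n. hom_part n f"]
    by (simp add: pre_elim_def)
  have "lookup m 0 \<le> i" if m: "m \<in> keys f" for m
  proof -
    have *: "m \<in> keys (hom_part (mdeg m) f)" using m by (simp add: keys_hom_part)
    then have "hom_part (mdeg m) f \<noteq> 0" by auto
    then have "x0_deg_le i (hom_part (mdeg m) f)" using f d0_le_iff unfolding pre_elim_def by blast
    then show ?thesis using * by (simp add: x0_deg_le_def)
  qed
  then show "f \<in> {f \<in> I. x0_deg_le i f}" using 1 by (simp add: x0_deg_le_def)
next
  fix f assume f: "f \<in> {f \<in> I. x0_deg_le i f}"
  then show "f \<in> pre_elim I i"
    using homogeneous_ideal_hom_part[OF I, of f] x0_deg_le_hom_part[of i f] d0_le_iff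
    unfolding pre_elim_def by blast
qed

text \<open>Multiplication by an element of S does not raise the degree in x_0 and multiplies the
  leading coefficient. So the leading coefficients already form an ideal of S, and generating adds
  nothing.\<close>

lemma partial_elim_eq:
  assumes I: "homogeneous_ideal {0..N} I"
  shows "partial_elim N I i = x0_coeff i ` {f \<in> I. x0_deg_le i f}"
proof -
  let ?K = "x0_coeff i ` {f \<in> I. x0_deg_le i f}"
  note i = homogeneous_ideal_ideal[OF I]
  have "ideal ?K (poly_ring {1..N})"
    unfolding ideal_poly_ring_iff
  proof (intro conjI ballI)
    show "?K \<subseteq> polys {1..N}" using x0_coeff_polys ideal_polys[OF i] by blast
    show "0 \<in> ?K" using ideal_0[OF i] by (intro image_eqI[of _ _ 0]) auto
    show "a + b \<in> ?K" if "a \<in> ?K" "b \<in> ?K" for a b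
    proof -
      from that obtain f g where "a = x0_coeff i f" "f \<in> I" "x0_deg_le i f"
        "b = x0_coeff i g" "g \<in> I" "x0_deg_le i g" by auto
      then show ?thesis using ideal_add[OF i]
        by (intro image_eqI[of _ _ "f + g"]) (auto simp: x0_coeff_add x0_deg_le_add)
    qed
    show "p * a \<in> ?K" if "a \<in> ?K" "p \<in> polys {1..N}" for a p
    proof -
      from that obtain f where f: "a = x0_coeff i f" "f \<in> I" "x0_deg_le i f" by auto
      have "p * f \<in> I" using f that by (intro ideal_mult[OF i] polys_S_R)
      moreover have "x0_deg_le i (p * f)" using x0_deg_le_mult[OF x0_deg_le_polys[OF that(2)] f(3)] by simp
      moreover have "x0_coeff i (p * f) = p * a" using x0_coeff_mult[of p "{1..N}" i f] that f by simp
      ultimately show ?thesis by force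
    qed
  qed
  then show ?thesis unfolding partial_elim_def pre_elim_eq[OF I] by (rule gen_of_ideal)
qed

lemma partial_elim_ideal:
  assumes I: "homogeneous_ideal {0..N} I"
  shows "ideal (partial_elim N I i) (poly_ring {1..N})"
  unfolding partial_elim_def pre_elim_eq[OF I]
  by (rule gen_ideal) (use x0_coeff_polys ideal_polys[OF homogeneous_ideal_ideal[OF I]] in blast)

lemma partial_elim_0:
  assumes I: "homogeneous_ideal {0..N} I"
  shows "partial_elim N I 0 = I \<inter> polys {1..N}"
proof -
  note i = homogeneous_ideal_ideal[OF I]
  have "{f \<in> I. x0_deg_le 0 f} = I \<inter> polys {1..N}"
  proof (intro equalityI subsetI)
    fix f assume "f \<in> I \<inter> polys {1..N}"
    then show "f \<in> {f \<in> I. x0_deg_le 0 f}" using x0_deg_le_polys[of f "{1..N}"] by simp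
  qed (use polys_x0_deg_le ideal_polys[OF i] in blast)
  moreover have "x0_coeff 0 ` (I \<inter> polys {1..N}) = (\<lambda>f. f) ` (I \<inter> polys {1..N})"
    by (rule image_cong) (auto intro: x0_coeff_0_id)
  ultimately show ?thesis unfolding partial_elim_eq[OF I] by simp
qed

lemma partial_elim_Suc_mono:
  assumes I: "homogeneous_ideal {0..N} I"
  shows "partial_elim N I i \<subseteq> partial_elim N I (Suc i)"
  unfolding partial_elim_eq[OF I]
proof clarify
  fix f assume "f \<in> I" "x0_deg_le i f"
  then show "x0_coeff i f \<in> x0_coeff (Suc i) ` {f \<in> I. x0_deg_le (Suc i) f}"
    by (intro image_eqI[of _ _ "var 0 * f"])
      (auto simp: x0_coeff_var_mult x0_deg_le_var_mult ideal_mult[OF homogeneous_ideal_ideal[OF I]])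
qed

lemma partial_elim_mono:
  assumes "homogeneous_ideal {0..N} I" "i \<le> j"
  shows "partial_elim N I i \<subseteq> partial_elim N I j"
  using partial_elim_Suc_mono[OF assms(1)] assms(2) by (rule lift_Suc_mono_le)

text \<open>The decomposable elements form an ideal of R containing \<open>G\<close>. The degree of
  \<open>w\<close> need not be controlled, so cancellation between the two summands is never an
  issue.\<close>

lemma generated_x0_split:
  assumes G: "G \<subseteq> polys {0..N}" "\<And>g. g \<in> G \<Longrightarrow> x0_deg_le D g"
    and f: "f \<in> gen {0..N} G"
  obtains w s where "w \<in> gen {0..N} G" "s \<in> gen {0..N} G" "x0_deg_le D s" "f = var 0 * w + s"
proof -
  let ?I = "gen {0..N} G"
  note i = gen_ideal[OF G(1)]
  let ?U = "{var 0 * w + s | w s. w \<in> ?I \<and> s \<in> ?I \<and> x0_deg_le D s}"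
  have "ideal ?U (poly_ring {0..N})"
    unfolding ideal_poly_ring_iff
  proof (intro conjI ballI)
    show "?U \<subseteq> polys {0..N}" using ideal_polys[OF i] by auto
    show "0 \<in> ?U" using ideal_0[OF i] by (auto intro!: exI[of _ 0])
    show "a + b \<in> ?U" if ab: "a \<in> ?U" "b \<in> ?U" for a b
    proof -
      from ab obtain w s w' s' where
        "a = var 0 * w + s" "w \<in> ?I" "s \<in> ?I" "x0_deg_le D s"
        "b = var 0 * w' + s'" "w' \<in> ?I" "s' \<in> ?I" "x0_deg_le D s'" by blast
      then show ?thesis using ideal_add[OF i]
        by (intro CollectI exI[of _ "w + w'"] exI[of _ "s + s'"]) (auto simp: distrib_left x0_deg_le_add)
    qed
    show "p * a \<in> ?U" if ap: "a \<in> ?U" "p \<in> polys {0..N}" for a p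
    proof -
      from ap obtain w s where a: "a = var 0 * w + s" "w \<in> ?I" "s \<in> ?I" "x0_deg_le D s" by blast
      from ap(2) obtain p0 q where p: "p0 \<in> polys {1..N}" "q \<in> polys {0..N}" "p = p0 + var 0 * q"
        by (rule polys_split_x0)
      have p0: "p0 \<in> polys {0..N}" using p(1) by (rule polys_S_R)
      have "x0_deg_le (0 + D) (p0 * s)"
        using x0_deg_le_mult[OF x0_deg_le_polys[OF p(1)] a(4)] by simp
      \<comment> \<open>With p = p0 + x_0 q, only \<open>p0 * s\<close> must respect the bound on
        the degree in x_0, and \<open>p0\<close> is free of x_0; all the rest is a multiple of
        x_0.\<close>
      moreover have "p * a = var 0 * (p * w + q * s) + p0 * s" by (simp add: a p algebra_simps)
      moreover have "p * w + q * s \<in> ?I" "p0 * s \<in> ?I"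
        using a p p0 ap by (auto intro!: ideal_add[OF i] ideal_mult[OF i])
      ultimately show ?thesis by auto
    qed
  qed
  moreover have "G \<subseteq> ?U"
  proof
    fix g assume "g \<in> G"
    then show "g \<in> ?U" using gen_incl[OF G(1)] G(2) ideal_0[OF i]
      by (intro CollectI exI[of _ 0] exI[of _ g]) auto
  qed
  ultimately have "?I \<subseteq> ?U" by (rule gen_minimal)
  then show ?thesis using f that by blast
qed

text \<open>For f = x_0 w + s of degree at most j + 1 in x_0, with j at least \<open>D\<close>, the
  term \<open>s\<close> does not reach x_0^(j+1). So \<open>w\<close> has degree at most j in x_0
  and carries the same leading coefficient.\<close>

lemma partial_elim_stable:
  assumes I: "homogeneous_ideal {0..N} I"
    and G: "G \<subseteq> polys {0..N}" "\<And>g. g \<in> G \<Longrightarrow> x0_deg_le D g" "I = gen {0..N} G"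
    and "D \<le> i"
  shows "partial_elim N I i = partial_elim N I D"
proof -
  have "partial_elim N I (Suc j) \<subseteq> partial_elim N I j" if j: "D \<le> j" for j
    unfolding partial_elim_eq[OF I]
  proof clarify
    fix f assume f: "f \<in> I" "x0_deg_le (Suc j) f"
    then obtain w s where ws: "w \<in> I" "s \<in> I" "x0_deg_le D s" "f = var 0 * w + s"
      using generated_x0_split[OF G(1,2), of f] G(3) by blast
    have "x0_deg_le (Suc j) (f - s)" using f ws j by (intro x0_deg_le_diff) (auto intro: x0_deg_le_mono)
    then have "x0_deg_le j w" by (simp add: ws x0_deg_le_var_mult)
    moreover have "x0_coeff (Suc j) f = x0_coeff j w"
      using x0_coeff_eq_0[OF ws(3), of "Suc j"] j by (simp add: ws x0_coeff_add x0_coeff_var_mult)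
    ultimately show "x0_coeff (Suc j) f \<in> x0_coeff j ` {f \<in> I. x0_deg_le j f}" using ws by auto
  qed
  then have "partial_elim N I (Suc j) = partial_elim N I j" if "D \<le> j" for j
    using partial_elim_Suc_mono[OF I, of j] that by blast
  with \<open>D \<le> i\<close> show ?thesis by (induction i rule: dec_induct) auto
qed

subsection \<open>Dehomogenisation and the tangent cone\<close>

text \<open>On forms of degree \<open>M\<close> setting x_0 = 1 merges no monomials: the lost
  exponent of x_0 is \<open>M - mdeg m\<close>.\<close>

lemma lookup_dehom_form:
  assumes F: "F \<in> forms V M"
  shows "lookup (dehom 0 F) m =
    (if lookup m 0 = 0 \<and> mdeg m \<le> M then lookup F (m + single 0 (M - mdeg m)) else 0)"
proof -
  have *: "Poly_Mapping.update 0 0 k = m \<longleftrightarrow> lookup m 0 = 0 \<and> mdeg m \<le> M \<and> k = m + single 0 (M - mdeg m)"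
    if k: "k \<in> keys F" for k
  proof
    assume u: "Poly_Mapping.update 0 0 k = m"
    then have k': "k = m + single 0 (lookup k 0)"
      by (auto intro!: poly_mapping_eqI simp: lookup_add lookup_update lookup_single when_def)
    have "mdeg k = M" using F k by (auto dest: forms_keysD)
    then have "mdeg m + lookup k 0 = M" by (subst (asm) k') (simp add: mdeg_add)
    then have "lookup k 0 = M - mdeg m" "mdeg m \<le> M" by auto
    then show "lookup m 0 = 0 \<and> mdeg m \<le> M \<and> k = m + single 0 (M - mdeg m)"
      using k' u by (metis lookup_update)
  next
    assume "lookup m 0 = 0 \<and> mdeg m \<le> M \<and> k = m + single 0 (M - mdeg m)"
    then show "Poly_Mapping.update 0 0 k = m"
      by (auto intro!: poly_mapping_eqI simp: lookup_add lookup_update lookup_single when_def)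
  qed
  have "lookup (dehom 0 F) m = (\<Sum>k\<in>keys F. if Poly_Mapping.update 0 0 k = m then lookup F k else 0)"
    by (simp add: dehom_def lookup_sum lookup_single when_def)
  also have "\<dots> = (\<Sum>k\<in>keys F. if k = m + single 0 (M - mdeg m)
      then (if lookup m 0 = 0 \<and> mdeg m \<le> M then lookup F k else 0) else 0)"
    by (rule sum.cong) (auto simp: *)
  also have "\<dots> = (if lookup m 0 = 0 \<and> mdeg m \<le> M then lookup F (m + single 0 (M - mdeg m)) else 0)"
    by (auto simp: sum.delta in_keys_iff)
  finally show ?thesis .
qed

lemma dehom_polys: "p \<in> polys {0..N} \<Longrightarrow> dehom 0 p \<in> polys {1..N}"
proof (induction p rule: polys_induct)
  case (add m c p)
  have "keys (Poly_Mapping.update 0 0 m) \<subseteq> {1..N}"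
    using add(1) by (auto simp: keys_update Suc_le_eq)
  then show ?case using add by (auto simp: dehom_add dehom_single intro!: polys_add polys_single)
qed simp

lemma initial_form_eq:
  assumes "hom_part r f \<noteq> 0" "\<And>m. m \<in> keys f \<Longrightarrow> r \<le> mdeg m"
  shows "initial_form f = hom_part r f"
proof -
  obtain m where "m \<in> keys (hom_part r f)" using assms(1) by (metis keys_eq_empty ex_in_conv)
  then have "m \<in> keys f" "mdeg m = r" by (auto simp: keys_hom_part)
  then have "Min (mdeg ` keys f) = r" using assms(2) by (intro Min_eqI) auto
  then show ?thesis by (simp add: initial_form_def)
qed

lemma initial_form_props:
  assumes "f \<noteq> 0"
  obtains r where "initial_form f = hom_part r f" "hom_part r f \<noteq> 0" "\<And>m. m \<in> keys f \<Longrightarrow> r \<le> mdeg m"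
proof -
  let ?r = "Min (mdeg ` keys f)"
  have "?r \<in> mdeg ` keys f" using assms by (intro Min_in) auto
  then obtain m where m: "m \<in> keys f" "mdeg m = ?r" by auto
  then have "m \<in> keys (hom_part ?r f)" by (simp add: keys_hom_part)
  then have "hom_part ?r f \<noteq> 0" by auto
  then show ?thesis using that[of ?r] by (auto simp: initial_form_def)
qed

lemma hom_part_dehom:
  assumes F: "F \<in> forms V M" and i: "i \<le> M"
  shows "hom_part (M - i) (dehom 0 F) = x0_coeff i F"
proof (rule poly_mapping_eqI)
  fix m
  have "lookup F (m + single 0 i) = 0" if "mdeg m \<noteq> M - i"
  proof (rule ccontr)
    assume "lookup F (m + single 0 i) \<noteq> 0"
    then have "mdeg (m + single 0 i) = M" using F by (auto simp: graded_def in_keys_iff)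
    then show False using that by (simp add: mdeg_add)
  qed
  then show "lookup (hom_part (M - i) (dehom 0 F)) m = lookup (x0_coeff i F) m"
    using i by (auto simp: lookup_hom_part lookup_dehom_form[OF F] lookup_x0_coeff)
qed

text \<open>In a form of degree M the coefficient of x_0^i has degree M - i, so the highest power of
  x_0 corresponds to the lowest degree after dehomogenisation.\<close>

lemma initial_form_dehom:
  assumes F: "F \<in> forms V M" and i: "x0_deg_le i F" "x0_coeff i F \<noteq> 0"
  shows "initial_form (dehom 0 F) = x0_coeff i F" "dehom 0 F \<noteq> 0"
proof -
  obtain k where "k \<in> keys (x0_coeff i F)" using i(2) by (metis keys_eq_empty ex_in_conv)
  then have "k + single 0 i \<in> keys F" by (auto simp: in_keys_iff lookup_x0_coeff split: if_splits)
  then have iM: "i \<le> M" using F by (auto simp: graded_def mdeg_add dest!: bspec)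
  have eq: "hom_part (M - i) (dehom 0 F) = x0_coeff i F" by (rule hom_part_dehom[OF F iM])
  show "dehom 0 F \<noteq> 0" using eq i(2) by auto
  have "initial_form (dehom 0 F) = hom_part (M - i) (dehom 0 F)"
  proof (rule initial_form_eq)
    show "hom_part (M - i) (dehom 0 F) \<noteq> 0" using eq i(2) by simp
    fix m assume "m \<in> keys (dehom 0 F)"
    then have m: "lookup m 0 = 0" "mdeg m \<le> M" "m + single 0 (M - mdeg m) \<in> keys F"
      by (auto simp: in_keys_iff lookup_dehom_form[OF F] split: if_splits)
    then have "lookup (m + single 0 (M - mdeg m)) 0 \<le> i" using i(1) by (auto simp: x0_deg_le_def)
    then show "M - i \<le> mdeg m" using m by (simp add: lookup_add)
  qed
  with eq show "initial_form (dehom 0 F) = x0_coeff i F" by simp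
qed

lemma homogenise_in_ideal:
  assumes I: "homogeneous_ideal {0..N} I" and F: "F \<in> I"
  obtains M F' where "F' \<in> I" "F' \<in> forms {0..N} M" "dehom 0 F' = dehom 0 F"
proof -
  note i = homogeneous_ideal_ideal[OF I]
  have Fp: "F \<in> polys {0..N}" using ideal_polys[OF i F] .
  let ?M = "Max (insert 0 (mdeg ` keys F))"
  \<comment> \<open>Each homogeneous part, itself in \<open>I\<close>, is padded by a power of x_0,
    which dehomogenisation does not see.\<close>
  let ?F = "\<Sum>n\<in>mdeg ` keys F. single (single 0 (?M - n)) 1 * hom_part n F"
  have "?F \<in> I"
    using F by (intro ideal_sum[OF i] ideal_mult[OF i] homogeneous_ideal_hom_part[OF I] polys_single) auto
  moreover have "?F \<in> forms {0..N} ?M"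
  proof (rule graded_sum)
    fix n assume n: "n \<in> mdeg ` keys F"
    have "single (single 0 (?M - n)) 1 * hom_part n F \<in> forms {0..N} (mdeg (single 0 (?M - n)) + n)"
      by (rule forms_mult[OF forms_single hom_part_forms[OF Fp]]) simp
    moreover have "n \<le> ?M" using n by (intro Max_ge) auto
    ultimately show "single (single 0 (?M - n)) 1 * hom_part n F \<in> forms {0..N} ?M" by simp
  qed
  moreover have "dehom 0 ?F = dehom 0 F"
  proof -
    have u: "Poly_Mapping.update 0 0 (single 0 k) = (0 :: nat \<Rightarrow>\<^sub>0 nat)" for k
      by (rule poly_mapping_eqI) (simp add: lookup_update lookup_single when_def)
    have "dehom 0 ?F = (\<Sum>n\<in>mdeg ` keys F. dehom 0 (hom_part n F))"
      by (simp add: dehom_sum dehom_mult dehom_single u)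
    also have "\<dots> = dehom 0 (\<Sum>n\<in>mdeg ` keys F. hom_part n F)" by (simp add: dehom_sum)
    also have "\<dots> = dehom 0 F" by (simp add: sum_hom_parts)
    finally show ?thesis .
  qed
  ultimately show ?thesis using that by blast
qed

text \<open>The chart ideal consists of dehomogenised elements of \<open>I\<close>, which may be
  taken to be forms; their initial forms are then leading coefficients in x_0, and
  conversely.\<close>

lemma tangent_cone_eq_partial_elim:
  assumes def: "defining_ideal N X I"
    and stable: "\<And>i. D \<le> i \<Longrightarrow> partial_elim N I i = partial_elim N I D"
  shows "partial_elim N I D = tangent_cone_ideal N X"
proof -
  have I: "homogeneous_ideal {0..N} I" and ch: "chart_ideal N X 0 = dehom 0 ` I"
    using def by (auto simp: defining_ideal_def)
  note i = homogeneous_ideal_ideal[OF I]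
  let ?T = "{initial_form f | f. f \<in> chart_ideal N X 0 \<and> f \<noteq> 0}"
  have T_sub: "?T \<subseteq> partial_elim N I D"
  proof clarify
    fix f assume "f \<in> chart_ideal N X 0" and f0: "f \<noteq> 0"
    then obtain F0 where "F0 \<in> I" "f = dehom 0 F0" using ch by auto
    then obtain M F where F: "F \<in> I" "F \<in> forms {0..N} M" "f = dehom 0 F"
      using homogenise_in_ideal[OF I, of F0] by metis
    then have Fn: "F \<noteq> 0" using f0 by auto
    let ?i = "d0 F"
    have le: "x0_deg_le ?i F" using d0_le_iff[OF Fn] by blast
    have "?i \<in> (\<lambda>m. lookup m 0) ` keys F" unfolding d0_def using Fn by (intro Max_in) auto
    then obtain m where m: "m \<in> keys F" "lookup m 0 = ?i" by auto
    have "Poly_Mapping.update 0 0 m + single 0 ?i = m"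
      using m by (auto intro!: poly_mapping_eqI simp: lookup_add lookup_update lookup_single when_def)
    then have "lookup (x0_coeff ?i F) (Poly_Mapping.update 0 0 m) \<noteq> 0"
      using m by (simp add: lookup_x0_coeff lookup_update in_keys_iff)
    then have "x0_coeff ?i F \<noteq> 0" by auto
    then have "initial_form f = x0_coeff ?i F" using initial_form_dehom[OF F(2) le] F by simp
    then have 1: "initial_form f \<in> partial_elim N I ?i" unfolding partial_elim_eq[OF I] using F le by auto
    \<comment> \<open>The degree of \<open>F\<close> in x_0 is arbitrary: below \<open>D\<close> the
      ideals increase, above \<open>D\<close> they are constant.\<close>
    show "initial_form f \<in> partial_elim N I D"
    proof (cases "?i \<le> D")
      case True
      then show ?thesis using 1 partial_elim_mono[OF I True] by blast
    next
      case False
      then show ?thesis using 1 stable[of ?i] by simp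
    qed
  qed
  then have Tp: "?T \<subseteq> polys {1..N}" using ideal_polys[OF partial_elim_ideal[OF I]] by blast
  have "partial_elim N I D \<subseteq> gen {1..N} ?T"
    unfolding partial_elim_eq[OF I]
  proof clarify
    fix F assume F: "F \<in> I" "x0_deg_le D F"
    \<comment> \<open>\<open>F\<close> need not be homogeneous, so its leading coefficient is only a
      sum of initial forms. A part of smaller degree in x_0 contributes zero.\<close>
    have "x0_coeff D F = (\<Sum>n\<in>mdeg ` keys F. x0_coeff D (hom_part n F))"
      by (subst sum_hom_parts[of "mdeg ` keys F" F, symmetric]) (auto simp: x0_coeff_sum)
    moreover have "x0_coeff D (hom_part n F) \<in> gen {1..N} ?T" for n
    proof (cases "x0_coeff D (hom_part n F) = 0")
      case True
      then show ?thesis using ideal_0[OF gen_ideal[OF Tp]] by simp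
    next
      case False
      have *: "hom_part n F \<in> forms {0..N} n" using hom_part_forms ideal_polys[OF i F(1)] by blast
      note init = initial_form_dehom[OF * x0_deg_le_hom_part[OF F(2)] False]
      have "dehom 0 (hom_part n F) \<in> chart_ideal N X 0"
        using ch homogeneous_ideal_hom_part[OF I F(1)] by blast
      then have "x0_coeff D (hom_part n F) \<in> ?T" using init by force
      then show ?thesis by (rule gen_incl[OF Tp])
    qed
    ultimately show "x0_coeff D F \<in> gen {1..N} ?T"
      using ideal_sum[OF gen_ideal[OF Tp], of "mdeg ` keys F" "\<lambda>n. x0_coeff D (hom_part n F)"] by simp
  qed
  moreover have "gen {1..N} ?T \<subseteq> partial_elim N I D"
    by (rule gen_minimal[OF partial_elim_ideal[OF I] T_sub])
  ultimately show ?thesis by (auto simp: tangent_cone_ideal_def)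
qed

subsection \<open>Generators from the vanishing of Tor\<close>

lemma polys_irrelevant_decomp:
  assumes "p \<in> polys V" "finite V"
  shows "\<exists>c. (\<forall>a. c a \<in> polys V) \<and> p = single 0 (lookup p 0) + (\<Sum>a\<in>V. var a * c a)"
  using assms(1)
proof (induction p rule: polys_induct)
  case zero
  show ?case by (rule exI[of _ "\<lambda>_. 0"]) simp
next
  case (add m k p)
  then obtain c where c: "\<forall>a. c a \<in> polys V" "p = single 0 (lookup p 0) + (\<Sum>a\<in>V. var a * c a)" by blast
  show ?case
  proof (cases "m = 0")
    case True
    have "single m k + p = single 0 (lookup (single m k + p) 0) + (\<Sum>a\<in>V. var a * c a)"
      by (subst c(2)) (simp add: True lookup_add single_add add.assoc)
    then show ?thesis using c(1) by blast
  next
    case False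
    then obtain i where i: "lookup m i \<noteq> 0" by (metis lookup_zero poly_mapping_eqI)
    have eq: "m = single i 1 + (m - single i 1)"
      by (rule exponent_diff_add) (use i in \<open>auto simp: lookup_single when_def One_nat_def\<close>)
    have "keys m = insert i (keys (m - single i 1))" by (subst eq) (simp add: keys_plus_nat)
    then have iV: "i \<in> V" "keys (m - single i 1) \<subseteq> V" using add(1) by auto
    let ?c = "\<lambda>a. c a + (if a = i then single (m - single i 1) k else 0)"
    have "(\<Sum>a\<in>V. var a * ?c a) = (\<Sum>a\<in>V. var a * c a) + (\<Sum>a\<in>V. if a = i then var i * single (m - single i 1) k else 0)"
      by (subst sum.distrib[symmetric], rule sum.cong) (auto simp: distrib_left)
    also have "\<dots> = (\<Sum>a\<in>V. var a * c a) + var i * single (m - single i 1) k"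
      using iV assms(2) by simp
    also have "var i * single (m - single i 1) k = single m k"
      by (subst (2) eq) (simp add: var_def mult_single)
    finally have s: "(\<Sum>a\<in>V. var a * ?c a) = (\<Sum>a\<in>V. var a * c a) + single m k" .
    have l: "lookup (single m k + p) 0 = lookup p 0" using False by (simp add: lookup_add lookup_single)
    have "single m k + p = single 0 (lookup (single m k + p) 0) + (\<Sum>a\<in>V. var a * ?c a)"
      unfolding s l by (subst c(2)) (simp add: add_ac)
    moreover have "\<forall>a. ?c a \<in> polys V" using c(1) iV by (auto intro!: polys_add polys_single)
    ultimately show ?thesis by (intro exI[of _ ?c] conjI)
  qed
qed

lemma forms_Suc_decomp:
  assumes "f \<in> forms V (Suc j)" "finite V"
  obtains c where "\<And>a. c a \<in> forms V j" "f = (\<Sum>a\<in>V. var a * c a)"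
proof -
  obtain c where c: "\<forall>a. c a \<in> polys V" "f = single 0 (lookup f 0) + (\<Sum>a\<in>V. var a * c a)"
    using polys_irrelevant_decomp[OF graded_polys[OF assms(1)] assms(2)] by blast
  have "lookup f 0 = 0"
  proof (rule ccontr)
    assume "lookup f 0 \<noteq> 0"
    then show False using forms_keysD[OF assms(1), of 0] by (simp add: in_keys_iff)
  qed
  then have "hom_part (Suc j) f = (\<Sum>a\<in>V. hom_part (1 + j) (var a * c a))"
    by (subst c(2)) (simp only: hom_part_sum single_zero add_0_left plus_1_eq_Suc)
  also have "\<dots> = (\<Sum>a\<in>V. var a * hom_part j (c a))"
    by (rule sum.cong[OF refl hom_part_mult_form]) (rule forms_var)
  finally have "f = (\<Sum>a\<in>V. var a * hom_part j (c a))" using assms(1) by (simp add: hom_part_of_form)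
  then show ?thesis using that[of "\<lambda>a. hom_part j (c a)"] c(1) hom_part_forms by blast
qed

text \<open>The summands are antisymmetric in the two indices, so the double sum equals its own
  negative; in characteristic zero it vanishes.\<close>

lemma koszul_diff_squared_1:
  fixes b :: "nat set \<Rightarrow> ('k::field_char_0) mpoly"
  shows "(\<Sum>a\<in>{0..N}. var a * koszul_diff N b {a}) = 0"
proof -
  define t where "t = (\<lambda>a a'. if a = a' then 0 else (if a < a' then - 1 else 1) * (var a * var a' * b {a, a'}))"
  have *: "var a * koszul_diff N b {a} = (\<Sum>a'\<in>{0..N}. t a a')" if "a \<in> {0..N}" for a
  proof -
    have "card {x \<in> {a}. x < a'} = (if a < a' then 1 else 0)" for a' by (simp add: Collect_conv_if)
    then have "var a * koszul_diff N b {a} = (\<Sum>a'\<in>{0..N} - {a}. t a a')"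
      unfolding koszul_diff_def t_def sum_distrib_left
      by (intro sum.cong) (auto simp: insert_commute mult_ac)
    also have "\<dots> = (\<Sum>a'\<in>{0..N}. t a a')" by (rule sum.mono_neutral_left) (auto simp: t_def)
    finally show ?thesis .
  qed
  define T where "T = (\<Sum>a\<in>{0..N}. \<Sum>a'\<in>{0..N}. t a a')"
  have neg: "t a' a = - t a a'" for a a' by (auto simp: t_def mult_ac insert_commute)
  have "(\<Sum>a\<in>{0..N}. \<Sum>a'\<in>{0..N}. t a' a) = (\<Sum>a\<in>{0..N}. \<Sum>a'\<in>{0..N}. - t a a')"
    by (intro sum.cong refl neg)
  also have "\<dots> = - T" by (simp add: T_def sum_negf)
  finally have "(\<Sum>a\<in>{0..N}. \<Sum>a'\<in>{0..N}. t a' a) = - T" .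
  moreover have "(\<Sum>a\<in>{0..N}. \<Sum>a'\<in>{0..N}. t a' a) = T" unfolding T_def by (rule sum.swap)
  ultimately have "2 * T = 0" by simp
  then have "T = 0" by simp
  then show ?thesis by (simp add: * T_def)
qed

text \<open>Writing f as the sum of x_a c_a makes c a Koszul 1-cycle modulo I. Vanishing of Tor
  makes it a boundary modulo I; subtracting that boundary moves the coefficients into I and leaves
  the sum unchanged, as the differential squares to zero.\<close>

lemma tor_1_generators:
  fixes I :: "('k::field_char_0) mpoly set"
  assumes I: "homogeneous_ideal {0..N} I" and tor: "tor_vanishes N I 1 j"
    and f: "f \<in> I" "f \<in> forms {0..N} (Suc j)"
  obtains g where "\<And>a. a \<in> {0..N} \<Longrightarrow> g a \<in> I \<inter> forms {0..N} j" "f = (\<Sum>a\<in>{0..N}. var a * g a)"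
proof -
  obtain c where c: "\<And>a. c a \<in> forms {0..N} j" "f = (\<Sum>a\<in>{0..N}. var a * c a)"
    using forms_Suc_decomp[OF f(2)] by auto
  \<comment> \<open>Koszul 1-chains are indexed by one-element sets.\<close>
  let ?c = "\<lambda>A. c (the_elem A)"
  have "koszul_diff N ?c B \<in> I" if B: "B \<subseteq> {0..N} \<and> Suc (card B) = 1" for B
  proof -
    have "B = {}" using B finite_subset[of B "{0..N}"] by simp
    then show ?thesis using f c by (simp add: koszul_diff_def)
  qed
  then obtain b where b: "\<And>A. A \<subseteq> {0..N} \<Longrightarrow> card A = 1 \<Longrightarrow> ?c A - koszul_diff N b A \<in> I"
    using tor c(1) unfolding tor_vanishes_def by metis
  \<comment> \<open>Passing to degree j makes the coefficients homogeneous without any appeal to the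
    degrees of \<open>b\<close>; they stay in \<open>I\<close> because \<open>I\<close> is
    homogeneous.\<close>
  let ?g = "\<lambda>a. hom_part j (c a - koszul_diff N b {a})"
  have g: "c a - koszul_diff N b {a} \<in> I" if "a \<in> {0..N}" for a using b[of "{a}"] that by simp
  have "f = (\<Sum>a\<in>{0..N}. var a * (c a - koszul_diff N b {a}))"
    using c(2) koszul_diff_squared_1[of N b] by (simp add: right_diff_distrib sum_subtractf)
  then have "hom_part (Suc j) f = (\<Sum>a\<in>{0..N}. hom_part (1 + j) (var a * (c a - koszul_diff N b {a})))"
    by (metis (no_types, lifting) hom_part_sum plus_1_eq_Suc sum.cong)
  also have "\<dots> = (\<Sum>a\<in>{0..N}. var a * ?g a)"
    by (rule sum.cong[OF refl hom_part_mult_form]) (rule forms_var)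
  finally have "f = (\<Sum>a\<in>{0..N}. var a * ?g a)" using f(2) by (simp add: hom_part_of_form)
  moreover have "?g a \<in> I \<inter> forms {0..N} j" if "a \<in> {0..N}" for a
    using homogeneous_ideal_hom_part[OF I g[OF that], of j] hom_part_forms[of _ "{0..N}" j]
      ideal_polys[OF homogeneous_ideal_ideal[OF I] g[OF that]] by blast
  ultimately show ?thesis using that[of ?g] by blast
qed

lemma property_N_generators:
  fixes I :: "('k::field_char_0) mpoly set"
  assumes I: "homogeneous_ideal {0..N} I" and p: "property_N N I d 1"
  shows "I = gen {0..N} (\<Union>n\<le>d. I \<inter> forms {0..N} n)" (is "_ = gen _ ?G")
proof
  note i = homogeneous_ideal_ideal[OF I]
  have G: "?G \<subseteq> polys {0..N}" by (auto dest: graded_polys)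
  note gi = gen_ideal[OF G]
  have *: "f \<in> gen {0..N} ?G" if "f \<in> I" "f \<in> forms {0..N} n" for f n
    using that
  proof (induction n arbitrary: f)
    case 0
    then show ?case by (intro gen_incl[OF G]) auto
  next
    case (Suc j)
    show ?case
    proof (cases "Suc j \<le> d")
      case True
      then show ?thesis using Suc by (intro gen_incl[OF G]) auto
    next
      case False
      \<comment> \<open>\<open>tor_vanishes N I 1 j\<close> concerns total degree j + 1, so a form
        of degree j + 1 > d meets the range j \<ge> d exactly.\<close>
      then have "tor_vanishes N I 1 j" using p by (simp add: property_N_def)
      then obtain g where "\<And>a. a \<in> {0..N} \<Longrightarrow> g a \<in> I \<inter> forms {0..N} j" "f = (\<Sum>a\<in>{0..N}. var a * g a)"
        using tor_1_generators[OF I _ Suc.prems] by metis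
      then show ?thesis using Suc.IH by (auto intro!: ideal_sum[OF gi] ideal_mult[OF gi] simp del: UN_simps)
    qed
  qed
  show "I \<subseteq> gen {0..N} ?G"
  proof
    fix f assume f: "f \<in> I"
    have "hom_part n f \<in> gen {0..N} ?G" for n
      using * homogeneous_ideal_hom_part[OF I f] hom_part_forms[OF ideal_polys[OF i f]] by blast
    then have "(\<Sum>n\<in>mdeg ` keys f. hom_part n f) \<in> gen {0..N} ?G" by (intro ideal_sum[OF gi])
    then show "f \<in> gen {0..N} ?G" by (simp add: sum_hom_parts)
  qed
  show "gen {0..N} ?G \<subseteq> I" by (rule gen_minimal[OF i]) auto
qed

lemma eval_origin: "eval_mpoly origin_pt p = (\<Sum>m\<in>keys p. if keys m \<subseteq> {0} then lookup p m else 0)"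
proof -
  have "(\<Prod>i\<in>keys m. origin_pt i ^ lookup m i) = (if keys m \<subseteq> {0} then 1 else (0::'a))" for m :: "nat \<Rightarrow>\<^sub>0 nat"
  proof (cases "keys m \<subseteq> {0}")
    case True
    then show ?thesis by (auto simp: origin_pt_def intro!: prod.neutral)
  next
    case False
    then obtain i where "i \<in> keys m" "i \<noteq> 0" by auto
    then have "(\<Prod>i\<in>keys m. origin_pt i ^ lookup m i) = (0::'a)"
      by (intro prod_zero) (auto simp: origin_pt_def in_keys_iff)
    then show ?thesis using False by simp
  qed
  then have "lookup p m * (\<Prod>i\<in>keys m. origin_pt i ^ lookup m i) = (if keys m \<subseteq> {0} then lookup p m else 0)" for m
    by simp
  then show ?thesis unfolding eval_mpoly_def by (rule sum.cong[OF refl])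
qed

lemma eval_origin_S:
  assumes "p \<in> polys {1..N}"
  shows "eval_mpoly origin_pt p = lookup p 0"
proof -
  have "keys m \<subseteq> {0} \<longleftrightarrow> m = 0" if "m \<in> keys p" for m
  proof
    assume "keys m \<subseteq> {0}"
    moreover have "0 \<notin> keys m"
    proof
      assume "0 \<in> keys m"
      then have "(0::nat) \<in> {1..N}" using polys_keysD[OF assms that] by blast
      then show False by simp
    qed
    ultimately have "keys m = {}" by blast
    then show "m = 0" by (metis lookup_zero in_keys_iff empty_iff poly_mapping_eqI)
  qed simp
  then have "eval_mpoly origin_pt p = (\<Sum>m\<in>keys p. if m = 0 then lookup p m else 0)"
    unfolding eval_origin by (intro sum.cong) auto
  then show ?thesis by (auto simp: in_keys_iff)
qed

text \<open>Vanishing at the origin of the chart says that x_0^n has coefficient zero, and it is the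
  only monomial of degree n whose exponent at x_0 is n. For n = 0 the truncated \<open>n - 1\<close>
  is 0, so this case is recorded separately.\<close>

lemma defining_ideal_form_x0_deg:
  assumes def: "defining_ideal N X I" and q: "origin_pt \<in> X"
    and g: "g \<in> I" "g \<in> forms {0..N} n"
  shows "n \<noteq> 0 \<or> g = 0" "x0_deg_le (n - 1) g"
proof -
  have "dehom 0 g \<in> chart_ideal N X 0" using def g by (auto simp: defining_ideal_def)
  then have ev: "eval_mpoly origin_pt (dehom 0 g) = 0" and gp: "dehom 0 g \<in> polys ({0..N} - {0})"
    using q by (auto simp: chart_ideal_def origin_pt_def)
  have "{0..N} - {0} = {1..N}" by auto
  then have l0: "lookup (dehom 0 g) 0 = 0" using ev gp by (simp add: eval_origin_S)
  then have c: "lookup g (single 0 n) = 0" by (simp add: lookup_dehom_form[OF g(2)])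
  have lt: "lookup m 0 < n" if m: "m \<in> keys g" for m
  proof -
    have d: "mdeg m = n" using forms_keysD[OF g(2) m] by simp
    have "lookup m 0 \<noteq> n"
    proof
      assume e: "lookup m 0 = n"
      have eq: "m = single 0 n + (m - single 0 n)"
        by (rule exponent_diff_add) (use e in \<open>auto simp: lookup_single when_def\<close>)
      then have "mdeg (m - single 0 n) = 0" using d by (metis add_cancel_right_right mdeg_add mdeg_single)
      then have "m = single 0 n" using eq by (simp add: mdeg_eq_0_iff)
      then show False using c m by (simp add: in_keys_iff)
    qed
    moreover have "lookup m 0 \<le> n" using lookup_le_mdeg[of m 0] d by simp
    ultimately show ?thesis by simp
  qed
  show "x0_deg_le (n - 1) g" unfolding x0_deg_le_def using lt by force
  show "n \<noteq> 0 \<or> g = 0"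
  proof (cases "n = 0")
    case True
    then have "lookup g m = 0" for m using lt[of m] by (auto simp: in_keys_iff)
    then have "g = 0" by (intro poly_mapping_eqI) simp
    then show ?thesis by blast
  qed simp
qed

section \<open>Dickson's lemma and an Artin--Rees lemma\<close>

lemma nat_incseq_subseq:
  fixes x :: "nat \<Rightarrow> nat"
  obtains f where "strict_mono f" "incseq (\<lambda>n. x (f n))"
proof -
  obtain f where f: "strict_mono f" "monoseq (\<lambda>n. x (f n))" using seq_monosub by blast
  then consider "incseq (\<lambda>n. x (f n))" | "decseq (\<lambda>n. x (f n))" by (auto simp: monoseq_iff)
  then show ?thesis
  proof cases
    case 2
    \<comment> \<open>A decreasing sequence of naturals is constant from the point where it attains
      its least value.\<close>
    let ?m = "LEAST v. \<exists>n. x (f n) = v"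
    have "\<exists>n. x (f n) = ?m" by (rule LeastI_ex) blast
    then obtain n0 where n0: "x (f n0) = ?m" by blast
    have "x (f (n + n0)) = ?m" for n
    proof (rule antisym)
      show "x (f (n + n0)) \<le> ?m" using 2 n0 by (metis decseqD le_add2)
      show "?m \<le> x (f (n + n0))" by (rule Least_le) blast
    qed
    then have "incseq (\<lambda>n. x (f (n + n0)))" by (simp add: incseq_def)
    moreover have "strict_mono (\<lambda>n. f (n + n0))" using f(1) by (simp add: strict_mono_def)
    ultimately show ?thesis using that by blast
  qed (use f that in blast)
qed

lemma dickson_subseq:
  fixes s :: "nat \<Rightarrow> 'a \<Rightarrow> nat"
  assumes "finite V"
  shows "\<exists>f. strict_mono f \<and> (\<forall>v\<in>V. incseq (\<lambda>n. s (f n) v))"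
  using assms
proof (induction V)
  case empty
  then show ?case by (intro exI[of _ id]) (auto simp: strict_mono_def)
next
  case (insert v V)
  then obtain f where f: "strict_mono f" "\<forall>v\<in>V. incseq (\<lambda>n. s (f n) v)" by blast
  obtain g where g: "strict_mono g" "incseq (\<lambda>n. s (f (g n)) v)"
    using nat_incseq_subseq[of "\<lambda>n. s (f n) v"] by blast
  have "incseq (\<lambda>n. s (f (g n)) w)" if "w \<in> V" for w
  proof -
    have "incseq (\<lambda>n. s (f n) w)" using f(2) that by blast
    then show ?thesis using g(1) unfolding incseq_def by (meson strict_mono_less_eq)
  qed
  then show ?case using f(1) g by (intro exI[of _ "\<lambda>n. f (g n)"]) (auto simp: strict_mono_def)
qed

text \<open>The vectors are attached to arbitrary indices through \<open>e\<close>, since the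
  intended indices are pairs of an order and a polynomial.\<close>

lemma dickson_finite_basis:
  fixes e :: "'b \<Rightarrow> 'a \<Rightarrow> nat"
  assumes "finite V"
  obtains B where "finite B" "B \<subseteq> T" "\<And>x. x \<in> T \<Longrightarrow> \<exists>b\<in>B. \<forall>v\<in>V. e b v \<le> e x v"
proof (rule ccontr)
  note basis = that
  assume "\<not> thesis"
  then have no: "\<exists>x. x \<in> T \<and> \<not> (\<exists>b\<in>B. \<forall>v\<in>V. e b v \<le> e x v)" if "finite B" "B \<subseteq> T" for B
    using that basis[of B] by blast
  define pick where "pick = (\<lambda>B. SOME x. x \<in> T \<and> \<not> (\<exists>b\<in>B. \<forall>v\<in>V. e b v \<le> e x v))"
  \<comment> \<open>Without a finite basis one can always pick an element dominating none of those
    picked before; an increasing subsequence of these picks is a contradiction.\<close>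
  define F where "F = rec_nat {} (\<lambda>_ B. insert (pick B) B)"
  have F: "F 0 = {}" "F (Suc n) = insert (pick (F n)) (F n)" for n by (simp_all add: F_def)
  have pick: "pick B \<in> T \<and> \<not> (\<exists>b\<in>B. \<forall>v\<in>V. e b v \<le> e (pick B) v)" if "finite B" "B \<subseteq> T" for B
    unfolding pick_def by (rule someI_ex) (rule no[OF that])
  have FT: "finite (F n) \<and> F n \<subseteq> T" for n by (induction n) (use pick in \<open>auto simp: F\<close>)
  have mem: "pick (F i) \<in> F j" if "i < j" for i j
    using that by (induction j) (auto simp: F less_Suc_eq)
  obtain f where f: "strict_mono f" "\<forall>v\<in>V. incseq (\<lambda>n. e (pick (F (f n))) v)"
    using dickson_subseq[OF assms, of "\<lambda>n. e (pick (F n))"] by blast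
  have "\<forall>v\<in>V. e (pick (F (f 0))) v \<le> e (pick (F (f 1))) v"
    using f(2) by (auto simp: incseq_def)
  moreover have "pick (F (f 0)) \<in> F (f 1)" using f(1) by (intro mem) (simp add: strict_mono_def)
  ultimately show False using pick FT by blast
qed

text \<open>The order on exponents is lexicographic: the first index at which two exponents differ
  decides. Together with compatibility with addition, this lemma makes it a monomial order.\<close>

lemma exponent_nonneg: "(0 :: nat \<Rightarrow>\<^sub>0 nat) \<le> m"
proof (cases "m = 0")
  case False
  then obtain i where i: "lookup m i \<noteq> 0" by (metis lookup_zero poly_mapping_eqI)
  define k where "k = (LEAST i. lookup m i \<noteq> 0)"
  have "lookup m k \<noteq> 0" unfolding k_def using i by (rule LeastI)
  moreover have "\<forall>i<k. lookup m i = 0" unfolding k_def using not_less_Least by blast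
  ultimately have "less_fun (lookup 0) (lookup m)" by (intro less_funI exI[of _ k]) simp
  then have "0 < m" by (simp add: less_poly_mapping.rep_eq)
  then show ?thesis by simp
qed simp

lemma exponent_le_add: "(m :: nat \<Rightarrow>\<^sub>0 nat) \<le> m + k"
  using add_left_mono[OF exponent_nonneg[of k], of m] by simp

text \<open>In a descending sequence Dickson's lemma finds an earlier exponent that divides a later
  one and hence is at most the later one. Finiteness of \<open>V\<close> matters: lexicographically
  x_0 > x_1 > x_2 > ... never ends.\<close>

lemma wf_exponents:
  assumes "finite V"
  shows "wf {(a, b :: nat \<Rightarrow>\<^sub>0 nat). keys a \<subseteq> V \<and> a < b}"
  unfolding wf_iff_no_infinite_down_chain
proof
  assume "\<exists>s. \<forall>i. (s (Suc i), s i) \<in> {(a, b :: nat \<Rightarrow>\<^sub>0 nat). keys a \<subseteq> V \<and> a < b}"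
  then obtain s :: "nat \<Rightarrow> nat \<Rightarrow>\<^sub>0 nat" where s': "\<forall>i. keys (s (Suc i)) \<subseteq> V \<and> s (Suc i) < s i" by auto
  then have s: "keys (s (Suc i)) \<subseteq> V" "s (Suc i) < s i" for i by blast+
  have dec: "s j < s i" if "i < j" for i j
    using that
  proof (induction j)
    case (Suc j)
    then show ?case using s(2)[of j] by (cases "i = j") auto
  qed simp
  obtain f where f: "strict_mono f" "\<forall>v\<in>V. incseq (\<lambda>n. lookup (s (Suc (f n))) v)"
    using dickson_subseq[OF assms, of "\<lambda>n. lookup (s (Suc n))"] by blast
  let ?a = "s (Suc (f 0))" and ?b = "s (Suc (f 1))"
  have "lookup ?a v \<le> lookup ?b v" for v
  proof (cases "v \<in> V")
    case True
    then show ?thesis using f(2) by (auto simp: incseq_def)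
  next
    case False
    then have "v \<notin> keys ?a" using s(1) by blast
    then show ?thesis by (simp add: in_keys_iff)
  qed
  then have "?b = ?a + (?b - ?a)" by (rule exponent_diff_add)
  then have "?a \<le> ?b" using exponent_le_add by metis
  moreover have "?b < ?a" using f(1) by (intro dec) (simp add: strict_mono_def)
  ultimately show False by simp
qed

section \<open>Powers of the irrelevant ideal, described by the order of vanishing at the
  origin\<close>

definition mpow :: "nat set \<Rightarrow> nat \<Rightarrow> ('k::field) mpoly set" where
  "mpow V t = {z \<in> polys V. \<forall>m\<in>keys z. t \<le> mdeg m}"

lemma mpow_0 [simp]: "mpow V 0 = polys V"
  by (auto simp: mpow_def)

lemma mpow_polys: "z \<in> mpow V t \<Longrightarrow> z \<in> polys V"
  by (simp add: mpow_def)

lemma mpow_zero [simp]: "0 \<in> mpow V t"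
  by (simp add: mpow_def)

lemma mpow_add: "a \<in> mpow V t \<Longrightarrow> b \<in> mpow V t \<Longrightarrow> a + b \<in> mpow V t"
  using keys_add[of a b] by (auto simp: mpow_def)

lemma mpow_uminus: "a \<in> mpow V t \<Longrightarrow> - a \<in> mpow V t"
  by (auto simp: mpow_def in_keys_iff)

lemma mpow_diff: "a \<in> mpow V t \<Longrightarrow> b \<in> mpow V t \<Longrightarrow> a - b \<in> mpow V t"
  using mpow_add[of a V t "- b"] mpow_uminus[of b V t] by simp

lemma mpow_sum: "(\<And>x. x \<in> A \<Longrightarrow> f x \<in> mpow V t) \<Longrightarrow> sum f A \<in> mpow V t"
  by (induction A rule: infinite_finite_induct) (auto intro: mpow_add)

lemma mpow_antimono: "a \<in> mpow V t \<Longrightarrow> s \<le> t \<Longrightarrow> a \<in> mpow V s"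
  by (force simp: mpow_def)

lemma mpow_mult:
  assumes "a \<in> mpow V s" "b \<in> mpow V t"
  shows "a * b \<in> mpow V (s + t)"
proof -
  have "s + t \<le> mdeg m" if m: "m \<in> keys (a * b)" for m
  proof -
    obtain k l where kl: "k \<in> keys a" "l \<in> keys b" "m = k + l" using keys_mult[of a b] m by blast
    then have "s \<le> mdeg k" "t \<le> mdeg l" using assms by (auto simp: mpow_def)
    then show ?thesis by (simp add: kl(3) mdeg_add)
  qed
  moreover have "a * b \<in> polys V" using assms by (intro polys_mult) (simp_all add: mpow_def)
  ultimately show ?thesis by (simp add: mpow_def)
qed

lemma mpow_mult_left: "a \<in> polys V \<Longrightarrow> b \<in> mpow V t \<Longrightarrow> a * b \<in> mpow V t"
  using mpow_mult[of a V 0 b t] by simp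

lemma mpow_single: "keys m \<subseteq> V \<Longrightarrow> t \<le> mdeg m \<Longrightarrow> single m c \<in> mpow V t"
  by (auto simp: mpow_def intro: polys_single)

text \<open>An element \<open>z\<close> of order at least \<open>t\<close> stands for the element \<open>z u\<^sup>-\<^sup>t\<close> of the extended Rees
  algebra \<open>k[u, x\<^sub>i / u]\<close>, which is a polynomial ring; its leading exponent has the entry
  \<open>mdeg (Max (keys z)) - t\<close> at \<open>u\<close>. Dickson's lemma yields a finite Groebner basis of the Rees
  ideal of \<open>C\<close>, and division by it preserves the order.\<close>

lemma artin_rees:
  fixes C :: "('k::field) mpoly set"
  assumes C: "ideal C (poly_ring V)" and V: "finite V"
  obtains c where "\<And>t z U. z \<in> C \<Longrightarrow> z \<in> mpow V t \<Longrightarrow> 0 \<in> U \<Longrightarrow> (\<And>a b. a \<in> U \<Longrightarrow> b \<in> U \<Longrightarrow> a + b \<in> U) \<Longrightarrow>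
     (\<And>a b. a \<in> mpow V (t - c) \<Longrightarrow> b \<in> C \<Longrightarrow> a * b \<in> U) \<Longrightarrow> z \<in> U"
proof -
  define T where "T = {(t, z) | t z. z \<in> C \<and> z \<in> mpow V t \<and> z \<noteq> 0}"
  define e where "e = (\<lambda>(t, z :: 'k mpoly) v. case v of None \<Rightarrow> mdeg (Max (keys z)) - t
    | Some i \<Rightarrow> lookup (Max (keys z)) i)"
  obtain B where B: "finite B" "B \<subseteq> T"
    "\<And>x. x \<in> T \<Longrightarrow> \<exists>b\<in>B. \<forall>v\<in>insert None (Some ` V). e b v \<le> e x v"
    using dickson_finite_basis[of "insert None (Some ` V)" T e] V by auto
  \<comment> \<open>The Artin-Rees constant is the largest order attached to an element of the
    finite basis.\<close>
  define c where "c = Max (insert 0 (fst ` B))"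
  have c: "t \<le> c" if "(t, b) \<in> B" for t b
    unfolding c_def using B(1) that by (intro Max_ge) (auto intro: image_eqI[of _ _ "(t, b)"])
  \<comment> \<open>\<open>U\<close> stands for the product of M^(t-c) and \<open>C\<close>.
    Allowing any additively closed set that contains the products spares later uses the unpacking of
    a finite sum.\<close>
  have "z \<in> U"
    if z: "z \<in> C" "z \<in> mpow V t" and U: "0 \<in> U" "\<And>a b. a \<in> U \<Longrightarrow> b \<in> U \<Longrightarrow> a + b \<in> U"
       "\<And>a b. a \<in> mpow V (t - c) \<Longrightarrow> b \<in> C \<Longrightarrow> a * b \<in> U" for t z U
  proof -
    have "\<forall>z. z \<in> C \<and> z \<in> mpow V t \<and> (\<forall>k\<in>keys z. k \<le> m) \<longrightarrow> z \<in> U" for m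
    proof (induction m rule: wf_induct_rule[OF wf_exponents[OF V]])
      case (1 m)
      show ?case
      proof (intro allI impI, elim conjE)
        fix z assume z: "z \<in> C" "z \<in> mpow V t" "\<forall>k\<in>keys z. k \<le> m"
        show "z \<in> U"
        proof (cases "z = 0")
          case False
          define l where "l = Max (keys z)"
          have l: "l \<in> keys z" "\<And>k. k \<in> keys z \<Longrightarrow> k \<le> l"
            using False by (auto simp: l_def intro: Max_in)
          have lV: "keys l \<subseteq> V" and lt: "t \<le> mdeg l" using z(2) l(1) by (auto simp: mpow_def polys_def)
          have "(t, z) \<in> T" using z False by (simp add: T_def)
          then obtain t' b where b: "(t', b) \<in> B" "\<forall>v\<in>insert None (Some ` V). e (t', b) v \<le> e (t, z) v"
            using B(3)[of "(t, z)"] by auto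
          then have bC: "b \<in> C" "b \<in> mpow V t'" "b \<noteq> 0" using B(2) by (auto simp: T_def)
          define lb where "lb = Max (keys b)"
          have lb: "lb \<in> keys b" "\<And>k. k \<in> keys b \<Longrightarrow> k \<le> lb"
            using bC(3) by (auto simp: lb_def intro: Max_in)
          have lbV: "keys lb \<subseteq> V" and lbt: "t' \<le> mdeg lb"
            using bC(2) lb(1) by (auto simp: mpow_def polys_def)
          have e0: "mdeg lb - t' \<le> mdeg l - t" using b(2) by (simp add: e_def lb_def l_def)
          have "lookup lb i \<le> lookup l i" for i
          proof (cases "i \<in> V")
            case True
            then show ?thesis using b(2) by (simp add: e_def lb_def l_def)
          next
            case False
            then have "i \<notin> keys lb" using lbV by blast
            then show ?thesis by (simp add: in_keys_iff)
          qed
          then have leq: "l = lb + (l - lb)" by (rule exponent_diff_add)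
          define be where "be = l - lb"
          have leq: "l = be + lb" using leq by (simp add: be_def add.commute)
          have beV: "keys be \<subseteq> V" using lV by (simp add: leq keys_plus_nat)
          have "mdeg l = mdeg be + mdeg lb" by (simp add: leq mdeg_add)
          \<comment> \<open>This is what the entry at u buys: divisibility there says that the
            excess of the degree over the order is no larger for \<open>b\<close> than for
            \<open>z\<close>, so the quotient monomial makes up the difference of the
            orders.\<close>
          then have bet: "t - t' \<le> mdeg be" using e0 lt lbt by linarith
          define q where "q = single be (lookup z l / lookup b lb)"
          have q0: "lookup z l / lookup b lb \<noteq> 0" using l(1) lb(1) by (simp add: in_keys_iff)
          have qb: "q * b \<in> mpow V t"
          proof -
            have "q * b \<in> mpow V ((t - t') + t')"
              unfolding q_def using beV bet bC(2) by (intro mpow_mult mpow_single)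
            then show ?thesis by (rule mpow_antimono) simp
          qed
          define z' where "z' = z - q * b"
          have qV: "q \<in> polys V" using beV by (simp add: q_def polys_single)
          have z'C: "z' \<in> C" unfolding z'_def using z bC qV by (intro ideal_diff[OF C] ideal_mult[OF C])
          have z't: "z' \<in> mpow V t" unfolding z'_def using z qb by (intro mpow_diff)
          have "lookup z' l = 0"
            using lb(1) by (simp add: z'_def q_def lookup_minus leq lookup_single_times_add in_keys_iff)
          have z'l: "k < l" if k: "k \<in> keys z'" for k
          proof -
            have "k \<in> keys z \<or> k \<in> keys (q * b)" using k by (auto simp: z'_def in_keys_iff lookup_minus)
            then have "k \<le> l"
            proof
              assume "k \<in> keys (q * b)"
              then obtain k' where "k' \<in> keys b" "k = be + k'"
                using q0 by (auto simp: q_def keys_single_times)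
              then show "k \<le> l" using lb(2) by (simp add: leq add_left_mono)
            qed (use l in blast)
            moreover have "k \<noteq> l" using k \<open>lookup z' l = 0\<close> by (auto simp: in_keys_iff)
            ultimately show ?thesis by simp
          qed
          have "z' \<in> U"
          proof (cases "z' = 0")
            case False
            let ?m' = "Max (keys z')"
            have m': "?m' \<in> keys z'" "\<forall>k\<in>keys z'. k \<le> ?m'" using False by (auto intro: Max_in)
            have "?m' < m" using z'l[OF m'(1)] z(3) l(1) by (meson less_le_trans)
            moreover have "keys ?m' \<subseteq> V" using z't m'(1) by (auto simp: mpow_def polys_def)
            ultimately show ?thesis using 1[of ?m'] z'C z't m'(2) by blast
          qed (simp add: U(1))
          \<comment> \<open>The quotient has order at least t - t', and t' is at most
            \<open>c\<close>.\<close>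
          moreover have "q * b \<in> U"
            using c[OF b(1)] bet beV bC(1) by (intro U(3)) (auto simp: q_def intro!: mpow_single)
          ultimately have "z' + q * b \<in> U" by (rule U(2))
          then show ?thesis by (simp add: z'_def)
        qed (simp add: U(1))
      qed
    qed
    from this[of "Max (keys z)"] show ?thesis using z by auto
  qed
  then show ?thesis using that by blast
qed

section \<open>The ideals P + M^t, adic neighbourhoods of P\<close>

definition near :: "nat set \<Rightarrow> ('k::field) mpoly set \<Rightarrow> nat \<Rightarrow> 'k mpoly set" where
  "near V P t = {p + z | p z. p \<in> P \<and> z \<in> mpow V t}"

lemma near_iff: "s \<in> near V P t \<longleftrightarrow> (\<exists>z\<in>mpow V t. s - z \<in> P)"
  by (force simp: near_def)

lemma near_antimono: "t' \<le> t \<Longrightarrow> near V P t \<subseteq> near V P t'"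
  using mpow_antimono unfolding near_def by blast

lemma near_mono: "P \<subseteq> Q \<Longrightarrow> near V P t \<subseteq> near V Q t"
  unfolding near_def by blast

lemma near_polys: "ideal P (poly_ring V) \<Longrightarrow> s \<in> near V P t \<Longrightarrow> s \<in> polys V"
  unfolding near_def using ideal_polys mpow_polys polys_add by blast

lemma near_0: "ideal P (poly_ring V) \<Longrightarrow> 0 \<in> near V P t"
  using ideal_0 unfolding near_def by force

lemma near_ideal_mem: "p \<in> P \<Longrightarrow> p \<in> near V P t"
  unfolding near_def by force

lemma near_mpow_mem: "ideal P (poly_ring V) \<Longrightarrow> z \<in> mpow V t \<Longrightarrow> z \<in> near V P t"
  using ideal_0 unfolding near_def by force

lemma near_ideal:
  assumes P: "ideal P (poly_ring V)"
  shows "ideal (near V P t) (poly_ring V)"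
  unfolding ideal_poly_ring_iff
proof (intro conjI ballI)
  show "near V P t \<subseteq> polys V" using near_polys[OF P] by blast
  show "0 \<in> near V P t" by (rule near_0[OF P])
  show "a + b \<in> near V P t" if "a \<in> near V P t" "b \<in> near V P t" for a b
  proof -
    from that obtain z z' where "z \<in> mpow V t" "a - z \<in> P" "z' \<in> mpow V t" "b - z' \<in> P"
      by (auto simp: near_iff)
    then show ?thesis using ideal_add[OF P, of "a - z" "b - z'"]
      unfolding near_iff by (intro bexI[of _ "z + z'"]) (auto simp: algebra_simps intro: mpow_add)
  qed
  show "p * a \<in> near V P t" if "a \<in> near V P t" "p \<in> polys V" for a p
  proof -
    from that obtain z where "z \<in> mpow V t" "a - z \<in> P" by (auto simp: near_iff)
    then show ?thesis using ideal_mult[OF P, of "a - z" p] that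
      unfolding near_iff by (intro bexI[of _ "p * z"]) (auto simp: algebra_simps intro: mpow_mult_left)
  qed
qed

text \<open>Artin-Rees is applied to C = P + (g). If g s = p + z with z of order t, then z lies in
  C, so modulo P it is g w with w of order t - c. Hence g (s - w) lies in P, and so does s -
  w.\<close>

lemma near_colon:
  assumes P: "ideal P (poly_ring V)" and V: "finite V" and g: "g \<in> polys V"
    and nzd: "\<And>s. s \<in> polys V \<Longrightarrow> g * s \<in> P \<Longrightarrow> s \<in> P"
  obtains c where "\<And>t s. s \<in> polys V \<Longrightarrow> g * s \<in> near V P t \<Longrightarrow> s \<in> near V P (t - c)"
proof -
  define C where "C = {p + g * s | p s. p \<in> P \<and> s \<in> polys V}"
  have C: "ideal C (poly_ring V)"
    unfolding ideal_poly_ring_iff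
  proof (intro conjI ballI)
    show "C \<subseteq> polys V" unfolding C_def using ideal_polys[OF P] g by auto
    show "0 \<in> C" unfolding C_def using ideal_0[OF P] by (intro CollectI exI[of _ 0]) auto
    show "a + b \<in> C" if ab: "a \<in> C" "b \<in> C" for a b
    proof -
      from ab obtain p s q r where "a = p + g * s" "p \<in> P" "s \<in> polys V"
        "b = q + g * r" "q \<in> P" "r \<in> polys V" unfolding C_def by blast
      then show ?thesis unfolding C_def using ideal_add[OF P]
        by (intro CollectI exI[of _ "p + q"] exI[of _ "s + r"]) (auto simp: algebra_simps)
    qed
    show "x * a \<in> C" if ax: "a \<in> C" "x \<in> polys V" for a x
    proof -
      from ax obtain p s where "a = p + g * s" "p \<in> P" "s \<in> polys V" unfolding C_def by blast
      then show ?thesis unfolding C_def using ideal_mult[OF P] ax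
        by (intro CollectI exI[of _ "x * p"] exI[of _ "x * s"]) (auto simp: algebra_simps)
    qed
  qed
  obtain c where c: "\<And>t z U. z \<in> C \<Longrightarrow> z \<in> mpow V t \<Longrightarrow> 0 \<in> U \<Longrightarrow> (\<And>a b. a \<in> U \<Longrightarrow> b \<in> U \<Longrightarrow> a + b \<in> U) \<Longrightarrow>
     (\<And>a b. a \<in> mpow V (t - c) \<Longrightarrow> b \<in> C \<Longrightarrow> a * b \<in> U) \<Longrightarrow> z \<in> U"
    using artin_rees[OF C V] by blast
  have "s \<in> near V P (t - c)" if s: "s \<in> polys V" "g * s \<in> near V P t" for t s
  proof -
    obtain z where z: "z \<in> mpow V t" "g * s - z \<in> P" using s(2) by (auto simp: near_iff)
    have "z = - (g * s - z) + g * s" by simp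
    then have zC: "z \<in> C" unfolding C_def using ideal_uminus[OF P z(2)] s(1) by blast
    \<comment> \<open>An element of C is p + g r; multiplied by a of order t - c it is g (r a)
      modulo P, so this set contains all required products.\<close>
    define U where "U = {z. \<exists>w\<in>mpow V (t - c). z - g * w \<in> P}"
    have "z \<in> U"
    proof (rule c[OF zC z(1)])
      show "0 \<in> U" unfolding U_def using ideal_0[OF P] by (auto intro!: bexI[of _ 0])
      show "a + b \<in> U" if ab: "a \<in> U" "b \<in> U" for a b
      proof -
        from ab obtain w w' where w: "w \<in> mpow V (t - c)" "a - g * w \<in> P" "w' \<in> mpow V (t - c)" "b - g * w' \<in> P"
          unfolding U_def by blast
        have eq: "(a + b) - g * (w + w') = (a - g * w) + (b - g * w')" by (simp add: algebra_simps)
        have "(a + b) - g * (w + w') \<in> P" unfolding eq using w by (intro ideal_add[OF P])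
        then show ?thesis unfolding U_def using w by (intro CollectI bexI[of _ "w + w'"]) (auto intro: mpow_add)
      qed
      show "a * b \<in> U" if ab: "a \<in> mpow V (t - c)" "b \<in> C" for a b
      proof -
        from ab obtain p r where pr: "b = p + g * r" "p \<in> P" "r \<in> polys V" unfolding C_def by blast
        have "a * b - g * (r * a) = a * p" by (simp add: pr algebra_simps)
        then have "a * b - g * (r * a) \<in> P" using ideal_mult[OF P pr(2)] mpow_polys[OF ab(1)] by simp
        then show ?thesis unfolding U_def using ab pr by (intro CollectI bexI[of _ "r * a"]) (auto intro: mpow_mult_left)
      qed
    qed
    then obtain w where w: "w \<in> mpow V (t - c)" "z - g * w \<in> P" unfolding U_def by blast
    have "g * (s - w) = (g * s - z) + (z - g * w)" by (simp add: algebra_simps)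
    then have "g * (s - w) \<in> P" using ideal_add[OF P z(2) w(2)] by (simp only:)
    moreover have "s - w \<in> polys V" by (intro polys_diff s(1) mpow_polys[OF w(1)])
    ultimately have "s - w \<in> P" by (rule nzd[rotated])
    then show ?thesis using w(1) by (auto simp: near_iff)
  qed
  then show ?thesis using that by blast
qed

section \<open>Growth of the Hilbert function along a chain of primes\<close>

text \<open>States that the quotient by \<open>W\<close> has dimension at least \<open>n\<close>,
  without forming the quotient: the first \<open>n\<close> values of \<open>u\<close> are
  witnesses.\<close>

definition indep_mod :: "('k::field) mpoly set \<Rightarrow> nat \<Rightarrow> (nat \<Rightarrow> 'k mpoly) \<Rightarrow> bool" where
  "indep_mod W n u \<longleftrightarrow> (\<forall>a. (\<Sum>i<n. single 0 (a i) * u i) \<in> W \<longrightarrow> (\<forall>i<n. a i = 0))"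

lemma indep_modD: "indep_mod W n u \<Longrightarrow> (\<Sum>i<n. single 0 (a i) * u i) \<in> W \<Longrightarrow> i < n \<Longrightarrow> a i = 0"
  unfolding indep_mod_def by blast

lemma indep_mod_antimono: "indep_mod W n u \<Longrightarrow> W' \<subseteq> W \<Longrightarrow> indep_mod W' n u"
  unfolding indep_mod_def by blast

lemma indep_mod_le:
  assumes "indep_mod W n u" "m \<le> n"
  shows "indep_mod W m u"
  unfolding indep_mod_def
proof (intro allI impI)
  fix a i assume a: "(\<Sum>i<m. single 0 (a i) * u i) \<in> W" and i: "i < m"
  let ?a = "\<lambda>i. if i < m then a i else 0"
  have "(\<Sum>i<n. single 0 (?a i) * u i) = (\<Sum>i<m. single 0 (a i) * u i)"
    by (rule sum.mono_neutral_cong_right) (use assms(2) in auto)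
  then have "(\<Sum>i<n. single 0 (?a i) * u i) \<in> W" using a by simp
  then have "?a i = 0" using i assms(2) by (intro indep_modD[OF assms(1), of ?a]) auto
  then show "a i = 0" using i by simp
qed

text \<open>Multiplication by g embeds S/(P' + M^t) into the kernel of S/(P' + M^T) \<rightarrow>
  S/(P + M^T), so the dimensions add. A relation is read modulo P first, where the multiples of g
  disappear, and then divided by g.\<close>

lemma indep_mod_combine:
  assumes P: "ideal P (poly_ring V)" and P': "ideal P' (poly_ring V)" and sub: "P' \<subseteq> P"
    and g: "g \<in> P" and colon: "\<And>s. s \<in> polys V \<Longrightarrow> g * s \<in> near V P' T \<Longrightarrow> s \<in> near V P' t"
    and u: "\<And>i. u i \<in> polys V" "indep_mod (near V P' t) m u"
    and v: "\<And>i. v i \<in> polys V" "indep_mod (near V P T) n v"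
  shows "indep_mod (near V P' T) (m + n) (\<lambda>i. if i < m then g * u i else v (i - m))"
  unfolding indep_mod_def
proof (intro allI impI)
  let ?w = "\<lambda>i. if i < m then g * u i else v (i - m)"
  fix a i assume a: "(\<Sum>i<m + n. single 0 (a i) * ?w i) \<in> near V P' T" and i: "i < m + n"
  let ?A = "\<Sum>i<m. single 0 (a i) * u i" and ?B = "\<Sum>i<n. single 0 (a (m + i)) * v i"
  have "(\<Sum>i<m + n. single 0 (a i) * ?w i) = (\<Sum>i<m. single 0 (a i) * ?w i) + (\<Sum>i<n. single 0 (a (m + i)) * ?w (m + i))"
    by (induction n) (simp_all add: add.assoc)
  also have "\<dots> = g * ?A + ?B" by (simp add: sum_distrib_left mult.left_commute)
  finally have AB: "g * ?A + ?B \<in> near V P' T" using a by simp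
  have A: "?A \<in> polys V" by (intro polys_sum polys_mult u polys_const)
  note ni = near_ideal[OF P, of T] near_ideal[OF P', of T]
  have "g * ?A \<in> near V P T" using ideal_mult_right[OF P g A] by (rule near_ideal_mem)
  moreover have "g * ?A + ?B \<in> near V P T" using AB near_mono[OF sub] by blast
  ultimately have "(g * ?A + ?B) - g * ?A \<in> near V P T" by (intro ideal_diff[OF ni(1)])
  then have "?B \<in> near V P T" by simp
  then have b0: "\<forall>i<n. a (m + i) = 0" using indep_modD[OF v(2), of "\<lambda>i. a (m + i)"] by blast
  then have "?B = 0" by simp
  then have "g * ?A \<in> near V P' T" using AB by simp
  then have "?A \<in> near V P' t" using A by (intro colon)
  then have a0: "\<forall>i<m. a i = 0" using u(2) unfolding indep_mod_def by blast
  show "a i = 0"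
  proof (cases "i < m")
    case False
    then have "a (m + (i - m)) = 0" using b0 i by (metis add_diff_inverse_nat nat_add_left_cancel_less)
    then show ?thesis using False by simp
  qed (use a0 in simp)
qed

text \<open>Induction along the chain, then on t, following Pascal's rule. An element g of P_r
  outside the prime P_(r+1) is a non-zero-divisor modulo the latter. The last ideal P_0 only has to
  lie in M.\<close>

lemma chain_growth:
  fixes P :: "nat \<Rightarrow> ('k::field) mpoly set"
  assumes V: "finite V"
    and ideals: "\<And>i. i \<le> r \<Longrightarrow> ideal (P i) (poly_ring V)"
    and max: "\<And>p. p \<in> P 0 \<Longrightarrow> lookup p 0 = 0"
    and prime: "\<And>i p q. 0 < i \<Longrightarrow> i \<le> r \<Longrightarrow> p \<in> polys V \<Longrightarrow> q \<in> polys V \<Longrightarrow> p * q \<in> P i \<Longrightarrow> p \<in> P i \<or> q \<in> P i"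
    and chain: "\<And>i. i < r \<Longrightarrow> P (Suc i) \<subset> P i"
  obtains c where "\<And>t. 1 \<le> t \<Longrightarrow> \<exists>u. (\<forall>i. u i \<in> polys V) \<and> indep_mod (near V (P r) (c * t)) (t choose r) u"
proof -
  have "\<exists>c\<ge>1. \<forall>t\<ge>1. \<exists>u. (\<forall>i. u i \<in> polys V) \<and> indep_mod (near V (P r) (c * t)) (t choose r) u"
    using ideals prime chain
  proof (induction r)
    case 0
    \<comment> \<open>P_0 + M^t contains no nonzero constant once t \<ge> 1, so the element 1 is a
      witness for dimension one.\<close>
    have "indep_mod (near V (P 0) (1 * t)) (t choose 0) (\<lambda>_. 1)" if t: "1 \<le> t" for t
      unfolding indep_mod_def
    proof (intro allI impI)
      fix a :: "nat \<Rightarrow> 'k" and i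
      assume a: "(\<Sum>i<t choose 0. single 0 (a i) * 1) \<in> near V (P 0) (1 * t)" and i: "i < t choose 0"
      have "(\<Sum>i<t choose 0. single 0 (a i) * 1) = (single 0 (a 0) :: 'k mpoly)" by (simp add: One_nat_def)
      then have "single 0 (a 0) \<in> near V (P 0) (1 * t)" using a by simp
      then obtain z where z: "z \<in> mpow V t" "single 0 (a 0) - z \<in> P 0" by (auto simp: near_iff)
      have "0 \<notin> keys z" using z(1) t by (auto simp: mpow_def)
      then have "lookup z 0 = 0" by (simp add: in_keys_iff)
      then show "a i = 0" using max[OF z(2)] i by (simp add: lookup_minus)
    qed
    then show ?case by (intro exI[of _ 1]) (auto intro!: exI[of _ "\<lambda>_. 1"])
  next
    case (Suc r)
    have "\<exists>c\<ge>1. \<forall>t\<ge>1. \<exists>u. (\<forall>i. u i \<in> polys V) \<and> indep_mod (near V (P r) (c * t)) (t choose r) u"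
    proof (rule Suc.IH)
      show "ideal (P i) (poly_ring V)" if "i \<le> r" for i using Suc.prems(1)[of i] that by simp
      show "p \<in> P i \<or> q \<in> P i" if "0 < i" "i \<le> r" "p \<in> polys V" "q \<in> polys V" "p * q \<in> P i" for i p q
        using Suc.prems(2)[of i p q] that by simp
      show "P (Suc i) \<subset> P i" if "i < r" for i using Suc.prems(3)[of i] that by simp
    qed
    then obtain c0 where c0: "1 \<le> c0" "\<And>t. 1 \<le> t \<Longrightarrow> \<exists>u. (\<forall>i. u i \<in> polys V) \<and> indep_mod (near V (P r) (c0 * t)) (t choose r) u"
      by blast
    have Pr: "ideal (P r) (poly_ring V)" and Ps: "ideal (P (Suc r)) (poly_ring V)"
      using Suc.prems(1)[of r] Suc.prems(1)[of "Suc r"] by simp_all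
    have sub: "P (Suc r) \<subset> P r" using Suc.prems(3)[of r] by simp
    then obtain g where g: "g \<in> P r" "g \<notin> P (Suc r)" by blast
    have gV: "g \<in> polys V" using ideal_polys[OF Pr g(1)] .
    have "s \<in> P (Suc r)" if "s \<in> polys V" "g * s \<in> P (Suc r)" for s
      using Suc.prems(2)[of "Suc r" g s] gV g that by blast
    then obtain c1 where c1: "\<And>t s. s \<in> polys V \<Longrightarrow> g * s \<in> near V (P (Suc r)) t \<Longrightarrow> s \<in> near V (P (Suc r)) (t - c1)"
      using near_colon[OF Ps V gV] by blast
    \<comment> \<open>At least \<open>c0\<close>, so that the bound for P_r applies; at least
      \<open>c1\<close>, so that the loss from dividing by g fits into one step from c t to c (t +
      1).\<close>
    define c where "c = max c0 c1"
    have "\<exists>u. (\<forall>i. u i \<in> polys V) \<and> indep_mod (near V (P (Suc r)) (c * t)) (t choose Suc r) u" for t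
    proof (induction t)
      case 0
      show ?case by (intro exI[of _ "\<lambda>_. 0"]) (auto simp: indep_mod_def)
    next
      case (Suc t)
      then obtain u where u: "\<And>i. u i \<in> polys V" "indep_mod (near V (P (Suc r)) (c * t)) (t choose Suc r) u" by blast
      obtain v where v: "\<And>i. v i \<in> polys V" "indep_mod (near V (P r) (c0 * Suc t)) (Suc t choose r) v"
        using c0(2)[of "Suc t"] by auto
      have "near V (P r) (c * Suc t) \<subseteq> near V (P r) (c0 * Suc t)"
        by (intro near_antimono mult_le_mono1) (simp add: c_def)
      with v(2) have "indep_mod (near V (P r) (c * Suc t)) (Suc t choose r) v" by (rule indep_mod_antimono)
      \<comment> \<open>More witnesses are at hand than Pascal's rule asks for; the surplus is
        dropped.\<close>
      moreover have "t choose r \<le> Suc t choose r" by (cases r) auto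
      ultimately have v2: "indep_mod (near V (P r) (c * Suc t)) (t choose r) v" by (rule indep_mod_le)
      have "s \<in> near V (P (Suc r)) (c * t)" if "s \<in> polys V" "g * s \<in> near V (P (Suc r)) (c * Suc t)" for s
      proof -
        have "c * t \<le> c * Suc t - c1" by (simp add: c_def)
        then show ?thesis using c1[OF that] near_antimono by blast
      qed
      then have "indep_mod (near V (P (Suc r)) (c * Suc t)) ((t choose Suc r) + (t choose r))
          (\<lambda>i. if i < (t choose Suc r) then g * u i else v (i - (t choose Suc r)))"
        using sub by (intro indep_mod_combine[OF Pr Ps _ g(1) _ u v(1) v2]) auto
      then show ?case using u(1) v(1) gV
        by (intro exI[of _ "\<lambda>i. if i < (t choose Suc r) then g * u i else v (i - (t choose Suc r))"])
          (auto simp: add.commute)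
    qed
    moreover have "1 \<le> c" using c0(1) by (simp add: c_def)
    ultimately show ?case by blast
  qed
  then show ?thesis using that by blast
qed

text \<open>Each \<open>u i\<close> may be replaced modulo \<open>W\<close> by a combination of the
  monomials in \<open>M\<close>. The replacements are linearly independent in an actual vector space
  spanned by card M elements.\<close>

lemma indep_mod_card_le:
  assumes u: "\<And>i. u i \<in> polys V" "indep_mod W n u"
    and W: "ideal W (poly_ring V)" and M: "finite M"
    and span: "\<And>s. s \<in> polys V \<Longrightarrow> \<exists>x. keys x \<subseteq> M \<and> s - x \<in> W"
  shows "n \<le> card M"
proof -
  interpret vs: vector_space "\<lambda>c (p :: 'a mpoly). single 0 c * p"
    by standard (auto simp: distrib_left distrib_right single_add mult_single mult.assoc[symmetric])
  have "\<forall>i. \<exists>x. keys x \<subseteq> M \<and> u i - x \<in> W" using span u(1) by blast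
  then obtain x where x: "\<And>i. keys (x i) \<subseteq> M" "\<And>i. u i - x i \<in> W" by metis
  have indep: "\<forall>i<n. a i = 0" if a: "(\<Sum>i<n. single 0 (a i) * x i) = 0" for a
  proof -
    have "(\<Sum>i<n. single 0 (a i) * (u i - x i)) \<in> W"
      by (intro ideal_sum[OF W] ideal_mult[OF W] x polys_const)
    then have "(\<Sum>i<n. single 0 (a i) * u i) \<in> W"
      using a by (simp add: right_diff_distrib sum_subtractf)
    then show ?thesis using u(2) by (simp add: indep_mod_def)
  qed
  \<comment> \<open>Independence in a vector space concerns sets, so repetitions in the family must
    be excluded: they would give the relation x_i - x_j = 0.\<close>
  have inj: "inj_on x {..<n}"
  proof (rule inj_onI, rule ccontr)
    fix i j assume ij: "i \<in> {..<n}" "j \<in> {..<n}" "x i = x j" "i \<noteq> j"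
    let ?a = "\<lambda>k. (if k = i then 1 else 0) - (if k = j then 1 else (0::'a))"
    have "(\<Sum>k<n. single 0 (?a k) * x k) = (\<Sum>k<n. (if k = i then x i else 0) - (if k = j then x j else 0))"
      by (rule sum.cong) (auto simp: single_uminus)
    also have "\<dots> = 0" using ij by (simp add: sum_subtractf)
    finally have "(\<Sum>k<n. single 0 (?a k) * x k) = 0" .
    then have "\<forall>k<n. ?a k = 0" by (rule indep)
    then have "?a i = 0" using ij(1) by (simp only: lessThan_iff)
    then show False using ij by simp
  qed
  have "vs.independent (x ` {..<n})"
  proof
    assume "vs.dependent (x ` {..<n})"
    then obtain f v where f: "v \<in> x ` {..<n}" "f v \<noteq> 0" "(\<Sum>v\<in>x ` {..<n}. single 0 (f v) * v) = 0"
      using vs.dependent_finite[of "x ` {..<n}"] by auto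
    have "(\<Sum>i<n. single 0 (f (x i)) * x i) = 0" using f(3) by (simp add: sum.reindex[OF inj])
    from indep[OF this] show False using f by auto
  qed
  moreover have "x ` {..<n} \<subseteq> vs.span ((\<lambda>m. single m 1) ` M)"
  proof
    fix y assume "y \<in> x ` {..<n}"
    then have "keys y \<subseteq> M" using x(1) by auto
    then have "y = (\<Sum>m\<in>M. single m (lookup y m))" using M by (simp add: sum_monomials)
    also have "\<dots> = (\<Sum>m\<in>M. single 0 (lookup y m) * single m 1)" by (simp add: mult_single)
    also have "\<dots> \<in> vs.span ((\<lambda>m. single m 1) ` M)"
      by (intro vs.span_sum vs.span_scale vs.span_base) auto
    finally show "y \<in> vs.span ((\<lambda>m. single m 1) ` M)" .
  qed
  ultimately have "card (x ` {..<n}) \<le> card ((\<lambda>m. single m (1::'a)) ` M)"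
    using vs.independent_span_bound[of "(\<lambda>m. single m 1) ` M" "x ` {..<n}"] M by auto
  then show ?thesis using card_image_le[OF M, of "\<lambda>m. single m (1::'a)"] by (simp add: card_image[OF inj])
qed

section \<open>Linear substitutions\<close>

text \<open>When no \<open>th i\<close> involves a variable from \<open>Q\<close>, this is the
  retraction onto the polynomials in the other variables, with kernel generated by the x_i -
  th_i.\<close>

definition subst :: "nat set \<Rightarrow> (nat \<Rightarrow> ('k::field) mpoly) \<Rightarrow> 'k mpoly \<Rightarrow> 'k mpoly" where
  "subst Q th = lin_ext (single 0) (exp_prod (\<lambda>i. if i \<in> Q then th i else var i))"

lemma subst_add: "subst Q th (p + q) = subst Q th p + subst Q th q"
  by (simp add: subst_def lin_ext_add)

lemma subst_mult: "subst Q th (p * q) = subst Q th p * subst Q th q"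
  by (simp add: subst_def lin_ext_mult)

lemma subst_diff: "subst Q th (p - q) = subst Q th p - subst Q th q"
  by (simp add: subst_def lin_ext_diff)

lemma subst_sum: "subst Q th (sum f A) = (\<Sum>x\<in>A. subst Q th (f x))"
  by (simp add: subst_def lin_ext_sum)

lemma subst_0 [simp]: "subst Q th 0 = 0"
  by (simp add: subst_def)

lemma subst_const [simp]: "subst Q th (single 0 c) = single 0 c"
  by (simp add: subst_def lin_ext_single)

lemma subst_1 [simp]: "subst Q th 1 = 1"
  using subst_const[of Q th 1] by simp

lemma subst_var: "subst Q th (var i) = (if i \<in> Q then th i else var i)"
  by (simp add: subst_def var_def lin_ext_single)

lemma subst_monomial: "subst Q th (single m c) = single 0 c * subst Q th (single m 1)"
  by (simp add: subst_def lin_ext_single)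

lemma subst_polys:
  assumes p: "p \<in> polys V" and th: "\<And>i. i \<in> Q \<Longrightarrow> th i \<in> polys (V - Q)"
  shows "subst Q th p \<in> polys (V - Q)"
  using p by (induction p rule: polys_ring_induct) (auto simp: subst_add subst_mult subst_var th)

lemma subst_id: "p \<in> polys W \<Longrightarrow> W \<inter> Q = {} \<Longrightarrow> subst Q th p = p"
  by (induction p rule: polys_ring_induct) (auto simp: subst_add subst_mult subst_var)

lemma subst_monomial_forms:
  assumes m: "keys m \<subseteq> V" and th: "\<And>i. i \<in> Q \<Longrightarrow> th i \<in> forms (V - Q) 1"
  shows "subst Q th (single m 1) \<in> forms (V - Q) (mdeg m)"
  using m
proof (induction m rule: monomial_induct)
  case zero
  show ?case using forms_const[of 1 "V - Q"] by simp
next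
  case (add i m)
  have "subst Q th (var i) \<in> forms (V - Q) 1"
    using add(1) th forms_var[of i "V - Q"] by (auto simp: subst_var)
  then have "subst Q th (var i) * subst Q th (single m 1) \<in> forms (V - Q) (1 + mdeg m)"
    using add.IH by (rule forms_mult)
  then show ?case by (simp add: subst_mult[symmetric] var_def mult_single mdeg_add)
qed

lemma subst_forms:
  assumes p: "p \<in> forms V n" and th: "\<And>i. i \<in> Q \<Longrightarrow> th i \<in> forms (V - Q) 1"
  shows "subst Q th p \<in> forms (V - Q) n"
proof -
  have "subst Q th p = subst Q th (\<Sum>m\<in>keys p. single m (lookup p m))" by (simp add: sum_monomials)
  also have "\<dots> = (\<Sum>m\<in>keys p. single 0 (lookup p m) * subst Q th (single m 1))"
    by (simp only: subst_sum subst_monomial[of _ _ _ "lookup p _"])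
  also have "\<dots> \<in> forms (V - Q) n"
  proof (rule graded_sum)
    fix m assume m: "m \<in> keys p"
    then have "keys m \<subseteq> V" "mdeg m = n" using p by (auto simp: graded_def polys_def)
    then have "single 0 (lookup p m) * subst Q th (single m 1) \<in> forms (V - Q) (0 + mdeg m)"
      by (intro forms_mult forms_const subst_monomial_forms th)
    then show "single 0 (lookup p m) * subst Q th (single m 1) \<in> forms (V - Q) n"
      using \<open>mdeg m = n\<close> by simp
  qed
  finally show ?thesis .
qed

lemma tail_polys:
  assumes Q: "Q \<subseteq> V" and th: "\<And>i. i \<in> Q \<Longrightarrow> th i \<in> polys (V - Q)"
  shows "(\<lambda>i. var i - th i) ` Q \<subseteq> polys V"
proof clarify
  fix i assume i: "i \<in> Q"
  then have "th i \<in> polys V" using th[OF i] by (rule_tac polys_mono[of "V - Q"]) auto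
  then show "var i - th i \<in> polys V" using i Q by auto
qed

lemma subst_diff_mem:
  assumes p: "p \<in> polys V" and Q: "Q \<subseteq> V" and th: "\<And>i. i \<in> Q \<Longrightarrow> th i \<in> polys (V - Q)"
  shows "p - subst Q th p \<in> gen V ((\<lambda>i. var i - th i) ` Q)"
proof -
  have "(\<lambda>i. var i - th i) ` Q \<subseteq> polys V" using tail_polys[OF Q th] .
  note G = gen_ideal[OF this] and incl = gen_incl[OF this]
  show ?thesis using p
  proof (induction p rule: polys_ring_induct)
    case (const c)
    then show ?case by (simp add: ideal_0[OF G])
  next
    case (var i)
    then show ?case using incl by (auto simp: subst_var ideal_0[OF G])
  next
    case (add p q)
    then show ?case using ideal_add[OF G add.IH] by (simp add: subst_add algebra_simps)
  next
    case (mult p q)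
    have "subst Q th q \<in> polys (V - Q)" using mult(2) th by (rule subst_polys)
    then have "subst Q th q \<in> polys V" by (rule polys_mono[rotated]) auto
    \<comment> \<open>Writing s for the substitution, this sum is p q - s(p) s(q).\<close>
    then have "p * (q - subst Q th q) + subst Q th q * (p - subst Q th p) \<in> gen V ((\<lambda>i. var i - th i) ` Q)"
      using mult by (intro ideal_add[OF G] ideal_mult[OF G])
    then show ?case by (simp add: subst_mult algebra_simps)
  qed
qed

text \<open>The substitution is the identity modulo the x_i - th_i, so its kernel lies in the ideal
  they generate. It kills each of them because \<open>th i\<close> contains no variable that gets
  replaced.\<close>

lemma subst_eq_0_iff:
  assumes p: "p \<in> polys V" and Q: "Q \<subseteq> V" and th: "\<And>i. i \<in> Q \<Longrightarrow> th i \<in> polys (V - Q)"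
  shows "subst Q th p = 0 \<longleftrightarrow> p \<in> gen V ((\<lambda>i. var i - th i) ` Q)"
proof
  assume "subst Q th p = 0"
  then show "p \<in> gen V ((\<lambda>i. var i - th i) ` Q)" using subst_diff_mem[OF p Q, of th] th by simp
next
  have th0: "subst Q th (var i - th i) = 0" if "i \<in> Q" for i
  proof -
    have "(V - Q) \<inter> Q = {}" by blast
    then have "subst Q th (th i) = th i" by (rule subst_id[OF th[OF that]])
    then show ?thesis using that by (simp add: subst_diff subst_var)
  qed
  have G: "(\<lambda>i. var i - th i) ` Q \<subseteq> polys V" using tail_polys[OF Q th] .
  let ?K = "{p \<in> polys V. subst Q th p = 0}"
  have "ideal ?K (poly_ring V)" unfolding ideal_poly_ring_iff by (auto simp: subst_add subst_mult)
  then have "gen V ((\<lambda>i. var i - th i) ` Q) \<subseteq> ?K" by (rule gen_minimal) (use G th0 in auto)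
  moreover assume "p \<in> gen V ((\<lambda>i. var i - th i) ` Q)"
  ultimately show "subst Q th p = 0" by auto
qed

section \<open>Linear parts\<close>

abbreviation lin_coeff :: "('k::field) mpoly \<Rightarrow> nat \<Rightarrow> 'k" where
  "lin_coeff f i \<equiv> lookup f (single i (1::nat))"

lemma hom_part_1_eq:
  assumes f: "f \<in> polys V" and V: "finite V"
  shows "hom_part 1 f = (\<Sum>i\<in>V. single 0 (lin_coeff f i) * var i)"
proof -
  have inj: "inj_on (\<lambda>i. single i (1::nat)) V"
    by (rule inj_onI) (metis lookup_single_eq lookup_single_not_eq zero_neq_one)
  have "keys (hom_part 1 f) \<subseteq> (\<lambda>i. single i 1) ` V"
  proof
    fix m assume "m \<in> keys (hom_part 1 f)"
    then have m: "m \<in> keys f" "mdeg m = 1" by (auto simp: keys_hom_part)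
    obtain i where i: "m = single i 1" using mdeg_1E[OF m(2)] .
    have "i \<in> keys m" by (simp add: i)
    then show "m \<in> (\<lambda>i. single i 1) ` V" using polys_keysD[OF f m(1)] i by auto
  qed
  then have "hom_part 1 f = (\<Sum>m\<in>(\<lambda>i. single i 1) ` V. single m (lookup (hom_part 1 f) m))"
    using V by (simp add: sum_monomials)
  also have "\<dots> = (\<Sum>i\<in>V. single (single i 1) (lin_coeff f i))"
    by (subst sum.reindex[OF inj]) (simp add: lookup_hom_part)
  finally show ?thesis by (simp add: var_def mult_single)
qed

text \<open>Reduced echelon form of the space of linear parts of \<open>A\<close>, with pivot variables \<open>Q\<close>.\<close>

definition linear_pivots :: "nat set \<Rightarrow> ('k::field) mpoly set \<Rightarrow> nat set \<Rightarrow> (nat \<Rightarrow> 'k mpoly) \<Rightarrow> bool" where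
  "linear_pivots V A Q F \<longleftrightarrow> Q \<subseteq> V \<and> (\<forall>p\<in>Q. F p \<in> A) \<and>
     (\<forall>p\<in>Q. \<forall>q\<in>Q. lin_coeff (F p) q = (if p = q then 1 else 0)) \<and>
     (\<forall>f\<in>A. (\<forall>p\<in>Q. lin_coeff f p = 0) \<longrightarrow> (\<forall>i. lin_coeff f i = 0))"

text \<open>Gaussian elimination phrased as maximality: a set of pivots of largest size is taken,
  and an element violating the last clause would supply another pivot.\<close>

lemma linear_pivots_exist:
  assumes A: "ideal A (poly_ring V)" and V: "finite V"
  obtains Q F where "linear_pivots V A Q F"
proof -
  define R where "R = (\<lambda>Q. Q \<subseteq> V \<and> (\<exists>F. (\<forall>p\<in>Q. F p \<in> A) \<and>
     (\<forall>p\<in>Q. \<forall>q\<in>Q. lin_coeff (F p) q = (if p = q then 1 else 0))))"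
  have "R {}" by (simp add: R_def)
  moreover have "\<forall>Q. R Q \<longrightarrow> card Q < Suc (card V)"
    using V by (auto simp: R_def less_Suc_eq_le card_mono)
  ultimately obtain Q where Q: "R Q" "\<And>Q'. R Q' \<Longrightarrow> card Q' \<le> card Q"
    using ex_has_greatest_nat[of R "{}" card "Suc (card V)"] by (metis less_imp_le)
  then obtain F where F: "Q \<subseteq> V" "\<And>p. p \<in> Q \<Longrightarrow> F p \<in> A"
     "\<And>p q. p \<in> Q \<Longrightarrow> q \<in> Q \<Longrightarrow> lin_coeff (F p) q = (if p = q then 1 else 0)"
    unfolding R_def by blast
  have "lin_coeff f j = 0" if f: "f \<in> A" "\<forall>p\<in>Q. lin_coeff f p = 0" for f j
  proof (rule ccontr)
    assume j: "lin_coeff f j \<noteq> 0"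
    have "single j 1 \<in> keys f" using j by (simp add: in_keys_iff)
    then have jV: "j \<in> V" using polys_keysD[OF ideal_polys[OF A f(1)]] by fastforce
    have jQ: "j \<notin> Q" using j f(2) by blast
    define g where "g = single 0 (1 / lin_coeff f j) * f"
    have g: "g \<in> A" unfolding g_def by (intro ideal_mult[OF A] f polys_const)
    have gl: "lin_coeff g i = lin_coeff f i / lin_coeff f j" for i by (simp add: g_def mult_const_lookup)
    \<comment> \<open>The coefficient at the new pivot j is cleared from the old rows; the old pivot
      columns stay untouched because \<open>g\<close> vanishes there.\<close>
    define F' where "F' = (\<lambda>p. if p = j then g else F p - single 0 (lin_coeff (F p) j) * g)"
    have "R (insert j Q)"
      unfolding R_def
    proof (intro conjI exI[of _ F'] ballI)
      show "insert j Q \<subseteq> V" using jV F(1) by simp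
      show "F' p \<in> A" if "p \<in> insert j Q" for p
        using that F(2) g by (auto simp: F'_def intro!: ideal_diff[OF A] ideal_mult[OF A])
      show "lin_coeff (F' p) q = (if p = q then 1 else 0)" if "p \<in> insert j Q" "q \<in> insert j Q" for p q
        using that jQ j f(2) F(3) by (auto simp: F'_def lookup_minus mult_const_lookup gl)
    qed
    then have "card (insert j Q) \<le> card Q" by (rule Q(2))
    then show False using jQ finite_subset[OF F(1) V] by simp
  qed
  then show ?thesis using that[of Q F] F by (simp add: linear_pivots_def)
qed

text \<open>The sign is chosen so that the linear part of \<open>F p\<close> is x_p minus the tail:
  substituting tails for pivot variables kills all linear parts.\<close>

definition pivot_tail :: "nat set \<Rightarrow> nat set \<Rightarrow> (nat \<Rightarrow> ('k::field) mpoly) \<Rightarrow> nat \<Rightarrow> 'k mpoly" where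
  "pivot_tail V Q F p = - (\<Sum>i\<in>V - Q. single 0 (lin_coeff (F p) i) * var i)"

lemma pivot_tail_forms: "pivot_tail V Q F p \<in> forms (V - Q) 1"
  unfolding pivot_tail_def
proof (intro graded_uminus graded_sum)
  fix i assume "i \<in> V - Q"
  then show "single 0 (lin_coeff (F p) i) * var i \<in> forms (V - Q) 1"
    using forms_mult[OF forms_const forms_var, of i "V - Q"] by simp
qed

lemma pivot_tail_polys: "pivot_tail V Q F p \<in> polys (V - Q)"
  using pivot_tail_forms graded_polys by blast

lemma hom_part_1_pivot:
  assumes lp: "linear_pivots V A Q F" and A: "ideal A (poly_ring V)" and V: "finite V" and p: "p \<in> Q"
  shows "hom_part 1 (F p) = var p - pivot_tail V Q F p"
proof -
  have Q: "Q \<subseteq> V" "F p \<in> A" "\<And>q. q \<in> Q \<Longrightarrow> lin_coeff (F p) q = (if p = q then 1 else 0)"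
    using lp p by (auto simp: linear_pivots_def)
  have "hom_part 1 (F p) = (\<Sum>i\<in>V. single 0 (lin_coeff (F p) i) * var i)"
    by (rule hom_part_1_eq[OF ideal_polys[OF A Q(2)] V])
  also have "\<dots> = (\<Sum>i\<in>V - Q. single 0 (lin_coeff (F p) i) * var i) + (\<Sum>i\<in>Q. single 0 (lin_coeff (F p) i) * var i)"
    by (rule sum.subset_diff[OF Q(1) V])
  also have "(\<Sum>i\<in>Q. single 0 (lin_coeff (F p) i) * var i) = (\<Sum>i\<in>Q. if i = p then var p else 0)"
    by (rule sum.cong) (auto simp: Q(3))
  also have "\<dots> = var p" using p finite_subset[OF Q(1) V] by simp
  finally show ?thesis by (simp add: pivot_tail_def)
qed

text \<open>Subtracting from f the combination of the \<open>F p\<close> with its own pivot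
  coefficients leaves an element of \<open>A\<close> without pivot coefficients, hence without
  linear part.\<close>

lemma linear_parts_span:
  assumes lp: "linear_pivots V A Q F" and A: "ideal A (poly_ring V)" and V: "finite V" and f: "f \<in> A"
  shows "hom_part 1 f = (\<Sum>p\<in>Q. single 0 (lin_coeff f p) * (var p - pivot_tail V Q F p))"
proof -
  have Q: "Q \<subseteq> V" "\<And>p. p \<in> Q \<Longrightarrow> F p \<in> A"
      "\<And>p q. p \<in> Q \<Longrightarrow> q \<in> Q \<Longrightarrow> lin_coeff (F p) q = (if p = q then 1 else 0)"
      "\<And>f. f \<in> A \<Longrightarrow> (\<forall>p\<in>Q. lin_coeff f p = 0) \<Longrightarrow> (\<forall>i. lin_coeff f i = 0)"
    using lp by (auto simp: linear_pivots_def)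
  let ?g = "f - (\<Sum>p\<in>Q. single 0 (lin_coeff f p) * F p)"
  have g: "?g \<in> A" by (intro ideal_diff[OF A] ideal_sum[OF A] ideal_mult[OF A] f Q polys_const)
  have "lin_coeff ?g q = 0" if "q \<in> Q" for q
  proof -
    have "lin_coeff ?g q = lin_coeff f q - (\<Sum>p\<in>Q. if p = q then lin_coeff f q else 0)"
      unfolding lookup_minus lookup_sum mult_const_lookup
      by (intro arg_cong2[where f = minus] refl sum.cong) (auto simp: Q(3) that)
    also have "\<dots> = 0" using that finite_subset[OF Q(1) V] by simp
    finally show ?thesis .
  qed
  then have "\<forall>i. lin_coeff ?g i = 0" by (intro Q(4)[OF g]) blast
  then have "hom_part 1 ?g = 0" unfolding hom_part_1_eq[OF ideal_polys[OF A g] V] by simp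
  then have "hom_part 1 f = (\<Sum>p\<in>Q. hom_part (0 + 1) (single 0 (lin_coeff f p) * F p))"
    by (simp add: hom_part_diff hom_part_sum)
  also have "\<dots> = (\<Sum>p\<in>Q. single 0 (lin_coeff f p) * hom_part 1 (F p))"
    by (intro sum.cong refl hom_part_mult_form[OF forms_const])
  also have "\<dots> = (\<Sum>p\<in>Q. single 0 (lin_coeff f p) * (var p - pivot_tail V Q F p))"
    by (intro sum.cong refl) (simp add: hom_part_1_pivot[OF lp A V])
  finally show ?thesis .
qed

lemma gen_linear_parts:
  assumes lp: "linear_pivots V A Q F" and A: "ideal A (poly_ring V)" and V: "finite V"
  shows "gen V (hom_part 1 ` A) = gen V ((\<lambda>p. var p - pivot_tail V Q F p) ` Q)"
proof
  let ?l = "\<lambda>p. var p - pivot_tail V Q F p"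
  have Q: "Q \<subseteq> V" "\<And>p. p \<in> Q \<Longrightarrow> F p \<in> A" using lp by (auto simp: linear_pivots_def)
  have 1: "hom_part 1 ` A \<subseteq> polys V" using hom_part_polys ideal_polys[OF A] by blast
  have sub: "?l ` Q \<subseteq> hom_part 1 ` A" using hom_part_1_pivot[OF lp A V, symmetric] Q(2) by auto
  then have 2: "?l ` Q \<subseteq> polys V" using 1 by blast
  show "gen V (?l ` Q) \<subseteq> gen V (hom_part 1 ` A)"
    by (rule gen_minimal[OF gen_ideal[OF 1]]) (use sub gen_incl[OF 1] in blast)
  show "gen V (hom_part 1 ` A) \<subseteq> gen V (?l ` Q)"
  proof (rule gen_minimal[OF gen_ideal[OF 2]])
    have "?l p \<in> gen V (?l ` Q)" if "p \<in> Q" for p using that by (intro gen_incl[OF 2]) auto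
    then show "hom_part 1 ` A \<subseteq> gen V (?l ` Q)"
      by (auto simp only: linear_parts_span[OF lp A V] image_subset_iff intro!: ideal_sum[OF gen_ideal[OF 2]]
          ideal_mult[OF gen_ideal[OF 2]] polys_const)
  qed
qed

section \<open>An upper bound for the Hilbert function\<close>

lemma near_mult_mpow:
  assumes P: "ideal P (poly_ring V)" and "a \<in> mpow V s" "b \<in> near V P t"
  shows "a * b \<in> near V P (s + t)"
proof -
  obtain z where z: "z \<in> mpow V t" "b - z \<in> P" using assms(3) by (auto simp: near_iff)
  have "a * b - a * z = a * (b - z)" by (simp add: right_diff_distrib)
  then have "a * b - a * z \<in> P" using ideal_mult[OF P z(2) mpow_polys[OF assms(2)]] by simp
  then show ?thesis unfolding near_iff using mpow_mult[OF assms(2) z(1)] by blast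
qed

lemma mpow_mono: "z \<in> mpow W t \<Longrightarrow> W \<subseteq> V \<Longrightarrow> z \<in> mpow V t"
  by (auto simp: mpow_def intro: polys_mono)

lemma forms_mpow: "p \<in> forms V n \<Longrightarrow> p \<in> mpow V n"
  by (auto simp: graded_def mpow_def)

lemma order_one_linear_part:
  assumes "f \<in> polys V" "lookup f 0 = 0"
  shows "f - hom_part 1 f \<in> mpow V 2"
proof -
  have "2 \<le> mdeg m" if m: "m \<in> keys (f - hom_part 1 f)" for m
  proof -
    have "lookup f m - lookup (hom_part 1 f) m \<noteq> 0" using m by (simp add: in_keys_iff lookup_minus)
    then have "mdeg m \<noteq> 1" "lookup f m \<noteq> 0" by (auto simp: lookup_hom_part split: if_splits)
    then have "mdeg m \<noteq> 0" using assms(2) by (metis mdeg_eq_0_iff)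
    with \<open>mdeg m \<noteq> 1\<close> show ?thesis by simp
  qed
  then show ?thesis using assms by (simp add: mpow_def hom_part_polys)
qed

lemma pivot_near:
  assumes lp: "linear_pivots V A Q F" and A: "ideal A (poly_ring V)" and V: "finite V"
    and A0: "\<And>f. f \<in> A \<Longrightarrow> lookup f 0 = 0" and p: "p \<in> Q"
  shows "var p - pivot_tail V Q F p \<in> near V A 2"
proof -
  have Fp: "F p \<in> A" using lp p by (auto simp: linear_pivots_def)
  have "F p - hom_part 1 (F p) \<in> mpow V 2"
    using order_one_linear_part ideal_polys[OF A Fp] A0[OF Fp] by blast
  then have "F p - (F p - hom_part 1 (F p)) \<in> near V A 2"
    by (intro ideal_diff[OF near_ideal[OF A]] near_ideal_mem[OF Fp] near_mpow_mem[OF A])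
  then show ?thesis by (simp add: hom_part_1_pivot[OF lp A V p])
qed

text \<open>One variable at a time: x_i differs from its substitute by an element of A + M^2, and
  the other factors contribute their full degree.\<close>

lemma subst_monomial_near:
  assumes lp: "linear_pivots V A Q F" and A: "ideal A (poly_ring V)" and V: "finite V"
    and A0: "\<And>f. f \<in> A \<Longrightarrow> lookup f 0 = 0" and m: "keys m \<subseteq> V"
  shows "single m 1 - subst Q (pivot_tail V Q F) (single m 1) \<in> near V A (Suc (mdeg m))"
  using m
proof (induction m rule: monomial_induct)
  case zero
  then show ?case using near_0[OF A] by simp
next
  case (add i m)
  let ?s = "subst Q (pivot_tail V Q F)"
  have "single (single i 1 + m) 1 - ?s (single (single i 1 + m) 1)
      = var i * single m 1 - ?s (var i) * ?s (single m 1)"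
    by (simp add: subst_mult[symmetric] var_def mult_single)
  also have "\<dots> = var i * (single m 1 - ?s (single m 1)) + ?s (single m 1) * (var i - ?s (var i))"
    by (simp add: algebra_simps)
  also have "\<dots> \<in> near V A (Suc (Suc (mdeg m)))"
  proof (rule ideal_add[OF near_ideal[OF A]])
    have "var i * (single m 1 - ?s (single m 1)) \<in> near V A (1 + Suc (mdeg m))"
      by (rule near_mult_mpow[OF A forms_mpow[OF forms_var[OF add(1)]] add.IH])
    then show "var i * (single m 1 - ?s (single m 1)) \<in> near V A (Suc (Suc (mdeg m)))"
      by (simp only: plus_1_eq_Suc)
    have "?s (single m 1) \<in> mpow (V - Q) (mdeg m)"
      by (intro forms_mpow subst_monomial_forms add(2) pivot_tail_forms)
    then have 1: "?s (single m 1) \<in> mpow V (mdeg m)" by (rule mpow_mono) auto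
    have 2: "var i - ?s (var i) \<in> near V A 2"
      using pivot_near[OF lp A V A0, of i] near_0[OF A] by (auto simp: subst_var)
    show "?s (single m 1) * (var i - ?s (var i)) \<in> near V A (Suc (Suc (mdeg m)))"
      using near_mult_mpow[OF A 1 2] by simp
  qed
  finally show ?case by (simp only: mdeg_add mdeg_single plus_1_eq_Suc)
qed

lemma subst_near:
  assumes lp: "linear_pivots V A Q F" and A: "ideal A (poly_ring V)" and V: "finite V"
    and A0: "\<And>f. f \<in> A \<Longrightarrow> lookup f 0 = 0" and z: "z \<in> mpow V r"
  shows "z - subst Q (pivot_tail V Q F) z \<in> near V A (Suc r)"
    and "subst Q (pivot_tail V Q F) z \<in> mpow (V - Q) r"
proof -
  let ?s = "subst Q (pivot_tail V Q F)"
  have z0: "z = (\<Sum>m\<in>keys z. single 0 (lookup z m) * single m 1)"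
    by (simp add: mult_single sum_monomials)
  have m: "keys m \<subseteq> V" "r \<le> mdeg m" if "m \<in> keys z" for m
    using z that by (auto simp: mpow_def polys_def)
  have s: "?s z = (\<Sum>m\<in>keys z. single 0 (lookup z m) * ?s (single m 1))"
    by (subst z0) (simp only: subst_sum subst_mult subst_const)
  have "z - ?s z = (\<Sum>m\<in>keys z. single 0 (lookup z m) * (single m 1 - ?s (single m 1)))"
    by (subst z0) (simp only: s sum_subtractf right_diff_distrib)
  also have "\<dots> \<in> near V A (Suc r)"
  proof (intro ideal_sum[OF near_ideal[OF A]] ideal_mult[OF near_ideal[OF A]] polys_const)
    fix k assume k: "k \<in> keys z"
    show "single k 1 - ?s (single k 1) \<in> near V A (Suc r)"
      using subst_monomial_near[OF lp A V A0 m(1)[OF k]] m(2)[OF k] near_antimono[of "Suc r" "Suc (mdeg k)"]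
      by auto
  qed
  finally show "z - ?s z \<in> near V A (Suc r)" .
  show "?s z \<in> mpow (V - Q) r"
    unfolding s
  proof (intro mpow_sum mpow_mult_left polys_const)
    fix k assume k: "k \<in> keys z"
    show "?s (single k 1) \<in> mpow (V - Q) r"
      using forms_mpow[OF subst_monomial_forms[OF m(1)[OF k] pivot_tail_forms]] m(2)[OF k]
      by (rule mpow_antimono)
  qed
qed

text \<open>Substituting tails turns an element of order r into one in the non-pivot variables, with
  an error in A + M^(r+1). The error is treated in the same way, and after t - r rounds it lies in
  M^t.\<close>

lemma near_nonpivot:
  assumes lp: "linear_pivots V A Q F" and A: "ideal A (poly_ring V)" and V: "finite V"
    and A0: "\<And>f. f \<in> A \<Longrightarrow> lookup f 0 = 0" and z: "z \<in> mpow V r"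
  shows "\<exists>y\<in>mpow (V - Q) r. z - y \<in> near V A t"
  using z
proof (induction "t - r" arbitrary: r z)
  case 0
  then have "t \<le> r" by simp
  then have "z \<in> mpow V t" using "0.prems" by (rule mpow_antimono[rotated])
  then have "z - 0 \<in> near V A t" by (simp add: near_mpow_mem[OF A])
  then show ?case by (rule bexI) (rule mpow_zero)
next
  case (Suc d)
  let ?s = "subst Q (pivot_tail V Q F)"
  obtain z' where z': "z' \<in> mpow V (Suc r)" "z - ?s z - z' \<in> A"
    using subst_near(1)[OF lp A V A0 Suc.prems] by (auto simp: near_iff)
  obtain y where y: "y \<in> mpow (V - Q) (Suc r)" "z' - y \<in> near V A t"
  proof -
    have "d = t - Suc r" using Suc.hyps(2) by simp
    then show thesis using Suc.hyps(1)[OF _ z'(1)] that by blast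
  qed
  have "(z - ?s z - z') + (z' - y) \<in> near V A t"
    by (intro ideal_add[OF near_ideal[OF A]] near_ideal_mem z' y)
  then have "z - (?s z + y) \<in> near V A t" by (simp add: algebra_simps)
  moreover have "?s z + y \<in> mpow (V - Q) r"
    using subst_near(2)[OF lp A V A0 Suc.prems] y(1) by (intro mpow_add) (auto intro: mpow_antimono)
  ultimately show ?case by blast
qed

section \<open>Standard monomials: exponents not divisible by a given one\<close>

definition std_exps :: "nat set \<Rightarrow> (nat \<Rightarrow>\<^sub>0 nat) \<Rightarrow> nat \<Rightarrow> (nat \<Rightarrow>\<^sub>0 nat) set" where
  "std_exps Y mu t = {m. keys m \<subseteq> Y \<and> mdeg m < t \<and> (\<exists>i. lookup m i < lookup mu i)}"

text \<open>Failing to be divisible by \<open>mu\<close> means that some exponent j has a value c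
  below that of \<open>mu\<close>. There are \<open>mdeg mu\<close> such pairs (j, c), and each
  leaves card Y - 1 exponents free below t.\<close>

lemma std_exps_card:
  assumes Y: "finite Y" and mu: "keys mu \<subseteq> Y"
  shows "finite (std_exps Y mu t)" "card (std_exps Y mu t) \<le> mdeg mu * t ^ (card Y - 1)"
proof -
  define M where "M = (\<lambda>(j, c). {m :: nat \<Rightarrow>\<^sub>0 nat. keys m \<subseteq> Y \<and> mdeg m < t \<and> lookup m j = c})"
  have fM: "finite (M (j, c)) \<and> card (M (j, c)) \<le> t ^ (card Y - 1)" if j: "j \<in> Y" for j c
  proof -
    let ?r = "\<lambda>m :: nat \<Rightarrow>\<^sub>0 nat. restrict (lookup m) (Y - {j})"
    have inj: "inj_on ?r (M (j, c))"
    proof (rule inj_onI)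
      fix a b assume ab: "a \<in> M (j, c)" "b \<in> M (j, c)" "?r a = ?r b"
      show "a = b"
      proof (rule poly_mapping_eqI)
        fix i
        consider "i \<in> Y - {j}" | "i = j" | "i \<notin> Y" by blast
        then show "lookup a i = lookup b i"
        proof cases
          case 1
          then show ?thesis using fun_cong[OF ab(3), of i] by simp
        next
          case 2
          then show ?thesis using ab by (simp add: M_def)
        next
          case 3
          then have "i \<notin> keys a" "i \<notin> keys b" using ab by (auto simp: M_def)
          then show ?thesis by (simp add: in_keys_iff)
        qed
      qed
    qed
    have sub: "?r ` M (j, c) \<subseteq> (\<Pi>\<^sub>E i\<in>Y - {j}. {..<t})"
    proof clarify
      fix m assume "m \<in> M (j, c)"
      then have "lookup m i < t" for i using lookup_le_mdeg[of m i] by (simp add: M_def)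
      then show "?r m \<in> (\<Pi>\<^sub>E i\<in>Y - {j}. {..<t})" by auto
    qed
    have fP: "finite (\<Pi>\<^sub>E i\<in>Y - {j}. {..<t})" using Y by (intro finite_PiE) auto
    then have "finite (?r ` M (j, c))" using sub finite_subset by blast
    then have "finite (M (j, c))" using inj by (rule finite_imageD)
    moreover have "card (?r ` M (j, c)) \<le> card (\<Pi>\<^sub>E i\<in>Y - {j}. {..<t})" by (rule card_mono[OF fP sub])
    moreover have "card (\<Pi>\<^sub>E i\<in>Y - {j}. {..<t}) = t ^ (card Y - 1)"
      using Y j by (simp add: card_PiE)
    ultimately show ?thesis by (simp add: card_image[OF inj])
  qed
  let ?I = "SIGMA j:Y. {..<lookup mu j}"
  have sub: "std_exps Y mu t \<subseteq> (\<Union>x\<in>?I. M x)"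
  proof
    fix m assume "m \<in> std_exps Y mu t"
    then obtain i where m: "keys m \<subseteq> Y" "mdeg m < t" "lookup m i < lookup mu i" by (auto simp: std_exps_def)
    then have "i \<in> keys mu" by (simp add: in_keys_iff)
    then have "(i, lookup m i) \<in> ?I" using mu m by auto
    moreover have "m \<in> M (i, lookup m i)" using m by (simp add: M_def)
    ultimately show "m \<in> (\<Union>x\<in>?I. M x)" by blast
  qed
  have fU: "finite (\<Union>x\<in>?I. M x)" using Y fM by auto
  show "finite (std_exps Y mu t)" using sub fU by (rule finite_subset)
  have "card (std_exps Y mu t) \<le> card (\<Union>x\<in>?I. M x)" by (rule card_mono[OF fU sub])
  also have "\<dots> \<le> (\<Sum>x\<in>?I. card (M x))" using Y by (intro card_UN_le) auto
  also have "\<dots> \<le> (\<Sum>x\<in>?I. t ^ (card Y - 1))" using fM by (intro sum_mono) auto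
  also have "\<dots> = mdeg mu * t ^ (card Y - 1)" using Y mu by (simp add: mdeg_superset[OF Y mu])
  finally show "card (std_exps Y mu t) \<le> mdeg mu * t ^ (card Y - 1)" .
qed

text \<open>The form h is congruent modulo A to something of higher order. So a monomial divisible
  by the leading exponent of h is, modulo A + M^t, a combination of smaller monomials of the same
  degree and a remainder of higher order. The outer induction handles the order, the inner one the
  monomial order.\<close>

lemma near_std:
  assumes A: "ideal A (poly_ring V)" and V: "finite V" and Y: "Y \<subseteq> V"
    and nonpiv: "\<And>r z. z \<in> mpow V r \<Longrightarrow> \<exists>y\<in>mpow Y r. z - y \<in> near V A t"
    and h: "h \<in> forms Y s" "h \<in> near V A (Suc s)" "h \<noteq> 0"
    and y: "y \<in> mpow Y r"
  shows "\<exists>x. keys x \<subseteq> std_exps Y (Max (keys h)) t \<and> y - x \<in> near V A t"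
  using y
proof (induction "t - r" arbitrary: r y rule: less_induct)
  case (less r y)
  define mu where "mu = Max (keys h)"
  define good where "good = {y. \<exists>x. keys x \<subseteq> std_exps Y mu t \<and> y - x \<in> near V A t}"
  note ni = near_ideal[OF A, of t]
  have good_add: "a + b \<in> good" if "a \<in> good" "b \<in> good" for a b
  proof -
    from that obtain x x' where *: "keys x \<subseteq> std_exps Y mu t" "a - x \<in> near V A t"
        "keys x' \<subseteq> std_exps Y mu t" "b - x' \<in> near V A t" unfolding good_def by blast
    have eq: "(a + b) - (x + x') = (a - x) + (b - x')" by simp
    have "(a + b) - (x + x') \<in> near V A t" unfolding eq by (rule ideal_add[OF ni *(2,4)])
    moreover have "keys (x + x') \<subseteq> std_exps Y mu t" using * keys_add[of x x'] by blast
    ultimately show ?thesis unfolding good_def by blast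
  qed
  have good_const: "single 0 c * a \<in> good" if a: "a \<in> good" for a c
  proof -
    from a obtain x where *: "keys x \<subseteq> std_exps Y mu t" "a - x \<in> near V A t" unfolding good_def by blast
    have "single 0 c * a - single 0 c * x = single 0 c * (a - x)" by (simp add: right_diff_distrib)
    then have "single 0 c * a - single 0 c * x \<in> near V A t" using ideal_mult[OF ni *(2) polys_const] by simp
    moreover have "keys (single 0 c * x) \<subseteq> std_exps Y mu t"
      using * by (auto simp: in_keys_iff mult_const_lookup)
    ultimately show ?thesis unfolding good_def by blast
  qed
  have good_near: "a \<in> good" if "a \<in> near V A t" for a
    using that unfolding good_def by (intro CollectI exI[of _ 0]) simp
  have good_sum: "sum f B \<in> good" if "\<And>b. b \<in> B \<Longrightarrow> f b \<in> good" for f and B :: "(nat \<Rightarrow>\<^sub>0 nat) set"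
    using that by (induction B rule: infinite_finite_induct) (auto intro: good_add good_near near_0[OF A])
  have mu: "mu \<in> keys h" "\<And>k. k \<in> keys h \<Longrightarrow> k \<le> mu" using h(3) by (auto simp: mu_def intro: Max_in)
  have hY: "keys k \<subseteq> Y" "mdeg k = s" if "k \<in> keys h" for k using h(1) that by (auto simp: graded_def polys_def)
  \<comment> \<open>Higher order is settled by the outer induction, once the element is brought into
    the variables \<open>Y\<close>; that is why \<open>nonpiv\<close> has to preserve the
    order.\<close>
  have high: "a \<in> good" if "a \<in> near V A (Suc r)" "r < t" for a
  proof -
    obtain z where z: "z \<in> mpow V (Suc r)" "a - z \<in> A" using \<open>a \<in> near V A (Suc r)\<close> by (auto simp: near_iff)
    obtain y where y: "y \<in> mpow Y (Suc r)" "z - y \<in> near V A t" using nonpiv[OF z(1)] by blast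
    have "y \<in> good" using less.hyps[OF _ y(1)] \<open>r < t\<close> unfolding good_def mu_def by auto
    moreover have "(a - z) + (z - y) \<in> good"
      by (intro good_near ideal_add[OF ni] near_ideal_mem[OF z(2)] y(2))
    ultimately have "((a - z) + (z - y)) + y \<in> good" by (rule good_add[rotated])
    then show ?thesis by simp
  qed
  have mono: "single m 1 \<in> good" if "keys m \<subseteq> Y" "r \<le> mdeg m" for m
    using that
  proof (induction m rule: wf_induct_rule[OF wf_exponents[OF finite_subset[OF Y V]]])
    case (1 m)
    show ?case
    proof (cases "mdeg m = r \<and> r < t")
      case False
      then have "t \<le> mdeg m \<or> Suc r \<le> mdeg m \<and> r < t" using 1(3) by auto
      then show ?thesis
      proof
        assume "t \<le> mdeg m"
        then have "single m 1 \<in> mpow V t" using 1(2) Y by (intro mpow_single) auto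
        then show ?thesis by (intro good_near near_mpow_mem[OF A])
      next
        assume "Suc r \<le> mdeg m \<and> r < t"
        then have "single m 1 \<in> mpow V (Suc r)" using 1(2) Y by (intro mpow_single) auto
        then show ?thesis using \<open>Suc r \<le> mdeg m \<and> r < t\<close> by (intro high near_mpow_mem[OF A]) auto
      qed
    next
      case True
      show ?thesis
      proof (cases "m \<in> std_exps Y mu t")
        case True
        then show ?thesis unfolding good_def
          by (intro CollectI exI[of _ "single m 1"]) (auto simp: near_0[OF A])
      next
        case False
        then have le: "lookup mu i \<le> lookup m i" for i
          using 1(2) True by (auto simp: std_exps_def not_less)
        define be where "be = m - mu"
        have m: "m = be + mu" using exponent_diff_add[OF le] by (simp add: be_def add.commute)
        have beY: "keys be \<subseteq> Y" using 1(2) by (simp add: m keys_plus_nat)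
        have deg: "mdeg be + s = r" using True hY(2)[OF mu(1)] by (simp add: m mdeg_add)
        have bV: "keys be \<subseteq> V" using beY Y by blast
        \<comment> \<open>The multiple of h has leading exponent m and degree r but agrees modulo A
          with something of order r + 1, so it is already \<open>good\<close>.\<close>
        have "single be 1 * h \<in> near V A (mdeg be + Suc s)"
          by (rule near_mult_mpow[OF A mpow_single h(2)]) (use bV in auto)
        then have hi: "single be 1 * h \<in> good" using deg True by (intro high) auto
        have "h = single mu (lookup h mu) + (\<Sum>k\<in>keys h - {mu}. single k (lookup h k))"
          using mu(1) sum.remove[of "keys h" mu "\<lambda>k. single k (lookup h k)"] by (simp add: sum_monomials)
        then have "single be 1 * h = single m (lookup h mu) + (\<Sum>k\<in>keys h - {mu}. single (be + k) (lookup h k))"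
          by (metis (no_types, lifting) distrib_left m mult_1 mult_single sum.cong sum_distrib_left)
        then have eq: "single m (lookup h mu) = single be 1 * h + single 0 (- 1) * (\<Sum>k\<in>keys h - {mu}. single (be + k) (lookup h k))"
          by (simp add: single_uminus)
        have "single (be + k) (lookup h k) \<in> good" if k: "k \<in> keys h - {mu}" for k
        proof -
          have "k < mu" using k mu(2)[of k] by auto
          then have "be + k < m" by (simp add: m)
          moreover have "keys (be + k) \<subseteq> Y" using beY hY(1)[of k] k by (simp add: keys_plus_nat)
          moreover have "r \<le> mdeg (be + k)" using hY(2)[of k] k deg by (simp add: mdeg_add)
          ultimately have "single (be + k) 1 \<in> good" using 1(1) by blast
          then have "single 0 (lookup h k) * single (be + k) 1 \<in> good" by (rule good_const)
          then show ?thesis by (simp add: mult_single)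
        qed
        then have "single m (lookup h mu) \<in> good"
          unfolding eq by (intro good_add hi good_const good_sum)
        then have "single 0 (1 / lookup h mu) * single m (lookup h mu) \<in> good" by (rule good_const)
        then show ?thesis using mu(1) by (simp add: mult_single in_keys_iff)
      qed
    qed
  qed
  have "y = (\<Sum>m\<in>keys y. single 0 (lookup y m) * single m 1)"
    by (simp add: mult_single sum_monomials)
  also have "\<dots> \<in> good"
    using less.prems by (intro good_sum good_const mono) (auto simp: mpow_def polys_def)
  finally show ?case unfolding good_def mu_def by blast
qed

text \<open>With t = n T the binomial coefficient is at least T^n, while K t^(n-1) is K n^(n-1)
  times T^(n-1). So any T above K n^(n-1) will do.\<close>

lemma binomial_beats_power:
  fixes n K :: nat
  assumes "0 < n"
  shows "\<exists>t\<ge>1. K * t ^ (n - 1) < t choose n"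
proof -
  define T where "T = Suc (K * n ^ (n - 1))"
  let ?t = "n * T"
  have T: "0 < T" by (simp add: T_def)
  have "real T ^ n = (real ?t / real n) ^ n" using assms by simp
  also have "\<dots> \<le> real (?t choose n)"
    using assms T by (intro binomial_ge_n_over_k_pow_k) auto
  finally have 1: "T ^ n \<le> ?t choose n" by (metis of_nat_le_iff of_nat_power)
  have "K * ?t ^ (n - 1) = (K * n ^ (n - 1)) * T ^ (n - 1)" by (simp add: power_mult_distrib mult.assoc)
  also have "\<dots> < T * T ^ (n - 1)" using T by (simp add: T_def)
  also have "\<dots> = T ^ n" using assms by (metis Suc_pred' One_nat_def power_Suc)
  finally have "K * ?t ^ (n - 1) < ?t choose n" using 1 by linarith
  moreover have "1 \<le> ?t" using assms T by (simp add: Suc_le_eq One_nat_def)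
  ultimately show ?thesis by blast
qed

text \<open>Regularity: if the chain of primes is as long as the number of non-pivot variables, an
  initial form outside the ideal of linear parts would make the Hilbert function grow too slowly.\<close>

lemma initial_form_in_linear_parts:
  fixes A :: "('k::field) mpoly set"
  assumes lp: "linear_pivots V A Q F" and A: "ideal A (poly_ring V)" and V: "finite V"
    and A0: "\<And>f. f \<in> A \<Longrightarrow> lookup f 0 = 0"
    and ideals: "\<And>i. i \<le> n \<Longrightarrow> ideal (P i) (poly_ring V)"
    and max: "\<And>p. p \<in> P 0 \<Longrightarrow> lookup p 0 = 0"
    and prime: "\<And>i p q. 0 < i \<Longrightarrow> i \<le> n \<Longrightarrow> p \<in> polys V \<Longrightarrow> q \<in> polys V \<Longrightarrow> p * q \<in> P i \<Longrightarrow> p \<in> P i \<or> q \<in> P i"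
    and chain: "\<And>i. i < n \<Longrightarrow> P (Suc i) \<subset> P i"
    and AP: "A \<subseteq> P n" and n: "n = card (V - Q)"
    and f: "f \<in> A" "f \<noteq> 0"
  shows "initial_form f \<in> gen V (hom_part 1 ` A)"
proof (rule ccontr)
  assume no: "initial_form f \<notin> gen V (hom_part 1 ` A)"
  have Q: "Q \<subseteq> V" using lp by (simp add: linear_pivots_def)
  obtain s where s: "initial_form f = hom_part s f" "\<And>m. m \<in> keys f \<Longrightarrow> s \<le> mdeg m"
    using initial_form_props[OF f(2)] by metis
  have fV: "f \<in> polys V" using ideal_polys[OF A f(1)] .
  let ?h = "hom_part s f" and ?s = "subst Q (pivot_tail V Q F)"
  \<comment> \<open>The offending initial form rewritten in the non-pivot variables. It is nonzero
    because the kernel of the substitution is exactly the ideal of linear parts.\<close>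
  define h where "h = ?s ?h"
  have hV: "?h \<in> forms V s" using fV by (rule hom_part_forms)
  have "h \<noteq> 0"
    using no subst_eq_0_iff[OF graded_polys[OF hV] Q, of "pivot_tail V Q F"] pivot_tail_polys
    unfolding h_def s(1) gen_linear_parts[OF lp A V] by blast
  have hY: "h \<in> forms (V - Q) s" unfolding h_def by (rule subst_forms[OF hV pivot_tail_forms])
  have "f - ?h \<in> mpow V (Suc s)"
  proof -
    have "Suc s \<le> mdeg m" if m: "m \<in> keys (f - ?h)" for m
    proof -
      have "lookup f m - lookup ?h m \<noteq> 0" using m by (simp add: in_keys_iff lookup_minus)
      then have "mdeg m \<noteq> s" "m \<in> keys f" by (auto simp: lookup_hom_part in_keys_iff split: if_splits)
      then show ?thesis using s(2)[of m] by simp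
    qed
    then show ?thesis using fV by (simp add: mpow_def hom_part_polys)
  qed
  \<comment> \<open>The expression is h: f lies in A, the tail of f has order s + 1, and the
    substitution changes a form of degree s by an element of A + M^(s+1).\<close>
  then have "f - (f - ?h) - (?h - h) \<in> near V A (Suc s)"
    unfolding h_def
    by (intro ideal_diff[OF near_ideal[OF A]] near_ideal_mem[OF f(1)] near_mpow_mem[OF A]
        subst_near(1)[OF lp A V A0] forms_mpow[OF hV])
  then have hn: "h \<in> near V A (Suc s)" by simp
  define mu where "mu = Max (keys h)"
  have "mu \<in> keys h" using \<open>h \<noteq> 0\<close> by (auto simp: mu_def intro: Max_in)
  then have muY: "keys mu \<subseteq> V - Q" using polys_keysD[OF graded_polys[OF hY]] by blast
  obtain c where c: "\<And>t. 1 \<le> t \<Longrightarrow> \<exists>u. (\<forall>i. u i \<in> polys V) \<and> indep_mod (near V (P n) (c * t)) (t choose n) u"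
    using chain_growth[of V n P, OF V ideals max prime chain] by blast
  have le: "t choose n \<le> mdeg mu * (c * t) ^ (n - 1)" if t: "1 \<le> t" for t
  proof -
    obtain u where u: "\<And>i. u i \<in> polys V" "indep_mod (near V (P n) (c * t)) (t choose n) u"
      using c[OF t] by blast
    have "indep_mod (near V A (c * t)) (t choose n) u"
      using u(2) near_mono[OF AP] by (rule indep_mod_antimono)
    then have "t choose n \<le> card (std_exps (V - Q) mu (c * t))"
    proof (rule indep_mod_card_le[OF u(1) _ near_ideal[OF A]])
      show "finite (std_exps (V - Q) mu (c * t))" using V by (intro std_exps_card(1)[OF _ muY]) auto
      fix p :: "'k mpoly" assume p: "p \<in> polys V"
      note nonpiv = near_nonpivot[OF lp A V A0, of _ _ "c * t"]
      obtain y where y: "y \<in> mpow (V - Q) 0" "p - y \<in> near V A (c * t)"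
        using nonpiv[of p 0] p by auto
      obtain x where x: "keys x \<subseteq> std_exps (V - Q) mu (c * t)" "y - x \<in> near V A (c * t)"
        using near_std[OF A V _ nonpiv hY hn \<open>h \<noteq> 0\<close> y(1)] unfolding mu_def by blast
      have "(p - y) + (y - x) \<in> near V A (c * t)" by (rule ideal_add[OF near_ideal[OF A] y(2) x(2)])
      then show "\<exists>x. keys x \<subseteq> std_exps (V - Q) mu (c * t) \<and> p - x \<in> near V A (c * t)"
        using x(1) by auto
    qed
    also have "\<dots> \<le> mdeg mu * (c * t) ^ (n - 1)" unfolding n using V by (intro std_exps_card(2)[OF _ muY]) auto
    finally show ?thesis .
  qed
  show False
  \<comment> \<open>Without non-pivot variables h is a constant, so its leading exponent is 0 and
    the upper bound is 0 against the binomial coefficient 1.\<close>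
  proof (cases "n = 0")
    case True
    then have "V - Q = {}" using n V by simp
    then have "keys mu = {}" using muY by blast
    then have "mdeg mu = 0" by (simp add: mdeg_def)
    then show False using le[of 1] True by simp
  next
    case False
    then obtain t where t: "1 \<le> t" "mdeg mu * c ^ (n - 1) * t ^ (n - 1) < t choose n"
      using binomial_beats_power[of n "mdeg mu * c ^ (n - 1)"] by auto
    then show False using le[OF t(1)] by (simp add: power_mult_distrib mult.assoc)
  qed
qed

section \<open>Irreducible closed sets through the origin of the chart\<close>

lemma chart_ideal_0:
  "chart_ideal N X 0 = {p \<in> polys {1..N}. \<forall>a\<in>X. a 0 = 1 \<longrightarrow> eval_mpoly a p = 0}"
proof -
  have "{0..N} - {0} = {1..N}" by (auto simp: One_nat_def)
  then show ?thesis by (simp add: chart_ideal_def)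
qed

lemma chart_ideal_ideal: "ideal (chart_ideal N X 0) (poly_ring {1..N})"
  unfolding ideal_poly_ring_iff chart_ideal_0 by (auto simp: eval_add eval_mult)

lemma chart_ideal_const:
  assumes "origin_pt \<in> X" "p \<in> chart_ideal N X 0"
  shows "lookup p 0 = 0"
proof -
  have "p \<in> polys {1..N}" "eval_mpoly origin_pt p = 0"
    using assms by (auto simp: chart_ideal_0 origin_pt_def)
  then show ?thesis by (simp add: eval_origin_S)
qed

lemma eval_form_scale:
  assumes "g \<in> forms V n"
  shows "eval_mpoly (\<lambda>i. c * a i) g = c ^ n * eval_mpoly a g"
proof -
  have *: "exp_prod (\<lambda>i. c * a i) m = c ^ mdeg m * exp_prod a m" for m
    by (simp add: exp_prod_def mdeg_def power_mult_distrib prod.distrib power_sum)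
  have "eval_mpoly (\<lambda>i. c * a i) g = (\<Sum>m\<in>keys g. c ^ n * (lookup g m * exp_prod a m))"
    unfolding eval_mpoly_eq lin_ext_def
    by (rule sum.cong) (use assms in \<open>auto simp: * graded_def\<close>)
  then show ?thesis by (simp add: eval_mpoly_eq lin_ext_def sum_distrib_left)
qed

lemma proj_closed_scale:
  assumes Z: "proj_closed N Z" and a: "a \<in> Z" and c: "c \<noteq> 0"
  shows "(\<lambda>i. c * a i) \<in> Z"
proof -
  obtain G where G: "G \<subseteq> (\<Union>n. forms {0..N} n)" "Z = proj_zeros N G" using Z by (auto simp: proj_closed_def)
  have "eval_mpoly (\<lambda>i. c * a i) g = 0" if "g \<in> G" for g
  proof -
    obtain n where "g \<in> forms {0..N} n" using G(1) \<open>g \<in> G\<close> by auto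
    then show ?thesis using a G(2) \<open>g \<in> G\<close> by (simp add: eval_form_scale proj_zeros_def)
  qed
  then show ?thesis using a c unfolding G(2) proj_zeros_def proj_coords_def by auto
qed

lemma proj_closed_Int_form:
  assumes Z: "proj_closed N Z" and F: "F \<in> forms {0..N} n"
  shows "proj_closed N {a \<in> Z. eval_mpoly a F = 0}"
proof -
  obtain G where G: "G \<subseteq> (\<Union>n. forms {0..N} n)" "Z = proj_zeros N G" using Z by (auto simp: proj_closed_def)
  have "insert F G \<subseteq> (\<Union>n. forms {0..N} n)" using G(1) F by blast
  moreover have "{a \<in> Z. eval_mpoly a F = 0} = proj_zeros N (insert F G)"
    unfolding G(2) proj_zeros_def by auto
  ultimately show ?thesis unfolding proj_closed_def by blast
qed

lemma irreducible_closed_forms: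
  assumes Z: "irreducible_closed N Z" and F: "F \<in> forms {0..N} m" and G: "G \<in> forms {0..N} n"
    and cover: "\<And>a. a \<in> Z \<Longrightarrow> eval_mpoly a F = 0 \<or> eval_mpoly a G = 0"
  shows "(\<forall>a\<in>Z. eval_mpoly a F = 0) \<or> (\<forall>a\<in>Z. eval_mpoly a G = 0)"
proof -
  let ?A = "{a \<in> Z. eval_mpoly a F = 0}" and ?B = "{a \<in> Z. eval_mpoly a G = 0}"
  have c: "proj_closed N Z" using Z by (simp add: irreducible_closed_def)
  have "Z = ?A \<union> ?B" using cover by blast
  then have "Z = ?A \<or> Z = ?B"
    using Z proj_closed_Int_form[OF c F] proj_closed_Int_form[OF c G]
    unfolding irreducible_closed_def by blast
  then show ?thesis by blast
qed

lemma homogenise_chart: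
  assumes p: "p \<in> polys {1..N}"
  obtains M F where "F \<in> forms {0..N} M" "\<And>a. a 0 = 1 \<Longrightarrow> eval_mpoly a F = eval_mpoly a p"
proof -
  let ?M = "Max (insert 0 (mdeg ` keys p))"
  let ?e = "\<lambda>m. m + single 0 (?M - mdeg m)"
  let ?F = "\<Sum>m\<in>keys p. single (?e m) (lookup p m)"
  have "?F \<in> forms {0..N} ?M"
  proof (rule graded_sum)
    fix m assume m: "m \<in> keys p"
    have "keys m \<subseteq> {1..N}" using polys_keysD[OF p m] .
    then have "keys (?e m) \<subseteq> {0..N}" by (auto simp: keys_plus_nat split: if_splits)
    then have "single (?e m) (lookup p m) \<in> forms {0..N} (mdeg (?e m))" by (rule forms_single)
    moreover have "mdeg m \<le> ?M" using m by (intro Max_ge) auto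
    then have "mdeg (?e m) = ?M" by (simp add: mdeg_add)
    ultimately show "single (?e m) (lookup p m) \<in> forms {0..N} ?M" by simp
  qed
  moreover have "eval_mpoly a ?F = eval_mpoly a p" if "a 0 = 1" for a
  proof -
    have "eval_mpoly a ?F = (\<Sum>m\<in>keys p. lookup p m * exp_prod a m)"
      by (simp add: eval_sum eval_single exp_prod_add that)
    then show ?thesis by (simp add: eval_mpoly_eq lin_ext_def)
  qed
  ultimately show ?thesis using that by blast
qed

lemma normalise_point:
  assumes Z: "proj_closed N Z" and a: "a \<in> Z" "a 0 \<noteq> 0"
  obtains b c where "b \<in> Z" "b 0 = 1" "a = (\<lambda>i. c * b i)"
proof -
  have "(\<lambda>i. inverse (a 0) * a i) \<in> Z" using a by (intro proj_closed_scale[OF Z]) auto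
  moreover have "a = (\<lambda>i. a 0 * (inverse (a 0) * a i))" using a(2) by (auto simp: fun_eq_iff)
  ultimately show ?thesis using that[of "\<lambda>i. inverse (a 0) * a i" "a 0"] a(2) by auto
qed

lemma vanish_by_chart:
  assumes Z: "proj_closed N Z" and F: "F \<in> forms V n"
    and van: "\<And>b. b \<in> Z \<Longrightarrow> b 0 = 1 \<Longrightarrow> eval_mpoly b F = 0" and a: "a \<in> Z" "a 0 \<noteq> 0"
  shows "eval_mpoly a F = 0"
proof -
  obtain b c where "b \<in> Z" "b 0 = 1" "a = (\<lambda>i. c * b i)" using normalise_point[OF Z a] .
  then show ?thesis using van by (simp add: eval_form_scale[OF F])
qed

text \<open>Irreducibility is a property of projective closed sets, so p and q are replaced by forms
  F and G with the same values on the chart.\<close>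

lemma chart_ideal_prime:
  assumes Z: "irreducible_closed N Z"
    and p: "p \<in> polys {1..N}" and q: "q \<in> polys {1..N}" and pq: "p * q \<in> chart_ideal N Z 0"
  shows "p \<in> chart_ideal N Z 0 \<or> q \<in> chart_ideal N Z 0"
proof -
  have c: "proj_closed N Z" using Z by (simp add: irreducible_closed_def)
  obtain m F where F: "F \<in> forms {0..N} m" "\<And>a. a 0 = 1 \<Longrightarrow> eval_mpoly a F = eval_mpoly a p"
    using homogenise_chart[OF p] by blast
  obtain n G where G: "G \<in> forms {0..N} n" "\<And>a. a 0 = 1 \<Longrightarrow> eval_mpoly a G = eval_mpoly a q"
    using homogenise_chart[OF q] by blast
  \<comment> \<open>F G is known to vanish only where x_0 is nonzero; the factor x_0 takes care of
    the hyperplane at infinity.\<close>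
  have x0: "var 0 \<in> forms {0..N} 1" by (rule forms_var) simp
  have FG: "F * G \<in> forms {0..N} (m + n)" by (rule forms_mult[OF F(1) G(1)])
  have van: "eval_mpoly b (F * G) = 0" if "b \<in> Z" "b 0 = 1" for b
  proof -
    have "eval_mpoly b (p * q) = 0" using pq that by (simp add: chart_ideal_0)
    then show ?thesis using F(2) G(2) that by (simp add: eval_mult)
  qed
  have "eval_mpoly a (var 0 * F) = 0 \<or> eval_mpoly a (var 0 * G) = 0" if "a \<in> Z" for a
    using vanish_by_chart[OF c FG van \<open>a \<in> Z\<close>] by (cases "a 0 = 0") (auto simp: eval_mult)
  from irreducible_closed_forms[OF Z forms_mult[OF x0 F(1)] forms_mult[OF x0 G(1)] this]
  have "(\<forall>a\<in>Z. eval_mpoly a (var 0 * F) = 0) \<or> (\<forall>a\<in>Z. eval_mpoly a (var 0 * G) = 0)" .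
  then show ?thesis
  proof
    assume "\<forall>a\<in>Z. eval_mpoly a (var 0 * F) = 0"
    then have "eval_mpoly a p = 0" if "a \<in> Z" "a 0 = 1" for a using F(2)[of a] that by (auto simp: eval_mult)
    then show ?thesis using p by (simp add: chart_ideal_0)
  next
    assume "\<forall>a\<in>Z. eval_mpoly a (var 0 * G) = 0"
    then have "eval_mpoly a q = 0" if "a \<in> Z" "a 0 = 1" for a using G(2)[of a] that by (auto simp: eval_mult)
    then show ?thesis using q by (simp add: chart_ideal_0)
  qed
qed

lemma chart_ideal_antimono: "Z \<subseteq> Z' \<Longrightarrow> chart_ideal N Z' i \<subseteq> chart_ideal N Z i"
  by (auto simp: chart_ideal_def)

text \<open>A form vanishing on Z but not on Z' gives the separating element. If it vanished on the
  chart part of Z', irreducibility would make it or x_0 vanish on all of Z', and x_0 is nonzero at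
  q.\<close>

lemma chart_ideal_strict:
  assumes Z: "proj_closed N Z" and Z': "irreducible_closed N Z'" and sub: "Z \<subset> Z'" and q: "origin_pt \<in> Z'"
  shows "chart_ideal N Z' 0 \<subset> chart_ideal N Z 0"
proof -
  have c: "proj_closed N Z'" using Z' by (simp add: irreducible_closed_def)
  obtain G where G: "G \<subseteq> (\<Union>n. forms {0..N} n)" "Z = proj_zeros N G" using Z by (auto simp: proj_closed_def)
  obtain a where a: "a \<in> Z'" "a \<notin> Z" using sub by blast
  have "Z' \<subseteq> proj_coords N" using c by (auto simp: proj_closed_def proj_zeros_def)
  then obtain g where g: "g \<in> G" "eval_mpoly a g \<noteq> 0" using a G(2) by (auto simp: proj_zeros_def)
  obtain n where gn: "g \<in> forms {0..N} n" using G(1) g(1) by auto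
  have "dehom 0 g \<in> chart_ideal N Z 0"
    using g(1) G(2) by (auto simp: chart_ideal_0 dehom_polys[OF graded_polys[OF gn]] eval_dehom proj_zeros_def)
  moreover have "dehom 0 g \<notin> chart_ideal N Z' 0"
  proof
    assume "dehom 0 g \<in> chart_ideal N Z' 0"
    then have van: "eval_mpoly b g = 0" if "b \<in> Z'" "b 0 = 1" for b
      using that by (auto simp: chart_ideal_0 eval_dehom)
    have x0: "var 0 \<in> forms {0..N} 1" by (rule forms_var) simp
    have "eval_mpoly b (var 0) = 0 \<or> eval_mpoly b g = 0" if "b \<in> Z'" for b
      using vanish_by_chart[OF c gn van that] by auto
    from irreducible_closed_forms[OF Z' x0 gn this] show False
      using g(2) a(1) q by (auto simp: origin_pt_def)
  qed
  ultimately show ?thesis using chart_ideal_antimono[of Z Z' N 0] sub by blast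
qed

text \<open>A finite supremum of a nonempty set of extended naturals is a maximum. The condition 0 <
  n excludes the empty set, whose supremum is 0.\<close>

lemma chain_dim_attained:
  assumes "chain_dim C = enat n" "0 < n"
  obtains Z where "\<And>i. i \<le> n \<Longrightarrow> Z i \<in> C" "\<And>i. i < n \<Longrightarrow> Z i \<subset> Z (Suc i)"
proof -
  let ?S = "{enat n | n. \<exists>Z. (\<forall>i\<le>n. Z i \<in> C) \<and> (\<forall>i<n. Z i \<subset> Z (Suc i))}"
  have S: "Sup ?S = enat n" using assms(1) by (simp add: chain_dim_def)
  have "?S \<noteq> {}"
  proof
    assume "?S = {}"
    then have "Sup ?S = 0" by (simp only: Sup_enat_def if_True simp_thms)
    then show False using S assms(2) by (simp add: zero_enat_def)
  qed
  moreover have "finite ?S"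
  proof (rule ccontr)
    assume "infinite ?S"
    then have "Sup ?S = \<infinity>" using calculation by (simp only: Sup_enat_def if_False simp_thms)
    then show False using S by simp
  qed
  ultimately have "Sup ?S = Max ?S" "Max ?S \<in> ?S" by (simp_all only: Sup_enat_def if_False if_True Max_in simp_thms)
  then have "enat n \<in> ?S" using S by argo
  then show ?thesis using that by auto
qed

section \<open>Smooth points\<close>

lemma sum_fun_apply: "(\<Sum>j\<in>A. g j) i = (\<Sum>j\<in>A. g j i)"
  for g :: "'b \<Rightarrow> 'c \<Rightarrow> 'a::comm_monoid_add"
  by (induction A rule: infinite_finite_induct) auto

lemma tangent_dim_eq:
  fixes X :: "(nat \<Rightarrow> 'k::field) set"
  assumes lp: "linear_pivots {1..N} (chart_ideal N X 0) Q F"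
  shows "tangent_dim N X = card ({1..N} - Q)"
proof -
  interpret vs: vector_space "\<lambda>c (v :: nat \<Rightarrow> 'k) i. c * v i"
    by standard (auto simp: fun_eq_iff algebra_simps)
  let ?A = "chart_ideal N X 0" and ?V = "{1..N}" and ?Y = "{1..N} - Q"
  let ?t = "pivot_tail ?V Q F"
  note A = chart_ideal_ideal[of N X]
  have fV: "finite ?V" by simp
  have Q: "Q \<subseteq> ?V" "\<And>p. p \<in> Q \<Longrightarrow> F p \<in> ?A" using lp by (auto simp: linear_pivots_def)
  have tail: "eval_mpoly v (?t p) = - (\<Sum>j\<in>?Y. lin_coeff (F p) j * v j)" for v p
    by (simp add: pivot_tail_def eval_mpoly_eq lin_ext_uminus lin_ext_sum lin_ext_mult lin_ext_single var_def)
  \<comment> \<open>The equations of the tangent space solved for the pivot coordinates, which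
    become linear functions of the free coordinates.\<close>
  have TS: "tangent_space N X = {v. (\<forall>i. i \<notin> ?V \<longrightarrow> v i = 0) \<and> (\<forall>p\<in>Q. v p = eval_mpoly v (?t p))}" (is "_ = ?T")
  proof (intro equalityI subsetI)
    fix v assume v: "v \<in> tangent_space N X"
    have "v p = eval_mpoly v (?t p)" if "p \<in> Q" for p
    proof -
      have "eval_mpoly v (hom_part 1 (F p)) = 0" using v Q(2)[OF that] by (simp add: tangent_space_def)
      then show ?thesis by (simp add: hom_part_1_pivot[OF lp A fV that] eval_diff)
    qed
    then show "v \<in> ?T" using v by (simp add: tangent_space_def)
  next
    fix v assume v: "v \<in> ?T"
    have "eval_mpoly v (hom_part 1 f) = 0" if "f \<in> ?A" for f
      unfolding linear_parts_span[OF lp A fV that] eval_sum eval_mult eval_diff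
      by (rule sum.neutral) (use v in auto)
    then show "v \<in> tangent_space N X" using v by (simp add: tangent_space_def)
  qed
  \<comment> \<open>The tangent vector with free coordinate j equal to 1 and the other free ones 0;
    its pivot coordinates are forced by the tails.\<close>
  define b where "b = (\<lambda>j i. if i = j then 1 else if i \<in> Q then - lin_coeff (F i) j else 0)"
  have bY: "b j i = (if i = j then 1 else 0)" if "i \<notin> Q" for i j using that by (simp add: b_def)
  have bQ: "b j i = - lin_coeff (F i) j" if "i \<in> Q" "j \<in> ?Y" for i j using that by (auto simp: b_def)
  have bT: "b j \<in> ?T" if j: "j \<in> ?Y" for j
  proof -
    have "b j i = 0" if "i \<notin> ?V" for i
    proof -
      have "i \<notin> Q" "i \<noteq> j" using that Q(1) j by auto
      then show ?thesis by (simp add: bY)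
    qed
    moreover have "b j p = eval_mpoly (b j) (?t p)" if p: "p \<in> Q" for p
    proof -
      have "(\<Sum>i\<in>?Y. lin_coeff (F p) i * b j i) = (\<Sum>i\<in>?Y. if i = j then lin_coeff (F p) j else 0)"
        by (rule sum.cong) (auto simp: bY)
      then show ?thesis using j p by (simp add: tail bQ)
    qed
    ultimately show ?thesis by simp
  qed
  have inj: "inj_on b ?Y"
  proof (rule inj_onI)
    fix i j assume ij: "i \<in> ?Y" "j \<in> ?Y" "b i = b j"
    then have "b i i = b j i" by metis
    moreover have "b i i = 1" using ij(1) by (subst bY) auto
    moreover have "b j i = (if i = j then 1 else 0)" using ij(1) by (intro bY) auto
    ultimately show "i = j" by (auto split: if_splits)
  qed
  have sumv: "(\<Sum>j\<in>?Y. (\<lambda>i. c j * b j i)) = (\<lambda>i. \<Sum>j\<in>?Y. c j * b j i)" for c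
    by (rule ext) (simp add: sum_fun_apply)
  have "vs.independent (b ` ?Y)"
  proof
    assume "vs.dependent (b ` ?Y)"
    then obtain f v where f: "v \<in> b ` ?Y" "f v \<noteq> 0" "(\<Sum>v\<in>b ` ?Y. (\<lambda>i. f v * v i)) = 0"
      using vs.dependent_finite[of "b ` ?Y"] by auto
    then have "(\<Sum>j\<in>?Y. (\<lambda>i. f (b j) * b j i)) = 0" by (simp add: sum.reindex[OF inj])
    then have z: "(\<Sum>j\<in>?Y. f (b j) * b j i) = 0" for i unfolding sumv by (metis zero_fun_apply)
    obtain j where j: "j \<in> ?Y" "v = b j" using f(1) by blast
    have "(\<Sum>l\<in>?Y. f (b l) * b l j) = (\<Sum>l\<in>?Y. if l = j then f (b j) else 0)"
      using j by (intro sum.cong) (auto simp: bY)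
    then show False using z[of j] j f(2) by simp
  qed
  moreover have "vs.span (b ` ?Y) = vs.span ?T"
  proof
    show "vs.span (b ` ?Y) \<subseteq> vs.span ?T" using bT by (intro vs.span_mono) auto
    have "?T \<subseteq> vs.span (b ` ?Y)"
    proof
      fix v assume v: "v \<in> ?T"
      have "v = (\<Sum>j\<in>?Y. (\<lambda>i. v j * b j i))"
      proof
        fix i
        have *: "(\<Sum>j\<in>?Y. v j * b j i) = (\<Sum>j\<in>?Y. if j = i then v i else 0)" if "i \<notin> Q"
          by (rule sum.cong) (use that in \<open>auto simp: bY\<close>)
        consider "i \<in> ?Y" | "i \<in> Q" | "i \<notin> ?V" by blast
        then have "v i = (\<Sum>j\<in>?Y. v j * b j i)"
        proof cases
          case 1
          then show ?thesis using * by simp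
        next
          case 2
          then have "(\<Sum>j\<in>?Y. v j * b j i) = (\<Sum>j\<in>?Y. - (lin_coeff (F i) j * v j))"
            by (intro sum.cong) (auto simp: bQ)
          also have "\<dots> = v i" using v 2 by (simp add: tail sum_negf)
          finally show ?thesis by simp
        next
          case 3
          then have "v i = 0" "i \<notin> Q" using v Q(1) by auto
          then show ?thesis using * 3 by simp
        qed
        then show "v i = (\<Sum>j\<in>?Y. (\<lambda>i. v j * b j i)) i" by (simp add: sumv)
      qed
      also have "\<dots> \<in> vs.span (b ` ?Y)" by (intro vs.span_sum vs.span_scale vs.span_base) auto
      finally show "v \<in> vs.span (b ` ?Y)" .
    qed
    then show "vs.span ?T \<subseteq> vs.span (b ` ?Y)" by (rule vs.span_minimal) (rule vs.subspace_span)
  qed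
  ultimately have "vs.dim ?T = card (b ` ?Y)" by (intro vs.dim_eq_card)
  then show ?thesis unfolding tangent_dim_def TS by (simp add: card_image[OF inj])
qed

lemma smooth_dims:
  assumes lp: "linear_pivots {1..N} (chart_ideal N X 0) Q F" and smooth: "smooth_at_origin N X"
  shows "local_dim N X origin_pt = enat (card ({1..N} - Q))" "codim N X = card Q"
proof -
  have d: "scheme_dim N X = enat (card ({1..N} - Q))" "local_dim N X origin_pt = scheme_dim N X"
    using smooth by (simp_all add: smooth_at_origin_def tangent_dim_eq[OF lp])
  then show "local_dim N X origin_pt = enat (card ({1..N} - Q))" by simp
  have Q: "Q \<subseteq> {1..N}" using lp by (simp add: linear_pivots_def)
  then have "card ({1..N} - Q) = N - card Q" "card Q \<le> N"
    using card_mono[OF _ Q] by (simp_all add: card_Diff_subset finite_subset)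
  then show "codim N X = card Q" by (simp add: codim_def d(1))
qed

text \<open>That initial forms lie in the ideal of linear parts is the regularity statement. The
  other inclusion is elementary: functions vanish at \<open>q\<close>, so a nonzero linear part is
  the initial form.\<close>

lemma tangent_cone_smooth:
  assumes closed: "proj_closed N X" and q: "origin_pt \<in> X" and smooth: "smooth_at_origin N X"
  shows "tangent_cone_ideal N X = tangent_space_ideal N X"
proof -
  let ?A = "chart_ideal N X 0" and ?V = "{1..N}"
  note A = chart_ideal_ideal[of N X] and A0 = chart_ideal_const[OF q]
  have V: "finite ?V" by simp
  obtain Q F where lp: "linear_pivots ?V ?A Q F" using linear_pivots_exist[OF A V] by blast
  define n where "n = card (?V - Q)"
  have n: "local_dim N X origin_pt = enat n" using smooth_dims(1)[OF lp smooth] by (simp add: n_def)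
  have init: "initial_form f \<in> tangent_space_ideal N X" if f: "f \<in> ?A" "f \<noteq> 0" for f
  proof (cases "n = 0")
    case True
    \<comment> \<open>For n = 0 no strict chain is required, and the chart ideal itself serves as
      P_0.\<close>
    show ?thesis unfolding tangent_space_ideal_def
      by (rule initial_form_in_linear_parts[OF lp A V A0, where n = n and P = "\<lambda>_. ?A"])
        (use True A A0 f in \<open>auto simp: n_def[symmetric]\<close>)
  next
    case False
    then have "0 < n" by simp
    then obtain Z where Z: "\<And>i. i \<le> n \<Longrightarrow> Z i \<in> {Z. irreducible_closed N Z \<and> Z \<subseteq> X \<and> origin_pt \<in> Z}"
        "\<And>i. i < n \<Longrightarrow> Z i \<subset> Z (Suc i)"
      using chain_dim_attained[OF n[unfolded local_dim_def]] by blast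
    then have Z': "\<And>i. i \<le> n \<Longrightarrow> irreducible_closed N (Z i)" "\<And>i. i \<le> n \<Longrightarrow> Z i \<subseteq> X"
      "\<And>i. i \<le> n \<Longrightarrow> origin_pt \<in> Z i" by auto
    show ?thesis unfolding tangent_space_ideal_def
    \<comment> \<open>Passing to ideals reverses the chain: P_0 belongs to the smallest closed set,
      and P_n to the largest, which is contained in \<open>X\<close>.\<close>
    proof (rule initial_form_in_linear_parts[OF lp A V A0, where n = n and P = "\<lambda>i. chart_ideal N (Z i) 0"])
      show "ideal (chart_ideal N (Z i) 0) (poly_ring ?V)" for i by (rule chart_ideal_ideal)
      show "lookup p 0 = 0" if "p \<in> chart_ideal N (Z 0) 0" for p
        using chart_ideal_const[OF Z'(3)[of 0] that] by simp
      show "p \<in> chart_ideal N (Z i) 0 \<or> r \<in> chart_ideal N (Z i) 0"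
        if "0 < i" "i \<le> n" "p \<in> polys ?V" "r \<in> polys ?V" "p * r \<in> chart_ideal N (Z i) 0" for i p r
        using chart_ideal_prime[OF Z'(1) that(3-5)] that(2) by blast
      show "chart_ideal N (Z (Suc i)) 0 \<subset> chart_ideal N (Z i) 0" if "i < n" for i
        using that Z'(1)[of i] Z'(1)[of "Suc i"] Z'(3)[of "Suc i"] Z(2)[of i]
        by (intro chart_ideal_strict) (auto simp: irreducible_closed_def)
      show "?A \<subseteq> chart_ideal N (Z n) 0" using Z'(2)[of n] by (intro chart_ideal_antimono) simp
    qed (use f in \<open>simp_all add: n_def\<close>)
  qed
  have T1: "hom_part 1 ` ?A \<subseteq> polys ?V" using hom_part_polys ideal_polys[OF A] by blast
  have I: "{initial_form f | f. f \<in> ?A \<and> f \<noteq> 0} \<subseteq> tangent_space_ideal N X" using init by blast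
  have IT: "ideal (tangent_space_ideal N X) (poly_ring ?V)"
    unfolding tangent_space_ideal_def by (rule gen_ideal[OF T1])
  have I1: "{initial_form f | f. f \<in> ?A \<and> f \<noteq> 0} \<subseteq> polys ?V" using I ideal_polys[OF IT] by blast
  have "hom_part 1 f \<in> tangent_cone_ideal N X" if f: "f \<in> ?A" for f
  proof (cases "hom_part 1 f = 0")
    case True
    then show ?thesis unfolding tangent_cone_ideal_def using ideal_0[OF gen_ideal[OF I1]] by simp
  next
    case False
    have "1 \<le> mdeg m" if "m \<in> keys f" for m
    proof -
      have "m \<noteq> 0" using that A0[OF f] by (auto simp: in_keys_iff)
      then have "mdeg m \<noteq> 0" by (simp add: mdeg_eq_0_iff)
      then show ?thesis by simp
    qed
    then have "initial_form f = hom_part 1 f" using False by (intro initial_form_eq)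
    moreover have "f \<noteq> 0" using False by auto
    ultimately have "hom_part 1 f \<in> {initial_form f | f. f \<in> ?A \<and> f \<noteq> 0}" using f by force
    then show ?thesis unfolding tangent_cone_ideal_def by (rule gen_incl[OF I1])
  qed
  then have "gen ?V (hom_part 1 ` ?A) \<subseteq> tangent_cone_ideal N X"
    unfolding tangent_cone_ideal_def by (intro gen_minimal[OF gen_ideal[OF I1]]) auto
  moreover have "tangent_cone_ideal N X \<subseteq> tangent_space_ideal N X"
    unfolding tangent_cone_ideal_def by (rule gen_minimal[OF IT I])
  ultimately show ?thesis unfolding tangent_space_ideal_def by blast
qed

section \<open>The Koszul complex of a regular sequence of linear forms\<close>

text \<open>Free modules of rank \<open>n\<close> as total functions vanishing from \<open>n\<close>
  on, so that all ranks share one type and direct sums are concatenations.\<close>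

definition vecs :: "nat set \<Rightarrow> nat \<Rightarrow> (nat \<Rightarrow> ('k::field) mpoly) set" where
  "vecs V n = {v. (\<forall>t. v t \<in> polys V) \<and> (\<forall>t\<ge>n. v t = 0)}"

definition vec_forms :: "nat set \<Rightarrow> nat \<Rightarrow> nat \<Rightarrow> (nat \<Rightarrow> ('k::field) mpoly) set" where
  "vec_forms V n d = {v. (\<forall>t. v t \<in> forms V d) \<and> (\<forall>t\<ge>n. v t = 0)}"

lemma vecsD: "v \<in> vecs V n \<Longrightarrow> v t \<in> polys V" "v \<in> vecs V n \<Longrightarrow> n \<le> t \<Longrightarrow> v t = 0"
  by (auto simp: vecs_def)

lemma vecs_0_dim: "v \<in> vecs V 0 \<longleftrightarrow> v = 0"
  by (auto simp: vecs_def fun_eq_iff)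

lemma vecs_0 [simp]: "0 \<in> vecs V n"
  by (auto simp: vecs_def)

lemma vecs_add: "u \<in> vecs V n \<Longrightarrow> v \<in> vecs V n \<Longrightarrow> u + v \<in> vecs V n"
  by (auto simp: vecs_def)

lemma vecs_uminus: "u \<in> vecs V n \<Longrightarrow> - u \<in> vecs V n"
  by (auto simp: vecs_def)

lemma vecs_scale: "p \<in> polys V \<Longrightarrow> v \<in> vecs V n \<Longrightarrow> (\<lambda>t. p * v t) \<in> vecs V n"
  by (auto simp: vecs_def)

lemma vec_forms_vecs: "v \<in> vec_forms V n d \<Longrightarrow> v \<in> vecs V n"
  unfolding vec_forms_def vecs_def using graded_polys by blast

definition koszul_ranks :: "nat \<Rightarrow> nat \<Rightarrow> nat" where
  "koszul_ranks e j = (case j of 0 \<Rightarrow> 0 | Suc i \<Rightarrow> e choose i)"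

text \<open>Pascal's rule, which is the rank count of the mapping cone.\<close>

lemma koszul_ranks_Suc: "koszul_ranks (Suc e) (Suc j) = koszul_ranks e (Suc j) + koszul_ranks e j"
  by (cases j) (auto simp: koszul_ranks_def)

lemma koszul_ranks_0 [simp]: "koszul_ranks e 0 = 0"
  by (simp add: koszul_ranks_def)

text \<open>The differential \<open>D j\<close> goes from homological degree \<open>j\<close> to \<open>j - 1\<close>; position \<open>j + 1\<close> has rank
  \<open>koszul_ranks e (Suc j) = e choose j\<close>, and position \<open>0\<close> is the zero module, which spares a case
  distinction in the mapping cone.\<close>

definition koszul_complex ::
    "nat set \<Rightarrow> nat \<Rightarrow> (nat \<Rightarrow> ('k::field) mpoly) \<Rightarrow> (nat \<Rightarrow> (nat \<Rightarrow> 'k mpoly) \<Rightarrow> nat \<Rightarrow> 'k mpoly) \<Rightarrow> bool" where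
  "koszul_complex V e l D \<longleftrightarrow>
     (\<forall>j u v. D j (u + v) = D j u + D j v) \<and>
     (\<forall>j p u. D j (\<lambda>t. p * u t) = (\<lambda>s. p * D j u s)) \<and>
     (\<forall>j. \<forall>u\<in>vecs V (koszul_ranks e (Suc j)). D j u \<in> vecs V (koszul_ranks e j)) \<and>
     (\<forall>j d. \<forall>u\<in>vec_forms V (koszul_ranks e (Suc j)) d. D j u \<in> vec_forms V (koszul_ranks e j) (Suc d)) \<and>
     (\<forall>j. \<forall>u\<in>vecs V (koszul_ranks e (Suc (Suc j))). D j (D (Suc j) u) = 0) \<and>
     (\<forall>j\<ge>1. \<forall>u\<in>vecs V (koszul_ranks e (Suc j)). D j u = 0 \<longrightarrow>
        (\<exists>w\<in>vecs V (koszul_ranks e (Suc (Suc j))). D (Suc j) w = u)) \<and>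
     (\<forall>u\<in>vecs V e. D 1 u 0 = (\<Sum>t<e. u t * l t))"

definition vec_join :: "nat \<Rightarrow> (nat \<Rightarrow> 'a) \<Rightarrow> (nat \<Rightarrow> 'a) \<Rightarrow> nat \<Rightarrow> 'a" where
  "vec_join n a b s = (if s < n then a s else b (s - n))"

definition vec_fst :: "nat \<Rightarrow> (nat \<Rightarrow> 'a::zero) \<Rightarrow> nat \<Rightarrow> 'a" where
  "vec_fst n v s = (if s < n then v s else 0)"

definition vec_snd :: "nat \<Rightarrow> (nat \<Rightarrow> 'a) \<Rightarrow> nat \<Rightarrow> 'a" where
  "vec_snd n v s = v (s + n)"

lemma vec_join_fst_snd: "vec_join n (vec_fst n v) (vec_snd n v) = v"
  by (auto simp: vec_join_def vec_fst_def vec_snd_def fun_eq_iff)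

lemma vec_snd_join [simp]: "vec_snd n (vec_join n a b) = b"
  by (auto simp: vec_join_def vec_snd_def fun_eq_iff)

lemma vec_fst_join: "a \<in> vecs V n \<Longrightarrow> vec_fst n (vec_join n a b) = a"
  by (auto simp: vec_join_def vec_fst_def vecs_def fun_eq_iff)

lemma vec_fst_vecs: "v \<in> vecs V (n + m) \<Longrightarrow> vec_fst n v \<in> vecs V n"
  by (auto simp: vec_fst_def vecs_def)

lemma vec_snd_vecs: "v \<in> vecs V (n + m) \<Longrightarrow> vec_snd n v \<in> vecs V m"
  by (auto simp: vec_snd_def vecs_def)

lemma vec_join_vecs: "a \<in> vecs V n \<Longrightarrow> b \<in> vecs V m \<Longrightarrow> vec_join n a b \<in> vecs V (n + m)"
  by (auto simp: vec_join_def vecs_def)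

lemma vec_fst_forms: "v \<in> vec_forms V (n + m) d \<Longrightarrow> vec_fst n v \<in> vec_forms V n d"
  by (auto simp: vec_fst_def vec_forms_def)

lemma vec_snd_forms: "v \<in> vec_forms V (n + m) d \<Longrightarrow> vec_snd n v \<in> vec_forms V m d"
  by (auto simp: vec_snd_def vec_forms_def)

lemma vec_join_forms: "a \<in> vec_forms V n d \<Longrightarrow> b \<in> vec_forms V m d \<Longrightarrow> vec_join n a b \<in> vec_forms V (n + m) d"
  by (auto simp: vec_join_def vec_forms_def)

lemma vec_join_0 [simp]: "vec_join n 0 0 = 0"
  by (auto simp: vec_join_def fun_eq_iff)

lemma vec_join_eq_0:
  assumes "vec_join n a b = 0" "a \<in> vecs V n"
  shows "a = 0" "b = 0"
proof -
  have "vec_fst n (vec_join n a b) = a" by (rule vec_fst_join[OF assms(2)])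
  then have "a s = (if s < n then vec_join n a b s else 0)" for s by (metis vec_fst_def)
  then show "a = 0" using assms(1) by (simp add: fun_eq_iff)
  have "vec_snd n (vec_join n a b) = b" by simp
  then show "b = 0" using assms(1) by (auto simp: vec_snd_def fun_eq_iff)
qed

text \<open>The mapping cone of multiplication by \<open>x\<close> on the complex \<open>D\<close>:
  a pair (a, b) goes to (D a + x b, - D b).\<close>

definition koszul_cone ::
    "nat \<Rightarrow> ('k::field) mpoly \<Rightarrow> (nat \<Rightarrow> (nat \<Rightarrow> 'k mpoly) \<Rightarrow> nat \<Rightarrow> 'k mpoly) \<Rightarrow> nat \<Rightarrow> (nat \<Rightarrow> 'k mpoly) \<Rightarrow> nat \<Rightarrow> 'k mpoly" where
  "koszul_cone e x D j v = (case j of 0 \<Rightarrow> 0 | Suc i \<Rightarrow>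
     vec_join (koszul_ranks e (Suc i))
       (D (Suc i) (vec_fst (koszul_ranks e (Suc (Suc i))) v) + (\<lambda>t. x * vec_snd (koszul_ranks e (Suc (Suc i))) v t))
       (- D i (vec_snd (koszul_ranks e (Suc (Suc i))) v)))"

text \<open>Exactness of the cone: for a cycle (a, b) one finds c with D c = b; then a + x c is a
  cycle of the old complex and equals D y, and (y, -c) is mapped to (a, b).\<close>

lemma koszul_cone_complex:
  fixes l :: "nat \<Rightarrow> ('k::field) mpoly"
  assumes K: "koszul_complex V e l D" and l: "\<And>t. t \<le> e \<Longrightarrow> l t \<in> forms V 1"
    and reg: "\<And>s. s \<in> polys V \<Longrightarrow> l e * s \<in> gen V (l ` {..<e}) \<Longrightarrow> s \<in> gen V (l ` {..<e})"
  shows "koszul_complex V (Suc e) l (koszul_cone e (l e) D)"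
proof -
  let ?r = "koszul_ranks e" and ?x = "l e" and ?D = "koszul_cone e (l e) D"
  have add: "D j (u + v) = D j u + D j v" for j u v using K by (simp add: koszul_complex_def)
  have scale: "D j (\<lambda>t. p * u t) = (\<lambda>s. p * D j u s)" for j p u using K by (simp add: koszul_complex_def)
  have into: "u \<in> vecs V (?r (Suc j)) \<Longrightarrow> D j u \<in> vecs V (?r j)" for j u using K by (simp add: koszul_complex_def)
  have grade: "u \<in> vec_forms V (?r (Suc j)) d \<Longrightarrow> D j u \<in> vec_forms V (?r j) (Suc d)" for j u d
    using K by (simp add: koszul_complex_def)
  have DD: "u \<in> vecs V (?r (Suc (Suc j))) \<Longrightarrow> D j (D (Suc j) u) = 0" for j u
    using K by (simp add: koszul_complex_def)
  have exact: "1 \<le> j \<Longrightarrow> u \<in> vecs V (?r (Suc j)) \<Longrightarrow> D j u = 0 \<Longrightarrow> \<exists>w\<in>vecs V (?r (Suc (Suc j))). D (Suc j) w = u" for j u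
    using K unfolding koszul_complex_def by blast
  have aug: "u \<in> vecs V e \<Longrightarrow> D 1 u 0 = (\<Sum>t<e. u t * l t)" for u
    using K unfolding koszul_complex_def by blast
  have D0: "D j 0 = 0" for j
  proof -
    have "D j (0 + 0) = D j 0 + D j 0" by (rule add)
    then show ?thesis by simp
  qed
  have Dneg: "D j (- u) = - D j u" for j u
    using add[of j u "- u"] D0[of j] by (simp add: eq_neg_iff_add_eq_0 add.commute)
  have xp: "?x \<in> polys V" using l graded_polys by blast
  have DS: "?D (Suc j) v = vec_join (?r (Suc j)) (D (Suc j) (vec_fst (?r (Suc (Suc j))) v)
      + (\<lambda>t. ?x * vec_snd (?r (Suc (Suc j))) v t)) (- D j (vec_snd (?r (Suc (Suc j))) v))" for j v
    by (simp add: koszul_cone_def)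
  have D'0: "?D 0 v = 0" for v by (simp add: koszul_cone_def)
  note rS = koszul_ranks_Suc[of e]
  have "?D j (u + v) = ?D j u + ?D j v" for j u v
  proof (cases j)
    case (Suc i)
    have 1: "vec_fst n (u + v) = vec_fst n u + vec_fst n v" for n by (auto simp: vec_fst_def fun_eq_iff)
    have 2: "vec_snd n (u + v) = vec_snd n u + vec_snd n v" for n by (auto simp: vec_snd_def fun_eq_iff)
    show ?thesis unfolding Suc DS 1 2 add
      by (auto simp: vec_join_def fun_eq_iff distrib_left)
  qed (simp add: D'0)
  moreover have "?D j (\<lambda>t. p * u t) = (\<lambda>s. p * ?D j u s)" for j p u
  proof (cases j)
    case (Suc i)
    have 1: "vec_fst n (\<lambda>t. p * u t) = (\<lambda>t. p * vec_fst n u t)" for n by (auto simp: vec_fst_def fun_eq_iff)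
    have 2: "vec_snd n (\<lambda>t. p * u t) = (\<lambda>t. p * vec_snd n u t)" for n by (auto simp: vec_snd_def fun_eq_iff)
    show ?thesis unfolding Suc DS 1 2 scale
      by (auto simp: vec_join_def fun_eq_iff distrib_left mult.left_commute)
  qed (simp add: D'0 fun_eq_iff)
  moreover have into': "?D j u \<in> vecs V (koszul_ranks (Suc e) j)" if u: "u \<in> vecs V (koszul_ranks (Suc e) (Suc j))" for j u
  proof (cases j)
    case (Suc i)
    note u' = u[unfolded Suc rS]
    show ?thesis unfolding Suc DS rS
      by (intro vec_join_vecs vecs_add vecs_scale vecs_uminus into xp vec_fst_vecs[OF u'] vec_snd_vecs[OF u'])
  qed (simp add: D'0)
  moreover have "?D j u \<in> vec_forms V (koszul_ranks (Suc e) j) (Suc d)"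
    if u: "u \<in> vec_forms V (koszul_ranks (Suc e) (Suc j)) d" for j u d
  proof (cases j)
    case (Suc i)
    note u' = u[unfolded Suc rS]
    have s: "vec_snd (?r (Suc (Suc i))) u \<in> vec_forms V (?r (Suc i)) d" by (rule vec_snd_forms[OF u'])
    have "?x * vec_snd (?r (Suc (Suc i))) u t \<in> forms V (1 + d)" for t
      using s l[of e] by (intro forms_mult) (auto simp: vec_forms_def)
    then have "?x * vec_snd (?r (Suc (Suc i))) u t \<in> forms V (Suc d)" for t by (simp only: plus_1_eq_Suc)
    then have "(\<lambda>t. ?x * vec_snd (?r (Suc (Suc i))) u t) \<in> vec_forms V (?r (Suc i)) (Suc d)"
      using s by (auto simp: vec_forms_def)
    moreover have "D (Suc i) (vec_fst (?r (Suc (Suc i))) u) \<in> vec_forms V (?r (Suc i)) (Suc d)"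
      by (rule grade[OF vec_fst_forms[OF u']])
    moreover have "D i (vec_snd (?r (Suc (Suc i))) u) \<in> vec_forms V (?r i) (Suc d)" by (rule grade[OF s])
    ultimately show ?thesis unfolding Suc DS rS
      by (intro vec_join_forms) (auto simp: vec_forms_def)
  qed (simp add: D'0 vec_forms_def)
  moreover have "?D j (?D (Suc j) u) = 0" if u: "u \<in> vecs V (koszul_ranks (Suc e) (Suc (Suc j)))" for j u
  proof (cases j)
    case (Suc i)
    note u' = u[unfolded Suc rS]
    let ?a = "vec_fst (?r (Suc (Suc (Suc i)))) u" and ?b = "vec_snd (?r (Suc (Suc (Suc i)))) u"
    have a: "?a \<in> vecs V (?r (Suc (Suc (Suc i))))" by (rule vec_fst_vecs[OF u'])
    have b: "?b \<in> vecs V (?r (Suc (Suc i)))" by (rule vec_snd_vecs[OF u'])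
    let ?a' = "D (Suc (Suc i)) ?a + (\<lambda>t. ?x * ?b t)"
    have a': "?a' \<in> vecs V (?r (Suc (Suc i)))" by (intro vecs_add into vecs_scale a b xp)
    have "?D (Suc i) (?D (Suc (Suc i)) u) = vec_join (?r (Suc i)) (D (Suc i) ?a' + (\<lambda>t. ?x * (- D (Suc i) ?b) t)) (- D i (- D (Suc i) ?b))"
      unfolding DS[of "Suc i"] unfolding DS[of i] vec_snd_join vec_fst_join[OF a'] ..
    moreover have "D (Suc i) ?a' + (\<lambda>t. ?x * (- D (Suc i) ?b) t) = 0"
      unfolding add scale DD[OF a] by (auto simp: fun_eq_iff)
    moreover have "- D i (- D (Suc i) ?b) = 0" by (simp add: Dneg DD[OF b])
    ultimately show ?thesis unfolding Suc by simp
  qed (simp add: D'0)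
  moreover have "\<exists>w\<in>vecs V (koszul_ranks (Suc e) (Suc (Suc j))). ?D (Suc j) w = u"
    if j: "1 \<le> j" and u: "u \<in> vecs V (koszul_ranks (Suc e) (Suc j))" and z: "?D j u = 0" for j u
  proof -
    obtain i where i: "j = Suc i" using j by (cases j) (auto simp: One_nat_def)
    note u' = u[unfolded i rS]
    let ?a = "vec_fst (?r (Suc (Suc i))) u" and ?b = "vec_snd (?r (Suc (Suc i))) u"
    have a: "?a \<in> vecs V (?r (Suc (Suc i)))" by (rule vec_fst_vecs[OF u'])
    have b: "?b \<in> vecs V (?r (Suc i))" by (rule vec_snd_vecs[OF u'])
    have A: "D (Suc i) ?a + (\<lambda>t. ?x * ?b t) \<in> vecs V (?r (Suc i))" by (intro vecs_add into vecs_scale a b xp)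
    have z1: "D (Suc i) ?a + (\<lambda>t. ?x * ?b t) = 0" and z2: "D i ?b = 0"
      using vec_join_eq_0[OF z[unfolded i DS] A] by simp_all
    have "\<exists>c\<in>vecs V (?r (Suc (Suc i))). D (Suc i) c = ?b"
    \<comment> \<open>Only in degree 0 is the old complex not exact. There the cycle condition says
      that x b lies in the ideal of the earlier forms, and regularity puts b into that ideal, the
      image of D 1.\<close>
    proof (cases "i = 0")
      case False
      then show ?thesis using exact[of i ?b] b z2 by (simp add: One_nat_def Suc_le_eq)
    next
      case True
      have r2: "?r (Suc (Suc i)) = e" "?r (Suc i) = 1" by (simp_all add: True koszul_ranks_def)
      have lp: "l ` {..<e} \<subseteq> polys V"
      proof clarify
        fix t assume "t < e"
        then show "l t \<in> polys V" using graded_polys[OF l[of t]] by simp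
      qed
      have lt: "l t \<in> gen V (l ` {..<e})" if "t < e" for t using gen_incl[OF lp] that by blast
      have a0: "D 1 ?a 0 = (\<Sum>t<e. ?a t * l t)" using aug a by (simp add: r2)
      have "D 1 ?a 0 + ?x * ?b 0 = 0" using fun_cong[OF z1, of 0] by (simp add: True One_nat_def)
      then have "?x * ?b 0 = - (\<Sum>t<e. ?a t * l t)" using a0 by (simp add: add_eq_0_iff)
      also have "\<dots> \<in> gen V (l ` {..<e})"
      proof (intro ideal_uminus[OF gen_ideal[OF lp]] ideal_sum[OF gen_ideal[OF lp]])
        fix t assume "t \<in> {..<e}"
        then show "?a t * l t \<in> gen V (l ` {..<e})"
          using lt by (intro ideal_mult[OF gen_ideal[OF lp]] vecsD(1)[OF a]) simp
      qed
      finally have "?b 0 \<in> gen V (l ` {..<e})" by (rule reg[OF vecsD(1)[OF b]])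
      also have "gen V (l ` {..<e}) = {\<Sum>t\<in>{..<e}. c t * l t | c. \<forall>t. c t \<in> polys V}"
        using lp by (intro gen_image) auto
      finally obtain c where c: "?b 0 = (\<Sum>t<e. c t * l t)" "\<And>t. c t \<in> polys V" by auto
      let ?c = "vec_fst e c"
      have cv: "?c \<in> vecs V e" using c(2) by (auto simp: vecs_def vec_fst_def)
      have "D 1 ?c 0 = ?b 0" unfolding aug[OF cv] c(1) by (simp add: vec_fst_def)
      moreover have "D 1 ?c \<in> vecs V 1" using into[of ?c 1] cv r2 True by (simp add: One_nat_def)
      ultimately have "D 1 ?c s = ?b s" for s
        using vecsD(2)[of "D 1 ?c" V 1 s] vecsD(2)[OF b, of s] r2 by (cases s) (auto simp: One_nat_def)
      then have "D (Suc i) ?c = ?b" by (simp add: True One_nat_def fun_eq_iff)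
      then show ?thesis using cv r2 by auto
    qed
    then obtain c where c: "c \<in> vecs V (?r (Suc (Suc i)))" "D (Suc i) c = ?b" by blast
    have "D (Suc i) (?a + (\<lambda>t. ?x * c t)) = 0" unfolding add scale c(2) by (rule z1)
    moreover have ac: "?a + (\<lambda>t. ?x * c t) \<in> vecs V (?r (Suc (Suc i)))" by (intro vecs_add vecs_scale a c(1) xp)
    ultimately obtain y where y: "y \<in> vecs V (?r (Suc (Suc (Suc i))))" "D (Suc (Suc i)) y = ?a + (\<lambda>t. ?x * c t)"
      using exact[of "Suc i"] by (auto simp: One_nat_def)
    let ?w = "vec_join (?r (Suc (Suc (Suc i)))) y (- c)"
    have "?w \<in> vecs V (koszul_ranks (Suc e) (Suc (Suc j)))"
      unfolding i rS by (intro vec_join_vecs vecs_uminus y c)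
    moreover have "?D (Suc j) ?w = u"
    proof -
      have "?D (Suc j) ?w = vec_join (?r (Suc (Suc i))) ((?a + (\<lambda>t. ?x * c t)) + (\<lambda>t. ?x * (- c) t)) (- D (Suc i) (- c))"
        unfolding i DS vec_snd_join vec_fst_join[OF y(1)] y(2) ..
      also have "(?a + (\<lambda>t. ?x * c t)) + (\<lambda>t. ?x * (- c) t) = ?a" by (auto simp: fun_eq_iff)
      also have "- D (Suc i) (- c) = ?b" by (simp add: Dneg c(2))
      finally show ?thesis by (simp only: vec_join_fst_snd)
    qed
    ultimately show ?thesis by blast
  qed
  moreover have "?D 1 u 0 = (\<Sum>t<Suc e. u t * l t)" if u: "u \<in> vecs V (Suc e)" for u
  proof -
    have r: "?r (Suc (Suc 0)) = e" "?r (Suc 0) = 1" by (simp_all add: koszul_ranks_def)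
    have f: "vec_fst e u \<in> vecs V e" using u by (auto simp: vecs_def vec_fst_def)
    have "?D 1 u 0 = D 1 (vec_fst e u) 0 + ?x * vec_snd e u 0"
      unfolding One_nat_def DS r by (simp add: vec_join_def)
    also have "D 1 (vec_fst e u) 0 = (\<Sum>t<e. u t * l t)" unfolding aug[OF f] by (simp add: vec_fst_def)
    finally show ?thesis by (simp add: vec_snd_def mult.commute)
  qed
  ultimately show ?thesis unfolding koszul_complex_def by blast
qed

lemma koszul_complex_exists:
  fixes l :: "nat \<Rightarrow> ('k::field) mpoly"
  assumes l: "\<And>t. t < e \<Longrightarrow> l t \<in> forms V 1"
    and reg: "\<And>j s. j < e \<Longrightarrow> s \<in> polys V \<Longrightarrow> l j * s \<in> gen V (l ` {..<j}) \<Longrightarrow> s \<in> gen V (l ` {..<j})"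
  shows "\<exists>D. koszul_complex V e l D"
  using assms
proof (induction e)
  case 0
  have r: "koszul_ranks 0 (Suc (Suc j)) = 0" for j by (simp add: koszul_ranks_def)
  have "\<exists>w\<in>vecs V (koszul_ranks 0 (Suc (Suc j))). 0 = u" if "1 \<le> j" "u \<in> vecs V (koszul_ranks 0 (Suc j))" for j and u :: "nat \<Rightarrow> 'k mpoly"
    using that by (cases j) (auto simp: r vecs_0_dim One_nat_def intro: vecs_0)
  then have "koszul_complex V 0 l (\<lambda>_ _. 0)"
    by (auto simp: koszul_complex_def vec_forms_def fun_eq_iff)
  then show ?case by blast
next
  case (Suc e)
  then obtain D where "koszul_complex V e l D" by (meson less_SucI)
  then have "koszul_complex V (Suc e) l (koszul_cone e (l e) D)"
    using Suc.prems by (intro koszul_cone_complex) auto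
  then show ?case by blast
qed

text \<open>Substitution for \<open>R\<close> identifies the quotient by the earlier forms with a
  polynomial ring, a domain. The next form contains no variable from \<open>R\<close>, so it
  survives unchanged and nonzero.\<close>

lemma pivot_forms_regular:
  fixes th :: "nat \<Rightarrow> ('k::field) mpoly"
  assumes Q: "Q \<subseteq> V" and th: "\<And>i. i \<in> Q \<Longrightarrow> th i \<in> polys (V - Q)"
    and R: "R \<subseteq> Q" and p: "p \<in> Q" "p \<notin> R" and s: "s \<in> polys V"
    and mem: "(var p - th p) * s \<in> gen V ((\<lambda>i. var i - th i) ` R)"
  shows "s \<in> gen V ((\<lambda>i. var i - th i) ` R)"
proof -
  have RV: "R \<subseteq> V" using R Q by blast
  have thR: "th i \<in> polys (V - R)" if "i \<in> Q" for i
    using th[OF that] by (rule polys_mono[rotated]) (use R in auto)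
  have thR': "th i \<in> polys (V - R)" if "i \<in> R" for i using thR that R by blast
  have l: "var p - th p \<in> polys (V - R)" using thR[OF p(1)] p Q by auto
  have lV: "var p - th p \<in> polys V" using l by (rule polys_mono[rotated]) auto
  have sl: "subst R th (var p - th p) = var p - th p" by (rule subst_id[OF l]) auto
  have "subst R th ((var p - th p) * s) = 0"
    using mem subst_eq_0_iff[OF polys_mult[OF lV s] RV, of th] thR' by blast
  then have "(var p - th p) * subst R th s = 0" by (simp add: subst_mult sl)
  moreover have "var p - th p \<noteq> 0"
  proof
    assume "var p - th p = 0"
    then have "var p = th p" by simp
    then have "(var p :: 'k mpoly) \<in> polys (V - Q)" using th[OF p(1)] by (simp only:)
    moreover have "single p 1 \<in> keys (var p :: 'k mpoly)" by (simp add: var_def)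
    ultimately have "keys (single p (1::nat)) \<subseteq> V - Q" by (rule polys_keysD)
    then show False using p(1) by simp
  qed
  ultimately have "subst R th s = 0" by simp
  then show ?thesis using subst_eq_0_iff[OF s RV, of th] thR' by blast
qed

section \<open>Homomorphisms from graded free modules\<close>

text \<open>A common interface for multiplication in the polynomial ring and
  \<open>free_scale\<close>, so that the augmentation and the differentials are built by the same
  extension lemmas.\<close>

definition scaling :: "(('k::field) mpoly \<Rightarrow> 'm \<Rightarrow> 'm::ab_group_add) \<Rightarrow> bool" where
  "scaling sc \<longleftrightarrow> (\<forall>p q x. sc (p + q) x = sc p x + sc q x) \<and> (\<forall>p x y. sc p (x + y) = sc p x + sc p y) \<and>
     (\<forall>p q x. sc (p * q) x = sc p (sc q x))"

lemma scaling_0: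
  assumes "scaling sc"
  shows "sc 0 x = 0" "sc p 0 = 0"
proof -
  have "sc (0 + 0) x = sc 0 x + sc 0 x" "sc p (0 + 0) = sc p 0 + sc p 0"
    using assms unfolding scaling_def by blast+
  then show "sc 0 x = 0" "sc p 0 = 0" by simp_all
qed

lemma scaling_times: "scaling ((*) :: ('k::field) mpoly \<Rightarrow> 'k mpoly \<Rightarrow> 'k mpoly)"
  by (simp add: scaling_def algebra_simps)

lemma lookup_free_scale: "lookup (free_scale p u) b = p * lookup u b"
  by (auto simp: free_scale_def map.rep_eq when_def)

lemma scaling_free_scale: "scaling (free_scale :: ('k::field) mpoly \<Rightarrow> ('b \<Rightarrow>\<^sub>0 'k mpoly) \<Rightarrow> 'b \<Rightarrow>\<^sub>0 'k mpoly)"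
  unfolding scaling_def
  by (intro conjI allI; rule poly_mapping_eqI) (auto simp: lookup_free_scale lookup_add algebra_simps)

lemma free_modI: "keys u \<subseteq> B \<Longrightarrow> (\<And>b. lookup u b \<in> polys V) \<Longrightarrow> u \<in> free_mod V B"
  by (auto simp: free_mod_def)

lemma free_modD: "u \<in> free_mod V B \<Longrightarrow> keys u \<subseteq> B" "u \<in> free_mod V B \<Longrightarrow> lookup u b \<in> polys V"
  by (auto simp: free_mod_def)

lemma free_mod_0 [simp]: "0 \<in> free_mod V B"
  by (auto simp: free_mod_def)

lemma free_mod_add: "u \<in> free_mod V B \<Longrightarrow> v \<in> free_mod V B \<Longrightarrow> u + v \<in> free_mod V B"
  using keys_add[of u v] by (auto simp: free_mod_def lookup_add)

lemma free_mod_uminus: "u \<in> free_mod V B \<Longrightarrow> - u \<in> free_mod V B"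
  by (auto simp: free_mod_def in_keys_iff)

lemma free_mod_diff: "u \<in> free_mod V B \<Longrightarrow> v \<in> free_mod V B \<Longrightarrow> u - v \<in> free_mod V B"
  using free_mod_add[of u V B "- v"] free_mod_uminus[of v V B] by simp

lemma free_mod_scale: "p \<in> polys V \<Longrightarrow> u \<in> free_mod V B \<Longrightarrow> free_scale p u \<in> free_mod V B"
  by (auto simp: free_mod_def in_keys_iff lookup_free_scale)

lemma free_graded_free_mod: "u \<in> free_graded V B d n \<Longrightarrow> u \<in> free_mod V B"
  by (simp add: free_graded_def)

lemma free_graded_lookup: "u \<in> free_graded V B d n \<Longrightarrow> lookup u b \<in> graded V (d b) n"
  unfolding free_graded_def by blast

definition free_ext :: "(('k::field) mpoly \<Rightarrow> 'm \<Rightarrow> 'm::ab_group_add) \<Rightarrow> ('b \<Rightarrow> 'm) \<Rightarrow> ('b \<Rightarrow>\<^sub>0 'k mpoly) \<Rightarrow> 'm" where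
  "free_ext sc U u = (\<Sum>b\<in>keys u. sc (lookup u b) (U b))"

lemma free_ext_superset:
  assumes "scaling sc" "finite A" "keys u \<subseteq> A"
  shows "free_ext sc U u = (\<Sum>b\<in>A. sc (lookup u b) (U b))"
  unfolding free_ext_def
  by (rule sum.mono_neutral_left) (use assms scaling_0[OF assms(1)] in \<open>auto simp: in_keys_iff\<close>)

lemma free_ext_add:
  assumes "scaling sc"
  shows "free_ext sc U (u + v) = free_ext sc U u + free_ext sc U v"
proof -
  let ?A = "keys u \<union> keys v"
  have "free_ext sc U (u + v) = (\<Sum>b\<in>?A. sc (lookup (u + v) b) (U b))"
    by (rule free_ext_superset[OF assms]) (auto intro!: subsetD[OF keys_add])
  moreover have "free_ext sc U u = (\<Sum>b\<in>?A. sc (lookup u b) (U b))"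
    by (rule free_ext_superset[OF assms]) auto
  moreover have "free_ext sc U v = (\<Sum>b\<in>?A. sc (lookup v b) (U b))"
    by (rule free_ext_superset[OF assms]) auto
  ultimately show ?thesis using assms by (simp add: lookup_add scaling_def sum.distrib)
qed

lemma free_ext_0 [simp]: "free_ext sc U 0 = 0"
  by (simp add: free_ext_def)

lemma free_ext_uminus: "scaling sc \<Longrightarrow> free_ext sc U (- u) = - free_ext sc U u"
  using free_ext_add[of sc U u "- u"] by (simp add: eq_neg_iff_add_eq_0 add.commute)

lemma free_ext_diff: "scaling sc \<Longrightarrow> free_ext sc U (u - v) = free_ext sc U u - free_ext sc U v"
  using free_ext_add[of sc U u "- v"] by (simp add: free_ext_uminus)

lemma scaling_sum: "scaling sc \<Longrightarrow> sc p (\<Sum>x\<in>A. f x) = (\<Sum>x\<in>A. sc p (f x))"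
  by (induction A rule: infinite_finite_induct) (auto simp: scaling_0 scaling_def)

lemma free_ext_scale:
  assumes "scaling sc"
  shows "free_ext sc U (free_scale p u) = sc p (free_ext sc U u)"
proof -
  have "free_ext sc U (free_scale p u) = (\<Sum>b\<in>keys u. sc (lookup (free_scale p u) b) (U b))"
    by (rule free_ext_superset[OF assms]) (auto simp: in_keys_iff lookup_free_scale)
  also have "\<dots> = (\<Sum>b\<in>keys u. sc p (sc (lookup u b) (U b)))"
    using assms by (simp add: lookup_free_scale scaling_def)
  also have "\<dots> = sc p (free_ext sc U u)" by (simp add: free_ext_def scaling_sum[OF assms])
  finally show ?thesis .
qed

lemma sum_closed:
  "0 \<in> M \<Longrightarrow> (\<And>x y. x \<in> M \<Longrightarrow> y \<in> M \<Longrightarrow> x + y \<in> M) \<Longrightarrow> (\<And>a. a \<in> A \<Longrightarrow> f a \<in> M) \<Longrightarrow> sum f A \<in> M"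
  by (induction A rule: infinite_finite_induct) auto

lemma free_ext_mem:
  assumes "u \<in> free_mod V B" "0 \<in> M" "\<And>x y. x \<in> M \<Longrightarrow> y \<in> M \<Longrightarrow> x + y \<in> M"
    and "\<And>p b. p \<in> polys V \<Longrightarrow> b \<in> B \<Longrightarrow> sc p (U b) \<in> M"
  shows "free_ext sc U u \<in> M"
  unfolding free_ext_def using assms free_modD[OF assms(1)] by (intro sum_closed) auto

lemma graded_hom_free_ext:
  assumes sc: "scaling sc"
    and M: "\<And>n. 0 \<in> M n" "\<And>n x y. x \<in> M n \<Longrightarrow> y \<in> M n \<Longrightarrow> x + y \<in> M n"
    and U: "\<And>b n p. b \<in> B \<Longrightarrow> p \<in> graded V (d b) n \<Longrightarrow> sc p (U b) \<in> M n"
  shows "graded_hom V B d sc M (free_ext sc U)"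
  unfolding graded_hom_def
proof (intro conjI ballI allI image_subsetI)
  show "free_ext sc U u \<in> M n" if "u \<in> free_graded V B d n" for u n
    unfolding free_ext_def
    using that free_modD(1)[OF free_graded_free_mod[OF that]]
    by (intro sum_closed M U) (auto simp: free_graded_def)
qed (simp_all add: free_ext_add[OF sc] free_ext_scale[OF sc])

text \<open>The homogeneous component of degree n in a free module with generator degrees
  \<open>d\<close>. The test \<open>d b \<le> n\<close> guards the truncated subtraction.\<close>

definition graded_part :: "('b \<Rightarrow> nat) \<Rightarrow> nat \<Rightarrow> ('b \<Rightarrow>\<^sub>0 ('k::field) mpoly) \<Rightarrow> 'b \<Rightarrow>\<^sub>0 'k mpoly" where
  "graded_part d n u = (\<Sum>b\<in>keys u. single b (if d b \<le> n then hom_part (n - d b) (lookup u b) else 0))"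

lemma lookup_graded_part:
  "lookup (graded_part d n u) b = (if d b \<le> n then hom_part (n - d b) (lookup u b) else 0)"
proof -
  have "lookup (graded_part d n u) b = (\<Sum>k\<in>keys u. if k = b then (if d b \<le> n then hom_part (n - d b) (lookup u b) else 0) else 0)"
    unfolding graded_part_def lookup_sum by (rule sum.cong) (auto simp: lookup_single when_def)
  then show ?thesis by (auto simp: in_keys_iff)
qed

lemma graded_part_graded:
  assumes u: "u \<in> free_mod V B"
  shows "graded_part d n u \<in> free_graded V B d n"
proof -
  have "hom_part (n - d b) (lookup u b) \<in> graded V (d b) n" if "d b \<le> n" for b
    using hom_part_forms[OF free_modD(2)[OF u], of "n - d b" b] that by (auto simp: graded_def)
  then have g: "lookup (graded_part d n u) b \<in> graded V (d b) n" for b by (simp add: lookup_graded_part)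
  have k: "keys (graded_part d n u) \<subseteq> B"
  proof
    fix b assume b: "b \<in> keys (graded_part d n u)"
    have "lookup u b \<noteq> 0"
    proof
      assume "lookup u b = 0"
      then have "lookup (graded_part d n u) b = 0" by (simp add: lookup_graded_part)
      then show False using b by (simp add: in_keys_iff)
    qed
    then show "b \<in> B" using free_modD(1)[OF u] by (auto simp: in_keys_iff)
  qed
  show ?thesis unfolding free_graded_def using g k graded_polys[OF g] by (auto intro!: free_modI)
qed

text \<open>\<open>H\<close> stands for taking the component of degree n in the target:
  \<open>hom_part n\<close> for the augmentation, \<open>graded_part\<close> for the differentials.
  The assumption \<open>U\<close> expresses that the image of each basis element b is homogeneous of
  degree \<open>d b\<close>.\<close>

lemma free_ext_graded_part:
  fixes sc :: "('k::field) mpoly \<Rightarrow> 'm \<Rightarrow> 'm::ab_group_add" and H :: "'m \<Rightarrow> 'm" and U :: "'b \<Rightarrow> 'm"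
  assumes sc: "scaling sc" and H: "H 0 = 0" "\<And>x y. H (x + y) = H x + H y"
    and U: "\<And>b p. b \<in> B \<Longrightarrow> p \<in> polys V \<Longrightarrow>
       H (sc p (U b)) = sc (if d b \<le> n then hom_part (n - d b) p else 0) (U b)"
    and u: "u \<in> free_mod V B"
  shows "H (free_ext sc U u) = free_ext sc U (graded_part d n u)"
proof -
  have Hs: "H (sum f A) = (\<Sum>x\<in>A. H (f x))" for f :: "'b \<Rightarrow> 'm" and A
    by (induction A rule: infinite_finite_induct) (auto simp: H)
  have "H (free_ext sc U u) = (\<Sum>b\<in>keys u. sc (lookup (graded_part d n u) b) (U b))"
    unfolding free_ext_def Hs lookup_graded_part
    by (rule sum.cong[OF refl U]) (use free_modD[OF u] in auto)
  also have "\<dots> = free_ext sc U (graded_part d n u)"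
    by (rule free_ext_superset[OF sc, symmetric]) (auto simp: in_keys_iff lookup_graded_part split: if_splits)
  finally show ?thesis .
qed

section \<open>Lifting a filtered Koszul complex\<close>

text \<open>In a basis element (m, t), m is the level of the filtration, matching the degree in x_0,
  and t numbers the basis of the Koszul module at that level.\<close>

definition res_basis :: "nat \<Rightarrow> nat \<Rightarrow> (nat \<times> nat) set" where
  "res_basis e i = {(m, t). 1 \<le> m \<and> t < e choose i}"

definition res_deg :: "nat \<Rightarrow> nat \<times> nat \<Rightarrow> nat" where
  "res_deg i = (\<lambda>(m, t). i + m)"

definition block :: "nat \<Rightarrow> (nat \<times> nat \<Rightarrow>\<^sub>0 ('k::field) mpoly) \<Rightarrow> nat \<Rightarrow> 'k mpoly" where
  "block m u t = lookup u (m, t)"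

definition block_emb :: "nat \<Rightarrow> nat \<Rightarrow> (nat \<Rightarrow> ('k::field) mpoly) \<Rightarrow> nat \<times> nat \<Rightarrow>\<^sub>0 'k mpoly" where
  "block_emb n m v = (\<Sum>t<n. single (m, t) (v t))"

lemma lookup_block_emb: "lookup (block_emb n m v) (m', t) = (if m' = m \<and> t < n then v t else 0)"
proof -
  have "lookup (block_emb n m v) (m', t) = (\<Sum>s<n. if s = t then (if m' = m then v t else 0) else 0)"
    unfolding block_emb_def lookup_sum by (rule sum.cong) (auto simp: lookup_single when_def)
  then show ?thesis by simp
qed

lemma block_emb_mem: "v \<in> vecs V (e choose i) \<Longrightarrow> 1 \<le> m \<Longrightarrow> block_emb (e choose i) m v \<in> free_mod V (res_basis e i)"
  by (rule free_modI) (auto simp: in_keys_iff lookup_block_emb res_basis_def vecs_def split: if_splits prod.splits)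

lemma block_block_emb: "v \<in> vecs V n \<Longrightarrow> block m (block_emb n m v) = v"
  by (auto simp: block_def lookup_block_emb vecs_def fun_eq_iff)

lemma block_diff: "block m (u - v) = block m u - block m v"
  by (auto simp: block_def lookup_minus fun_eq_iff)

lemma block_vecs:
  assumes "u \<in> free_mod V (res_basis e i)"
  shows "block m u \<in> vecs V (e choose i)"
proof -
  have "lookup u (m, t) = 0" if "e choose i \<le> t" for t
  proof -
    have "(m, t) \<notin> keys u" using free_modD(1)[OF assms] that by (auto simp: res_basis_def)
    then show ?thesis by (simp add: in_keys_iff)
  qed
  then show ?thesis using free_modD(2)[OF assms] by (simp add: vecs_def block_def)
qed

text \<open>Elements supported in levels up to m. Levels start at 1, so level 0 is the zero module,
  where the inductions begin.\<close>

definition fil :: "nat set \<Rightarrow> nat \<Rightarrow> nat \<Rightarrow> nat \<Rightarrow> (nat \<times> nat \<Rightarrow>\<^sub>0 ('k::field) mpoly) set" where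
  "fil V e i m = {u \<in> free_mod V (res_basis e i). \<forall>m'>m. \<forall>t. lookup u (m', t) = 0}"

lemma fil_free_mod: "u \<in> fil V e i m \<Longrightarrow> u \<in> free_mod V (res_basis e i)"
  by (simp add: fil_def)

lemma fil_lookup: "u \<in> fil V e i m \<Longrightarrow> m < m' \<Longrightarrow> lookup u (m', t) = 0"
  by (simp add: fil_def)

lemma fil_0_iff: "u \<in> fil V e i 0 \<longleftrightarrow> u = 0"
proof
  assume u: "u \<in> fil V e i 0"
  show "u = 0"
  proof (rule poly_mapping_eqI)
    fix b :: "nat \<times> nat"
    obtain m t where b: "b = (m, t)" by (cases b)
    show "lookup u b = lookup 0 b"
    proof (cases "m = 0")
      case True
      then have "b \<notin> keys u" using free_modD(1)[OF fil_free_mod[OF u]] b by (auto simp: res_basis_def)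
      then show ?thesis by (simp add: in_keys_iff)
    next
      case False
      then show ?thesis using fil_lookup[OF u, of m t] b by simp
    qed
  qed
qed (simp add: fil_def)

lemma fil_zero [simp]: "0 \<in> fil V e i m"
  by (simp add: fil_def)

lemma fil_add: "u \<in> fil V e i m \<Longrightarrow> v \<in> fil V e i m \<Longrightarrow> u + v \<in> fil V e i m"
  by (simp add: fil_def free_mod_add lookup_add)

lemma fil_diff: "u \<in> fil V e i m \<Longrightarrow> v \<in> fil V e i m \<Longrightarrow> u - v \<in> fil V e i m"
  by (simp add: fil_def free_mod_diff lookup_minus)

lemma fil_scale: "p \<in> polys V \<Longrightarrow> u \<in> fil V e i m \<Longrightarrow> free_scale p u \<in> fil V e i m"
  by (simp add: fil_def free_mod_scale lookup_free_scale)

lemma fil_mono: "u \<in> fil V e i m \<Longrightarrow> m \<le> n \<Longrightarrow> u \<in> fil V e i n"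
  by (auto simp: fil_def)

lemma fil_Suc: "u \<in> fil V e i (Suc m) \<Longrightarrow> block (Suc m) u = 0 \<Longrightarrow> u \<in> fil V e i m"
  by (auto simp: fil_def block_def fun_eq_iff) (metis Suc_lessI)

lemma fil_block_emb: "v \<in> vecs V (e choose i) \<Longrightarrow> 1 \<le> m \<Longrightarrow> block_emb (e choose i) m v \<in> fil V e i m"
  using block_emb_mem[of v V e i m] by (simp add: fil_def lookup_block_emb)

lemma fil_exhaust:
  assumes "u \<in> free_mod V (res_basis e i)"
  shows "\<exists>m. u \<in> fil V e i m"
proof -
  let ?m = "Max (insert 0 (fst ` keys u))"
  have "lookup u (m', t) = 0" if "?m < m'" for m' t
  proof (rule ccontr)
    assume "lookup u (m', t) \<noteq> 0"
    then have "(m', t) \<in> keys u" by (simp add: in_keys_iff)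
    then have "m' \<in> insert 0 (fst ` keys u)" by force
    then have "m' \<le> ?m" by (intro Max_ge) auto
    then show False using that by simp
  qed
  then have "u \<in> fil V e i ?m" using assms unfolding fil_def by blast
  then show ?thesis ..
qed

definition unit_vec :: "nat \<Rightarrow> nat \<Rightarrow> ('k::field) mpoly" where
  "unit_vec t s = (if s = t then 1 else 0)"

lemma unit_vec_forms: "t < n \<Longrightarrow> unit_vec t \<in> vec_forms V n 0"
  using forms_const[of 1 V] by (auto simp: unit_vec_def vec_forms_def)

locale filtered_koszul =
  fixes V :: "nat set" and e :: nat and l :: "nat \<Rightarrow> ('k::field) mpoly"
    and D :: "nat \<Rightarrow> (nat \<Rightarrow> 'k mpoly) \<Rightarrow> nat \<Rightarrow> 'k mpoly"
  assumes complex: "koszul_complex V e l D"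
begin

lemma D_add: "D j (u + v) = D j u + D j v"
  using complex by (simp add: koszul_complex_def)

lemma D_scale: "D j (\<lambda>t. p * u t) = (\<lambda>s. p * D j u s)"
  using complex by (simp add: koszul_complex_def)

lemma D_into: "u \<in> vecs V (e choose Suc k) \<Longrightarrow> D (Suc k) u \<in> vecs V (e choose k)"
  using complex unfolding koszul_complex_def by (auto simp: koszul_ranks_def split: nat.splits)

lemma D_forms: "u \<in> vec_forms V (e choose Suc k) d \<Longrightarrow> D (Suc k) u \<in> vec_forms V (e choose k) (Suc d)"
proof -
  have "\<forall>j d. \<forall>u\<in>vec_forms V (koszul_ranks e (Suc j)) d. D j u \<in> vec_forms V (koszul_ranks e j) (Suc d)"
    using complex unfolding koszul_complex_def by blast
  from this[rule_format, of u "Suc k" d]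
  show "u \<in> vec_forms V (e choose Suc k) d \<Longrightarrow> D (Suc k) u \<in> vec_forms V (e choose k) (Suc d)"
    by (simp add: koszul_ranks_def)
qed

lemma D_D: "u \<in> vecs V (e choose Suc (Suc k)) \<Longrightarrow> D (Suc k) (D (Suc (Suc k)) u) = 0"
proof -
  have "\<forall>j. \<forall>u\<in>vecs V (koszul_ranks e (Suc (Suc j))). D j (D (Suc j) u) = 0"
    using complex unfolding koszul_complex_def by blast
  from this[rule_format, of u "Suc k"]
  show "u \<in> vecs V (e choose Suc (Suc k)) \<Longrightarrow> D (Suc k) (D (Suc (Suc k)) u) = 0"
    by (simp add: koszul_ranks_def)
qed

lemma D_exact:
  assumes "u \<in> vecs V (e choose Suc k)" "D (Suc k) u = 0"
  obtains w where "w \<in> vecs V (e choose Suc (Suc k))" "D (Suc (Suc k)) w = u"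
proof -
  have "\<forall>j\<ge>1. \<forall>u\<in>vecs V (koszul_ranks e (Suc j)). D j u = 0 \<longrightarrow>
        (\<exists>w\<in>vecs V (koszul_ranks e (Suc (Suc j))). D (Suc j) w = u)"
    using complex unfolding koszul_complex_def by blast
  from this[rule_format, of "Suc k" u] assms that show ?thesis
    by (auto simp: koszul_ranks_def One_nat_def)
qed

lemma D_aug: "u \<in> vecs V e \<Longrightarrow> D 1 u 0 = (\<Sum>t<e. u t * l t)"
  using complex unfolding koszul_complex_def by blast

lemma D_0 [simp]: "D j 0 = 0"
proof -
  have "D j (0 + 0) = D j 0 + D j 0" by (rule D_add)
  then show ?thesis by simp
qed

lemma D_units:
  assumes v: "v \<in> vecs V n"
  shows "D j v s = (\<Sum>t<n. v t * D j (unit_vec t) s)"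
proof -
  have Dsum: "D j (\<Sum>t\<in>A. f t) = (\<Sum>t\<in>A. D j (f t))" for f :: "nat \<Rightarrow> nat \<Rightarrow> 'k mpoly" and A
    by (induction A rule: infinite_finite_induct) (simp_all only: sum.infinite sum.empty sum.insert D_add D_0 simp_thms)
  have "v = (\<Sum>t<n. (\<lambda>s. v t * unit_vec t s))"
  proof
    fix s
    have "(\<Sum>t<n. v t * unit_vec t s) = (\<Sum>t<n. if t = s then v s else 0)"
      by (rule sum.cong) (auto simp: unit_vec_def)
    also have "\<dots> = v s" using vecsD(2)[OF v, of s] by auto
    finally show "v s = (\<Sum>t<n. (\<lambda>s. v t * unit_vec t s)) s" by (simp add: sum_fun_apply)
  qed
  then have "D j v = (\<Sum>t<n. D j (\<lambda>s. v t * unit_vec t s))" by (metis Dsum)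
  then show ?thesis by (simp add: D_scale sum_fun_apply)
qed

text \<open>A graded submodule of the \<open>k + 1\<close>-st free module whose associated graded module consists
  of the cycles of the Koszul complex.\<close>

definition lifted_cycles :: "nat \<Rightarrow> (nat \<times> nat \<Rightarrow>\<^sub>0 'k mpoly) set \<Rightarrow> bool" where
  "lifted_cycles k Z \<longleftrightarrow> Z \<subseteq> free_mod V (res_basis e (Suc k)) \<and> 0 \<in> Z \<and>
     (\<forall>u\<in>Z. \<forall>v\<in>Z. u + v \<in> Z) \<and> (\<forall>p\<in>polys V. \<forall>u\<in>Z. free_scale p u \<in> Z) \<and>
     (\<forall>u\<in>Z. \<forall>n. graded_part (res_deg (Suc k)) n u \<in> Z) \<and>
     (\<forall>m\<ge>1. \<forall>u\<in>Z \<inter> fil V e (Suc k) m. D (Suc k) (block m u) = 0) \<and>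
     (\<forall>m\<ge>1. \<forall>v\<in>vecs V (e choose Suc k). D (Suc k) v = 0 \<longrightarrow> (\<exists>u\<in>Z \<inter> fil V e (Suc k) m. block m u = v))"

text \<open>The Koszul boundary of a unit vector is a Koszul cycle, hence the leading block of some
  element of \<open>Z\<close>.\<close>

lemma lifted_generators:
  assumes Z: "lifted_cycles k Z" and b: "b \<in> res_basis e (Suc (Suc k))"
  shows "\<exists>u. u \<in> Z \<inter> fil V e (Suc k) (fst b) \<and> u \<in> free_graded V (res_basis e (Suc k)) (res_deg (Suc k)) (res_deg (Suc (Suc k)) b) \<and>
     block (fst b) u = D (Suc (Suc k)) (unit_vec (snd b))"
proof -
  obtain m t where mt: "b = (m, t)" "1 \<le> m" "t < e choose Suc (Suc k)" using b by (auto simp: res_basis_def)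
  let ?v = "D (Suc (Suc k)) (unit_vec t)"
  have uf: "unit_vec t \<in> vec_forms V (e choose Suc (Suc k)) 0" using mt(3) by (rule unit_vec_forms)
  then have vf: "?v \<in> vec_forms V (e choose Suc k) 1" using D_forms[of _ "Suc k" 0] by (simp add: One_nat_def)
  have "D (Suc k) ?v = 0" using uf by (intro D_D vec_forms_vecs)
  then obtain u where u: "u \<in> Z" "u \<in> fil V e (Suc k) m" "block m u = ?v"
    using Z mt(2) vec_forms_vecs[OF vf] unfolding lifted_cycles_def by blast
  let ?n = "res_deg (Suc (Suc k)) b"
  \<comment> \<open>Making the lift homogeneous keeps its leading block: in block m, degree k + 2 +
    m leaves entries of degree 1, which is what the Koszul differential has.\<close>
  let ?u = "graded_part (res_deg (Suc k)) ?n u"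
  have "?u \<in> Z" using Z u(1) unfolding lifted_cycles_def by blast
  moreover have g: "?u \<in> free_graded V (res_basis e (Suc k)) (res_deg (Suc k)) ?n"
    by (rule graded_part_graded[OF fil_free_mod[OF u(2)]])
  moreover have "?u \<in> fil V e (Suc k) m"
    using free_graded_free_mod[OF g] u(2) by (simp add: fil_def lookup_graded_part)
  moreover have "block m ?u = ?v"
  proof
    fix s
    have "block m ?u s = hom_part 1 (block m u s)"
      by (simp add: block_def lookup_graded_part res_deg_def mt(1) One_nat_def)
    also have "\<dots> = ?v s"
    proof -
      have "?v s \<in> forms V 1" using vf by (simp add: vec_forms_def)
      then show ?thesis unfolding u(3) by (simp add: hom_part_of_form)
    qed
    finally show "block m ?u s = ?v s" .
  qed
  ultimately show ?thesis by (auto simp: mt(1))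
qed

text \<open>Sending basis elements to lifted Koszul boundaries gives a map with the Koszul
  differential as leading part. Exactness of the Koszul complex then yields surjectivity onto
  \<open>Z\<close> and the same invariant for the kernel.\<close>

lemma lifted_step:
  assumes Z: "lifted_cycles k Z"
  shows "\<exists>\<phi>. graded_hom V (res_basis e (Suc (Suc k))) (res_deg (Suc (Suc k))) free_scale
       (free_graded V (res_basis e (Suc k)) (res_deg (Suc k))) \<phi> \<and>
     Z = \<phi> ` free_mod V (res_basis e (Suc (Suc k))) \<and>
     (\<forall>u\<in>free_mod V (res_basis e (Suc (Suc k))). \<forall>b. lookup (lookup (\<phi> u) b) 0 = 0) \<and>
     lifted_cycles (Suc k) {u \<in> free_mod V (res_basis e (Suc (Suc k))). \<phi> u = 0}"
proof -
  let ?B = "res_basis e (Suc (Suc k))" and ?B' = "res_basis e (Suc k)"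
  let ?d = "res_deg (Suc (Suc k))" and ?d' = "res_deg (Suc k)"
  note sc = scaling_free_scale
  have Zsub: "Z \<subseteq> free_mod V ?B'" and Z0: "0 \<in> Z" and Zadd: "\<And>u v. u \<in> Z \<Longrightarrow> v \<in> Z \<Longrightarrow> u + v \<in> Z"
    and Zscale: "\<And>p u. p \<in> polys V \<Longrightarrow> u \<in> Z \<Longrightarrow> free_scale p u \<in> Z"
    and Zcyc: "\<And>m u. 1 \<le> m \<Longrightarrow> u \<in> Z \<Longrightarrow> u \<in> fil V e (Suc k) m \<Longrightarrow> D (Suc k) (block m u) = 0"
    using Z unfolding lifted_cycles_def by blast+
  obtain U where U: "\<And>b. b \<in> ?B \<Longrightarrow> U b \<in> Z" "\<And>b. b \<in> ?B \<Longrightarrow> U b \<in> fil V e (Suc k) (fst b)"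
      "\<And>b. b \<in> ?B \<Longrightarrow> U b \<in> free_graded V ?B' ?d' (?d b)"
      "\<And>b. b \<in> ?B \<Longrightarrow> block (fst b) (U b) = D (Suc (Suc k)) (unit_vec (snd b))"
    using lifted_generators[OF Z] by (metis IntE)
  define \<phi> where "\<phi> = free_ext free_scale U"
  have add: "\<phi> (u + v) = \<phi> u + \<phi> v" for u v unfolding \<phi>_def by (rule free_ext_add[OF sc])
  have diff: "\<phi> (u - v) = \<phi> u - \<phi> v" for u v unfolding \<phi>_def by (rule free_ext_diff[OF sc])
  have hom: "graded_hom V ?B ?d free_scale (free_graded V ?B' ?d') \<phi>"
    unfolding \<phi>_def
  proof (rule graded_hom_free_ext[OF sc])
    show "0 \<in> free_graded V ?B' ?d' n" for n by (simp add: free_graded_def)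
    show "x + y \<in> free_graded V ?B' ?d' n" if "x \<in> free_graded V ?B' ?d' n" "y \<in> free_graded V ?B' ?d' n" for n and x y :: "nat \<times> nat \<Rightarrow>\<^sub>0 'k mpoly"
      using that by (simp add: free_graded_def free_mod_add lookup_add)
    show "free_scale p (U b) \<in> free_graded V ?B' ?d' n" if b: "b \<in> ?B" and p: "p \<in> graded V (?d b) n" for b n p
    proof -
      have "p * lookup (U b) b' \<in> graded V (?d b + ?d' b') (n + ?d b)" for b'
        by (rule graded_mult[OF p free_graded_lookup[OF U(3)[OF b]]])
      then have "p * lookup (U b) b' \<in> graded V (?d' b') n" for b' by (fastforce simp: graded_def)
      then show ?thesis using free_mod_scale[OF graded_polys[OF p] free_graded_free_mod[OF U(3)[OF b]]]
        by (simp add: free_graded_def lookup_free_scale)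
    qed
  qed
  have into: "\<phi> u \<in> Z" if "u \<in> free_mod V ?B" for u
    unfolding \<phi>_def by (rule free_ext_mem[OF that Z0 Zadd]) (use Zscale U(1) in auto)
  have fil: "\<phi> u \<in> fil V e (Suc k) m" if u: "u \<in> fil V e (Suc (Suc k)) m" for u m
    unfolding \<phi>_def free_ext_def
  proof (rule sum_closed)
    fix b assume b: "b \<in> keys u"
    then have bB: "b \<in> ?B" using free_modD(1)[OF fil_free_mod[OF u]] by blast
    have "\<not> m < fst b" using b fil_lookup[OF u, of "fst b" "snd b"] by (auto simp: in_keys_iff)
    then show "free_scale (lookup u b) (U b) \<in> fil V e (Suc k) m"
      using U(2)[OF bB] free_modD(2)[OF fil_free_mod[OF u]] by (intro fil_scale) (auto intro: fil_mono)
  qed (auto intro: fil_add)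
  \<comment> \<open>Levels above m do not occur in u, and generators of levels below m do not reach
    block m; only the Koszul part is left.\<close>
  have lead: "block m (\<phi> u) = D (Suc (Suc k)) (block m u)" if u: "u \<in> fil V e (Suc (Suc k)) m" and m: "1 \<le> m" for u m
  proof
    fix s
    let ?n = "e choose Suc (Suc k)"
    let ?A = "keys u \<union> Pair m ` {..<?n}"
    have "block m (\<phi> u) s = (\<Sum>b\<in>?A. lookup u b * lookup (U b) (m, s))"
      unfolding \<phi>_def block_def free_ext_superset[OF sc, of ?A u U, simplified]
      by (simp add: lookup_sum lookup_free_scale)
    also have "\<dots> = (\<Sum>b\<in>Pair m ` {..<?n}. lookup u b * lookup (U b) (m, s))"
    proof (rule sum.mono_neutral_right)
      show "\<forall>b\<in>?A - Pair m ` {..<?n}. lookup u b * lookup (U b) (m, s) = 0"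
      proof
        fix b assume b: "b \<in> ?A - Pair m ` {..<?n}"
        then have bB: "b \<in> ?B" and bu: "b \<in> keys u" using free_modD(1)[OF fil_free_mod[OF u]] by blast+
        obtain m' t where mt: "b = (m', t)" by (cases b)
        have "m' \<noteq> m" using b bB by (auto simp: mt res_basis_def)
        moreover have "\<not> m < m'" using bu fil_lookup[OF u, of m' t] by (auto simp: mt in_keys_iff)
        ultimately have "m' < m" by simp
        then show "lookup u b * lookup (U b) (m, s) = 0" using fil_lookup[OF U(2)[OF bB], of m s] by (simp add: mt)
      qed
    qed auto
    also have "\<dots> = (\<Sum>t<?n. lookup u (m, t) * lookup (U (m, t)) (m, s))"
      by (subst sum.reindex) (auto simp: inj_on_def)
    also have "\<dots> = (\<Sum>t<?n. block m u t * D (Suc (Suc k)) (unit_vec t) s)"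
    proof (rule sum.cong[OF refl])
      fix t assume "t \<in> {..<?n}"
      then have "(m, t) \<in> ?B" using m by (simp add: res_basis_def)
      from U(4)[OF this] have "lookup (U (m, t)) (m, s) = D (Suc (Suc k)) (unit_vec t) s"
        by (simp add: block_def fun_eq_iff)
      then show "lookup u (m, t) * lookup (U (m, t)) (m, s) = block m u t * D (Suc (Suc k)) (unit_vec t) s"
        by (simp add: block_def)
    qed
    also have "\<dots> = D (Suc (Suc k)) (block m u) s"
      by (rule D_units[OF block_vecs[OF fil_free_mod[OF u]], symmetric])
    finally show "block m (\<phi> u) s = D (Suc (Suc k)) (block m u) s" .
  qed
  \<comment> \<open>The leading block of u is a Koszul cycle, hence a boundary. Subtracting the
    image of the corresponding element lowers the level while staying in Z.\<close>
  have onto: "u \<in> Z \<Longrightarrow> u \<in> fil V e (Suc k) m \<Longrightarrow> \<exists>w\<in>fil V e (Suc (Suc k)) m. \<phi> w = u" for u m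
  proof (induction m arbitrary: u)
    case 0
    then have "u = 0" by (simp add: fil_0_iff)
    then show ?case by (intro bexI[of _ 0]) (auto simp: \<phi>_def)
  next
    case (Suc m)
    have m1: "1 \<le> Suc m" by simp
    have "D (Suc k) (block (Suc m) u) = 0" by (rule Zcyc[OF m1 Suc.prems])
    then obtain w where w: "w \<in> vecs V (e choose Suc (Suc k))" "D (Suc (Suc k)) w = block (Suc m) u"
      using D_exact[OF block_vecs[OF fil_free_mod[OF Suc.prems(2)]]] by blast
    let ?w = "block_emb (e choose Suc (Suc k)) (Suc m) w"
    have wf: "?w \<in> fil V e (Suc (Suc k)) (Suc m)" by (rule fil_block_emb[OF w(1) m1])
    have neg: "- x \<in> Z" if "x \<in> Z" for x
    proof -
      have "free_scale (- 1) x = - x" by (rule poly_mapping_eqI) (simp add: lookup_free_scale)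
      then show ?thesis using Zscale[OF polys_uminus[OF polys_1] that] by simp
    qed
    have "u + - \<phi> ?w \<in> Z" by (intro Zadd neg into Suc.prems(1) fil_free_mod[OF wf])
    moreover have "u - \<phi> ?w \<in> fil V e (Suc k) m"
    proof (rule fil_Suc)
      show "u - \<phi> ?w \<in> fil V e (Suc k) (Suc m)" by (intro fil_diff Suc.prems(2) fil wf)
      show "block (Suc m) (u - \<phi> ?w) = 0"
        unfolding block_diff lead[OF wf m1] block_block_emb[OF w(1)] w(2) by simp
    qed
    ultimately obtain y where y: "y \<in> fil V e (Suc (Suc k)) m" "\<phi> y = u - \<phi> ?w" using Suc.IH by auto
    have "\<phi> (y + ?w) = u" by (simp add: add y(2))
    moreover have "y + ?w \<in> fil V e (Suc (Suc k)) (Suc m)" by (rule fil_add[OF fil_mono[OF y(1)] wf]) simp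
    ultimately show ?case by blast
  qed
  have img: "Z = \<phi> ` free_mod V ?B"
  proof
    show "\<phi> ` free_mod V ?B \<subseteq> Z" using into by blast
    show "Z \<subseteq> \<phi> ` free_mod V ?B"
    proof
      fix u assume u: "u \<in> Z"
      then obtain m where "u \<in> fil V e (Suc k) m" using Zsub fil_exhaust by blast
      then show "u \<in> \<phi> ` free_mod V ?B" using onto[OF u] fil_free_mod by blast
    qed
  qed
  have minimal: "lookup (lookup (\<phi> u) b') 0 = 0" if u: "u \<in> free_mod V ?B" for u b'
  proof -
    have "lookup (U b) b' \<in> mpow V 1" if b: "b \<in> ?B" for b
    proof (cases "lookup (U b) b' = 0")
      case False
      have "\<not> fst b < fst b'" using False fil_lookup[OF U(2)[OF b], of "fst b'" "snd b'"] by auto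
      \<comment> \<open>From level m to a level m' \<le> m an entry has degree 1 + m - m', so it is
        never a nonzero constant.\<close>
      then have lt: "?d' b' < ?d b" by (auto simp: res_deg_def split: prod.splits)
      have g: "lookup (U b) b' \<in> graded V (?d' b') (?d b)" by (rule free_graded_lookup[OF U(3)[OF b]])
      have "1 \<le> mdeg x" if "x \<in> keys (lookup (U b) b')" for x
        using forms_keysD[OF g that] lt by (simp add: One_nat_def)
      then show ?thesis using graded_polys[OF g] by (simp add: mpow_def)
    qed simp
    then have "lookup (\<phi> u) b' \<in> mpow V 1"
      unfolding \<phi>_def free_ext_def lookup_sum lookup_free_scale
      using free_modD[OF u] by (intro mpow_sum mpow_mult_left) auto
    then have "0 \<notin> keys (lookup (\<phi> u) b')" by (auto simp: mpow_def)
    then show ?thesis by (simp add: in_keys_iff)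
  qed
  \<comment> \<open>The chosen images are homogeneous; this makes the kernel a graded submodule, as
    the invariant demands.\<close>
  have part: "graded_part ?d' n (\<phi> u) = \<phi> (graded_part ?d n u)" if u: "u \<in> free_mod V ?B" for n u
    unfolding \<phi>_def
  proof (rule free_ext_graded_part[OF sc _ _ _ u])
    show "graded_part ?d' n 0 = (0 :: nat \<times> nat \<Rightarrow>\<^sub>0 'k mpoly)"
      by (rule poly_mapping_eqI) (simp add: lookup_graded_part)
    show "graded_part ?d' n (x + y) = graded_part ?d' n x + graded_part ?d' n y" for x y :: "nat \<times> nat \<Rightarrow>\<^sub>0 'k mpoly"
      by (rule poly_mapping_eqI) (simp add: lookup_graded_part lookup_add hom_part_add)
    show "graded_part ?d' n (free_scale p (U b)) = free_scale (if ?d b \<le> n then hom_part (n - ?d b) p else 0) (U b)"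
      if b: "b \<in> ?B" and p: "p \<in> polys V" for b p
    proof (rule poly_mapping_eqI)
      fix b'
      show "lookup (graded_part ?d' n (free_scale p (U b))) b' =
          lookup (free_scale (if ?d b \<le> n then hom_part (n - ?d b) p else 0) (U b)) b'"
      proof (cases "lookup (U b) b' = 0")
        case True
        then show ?thesis by (simp add: lookup_graded_part lookup_free_scale)
      next
        case False
        have g: "lookup (U b) b' \<in> graded V (?d' b') (?d b)" by (rule free_graded_lookup[OF U(3)[OF b]])
        obtain x where "x \<in> keys (lookup (U b) b')" using False by (metis keys_eq_empty ex_in_conv)
        then have le: "?d' b' \<le> ?d b" using forms_keysD[OF g] by fastforce
        have f: "lookup (U b) b' \<in> forms V (?d b - ?d' b')" using g le by (fastforce simp: graded_def)
        show ?thesis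
        proof (cases "?d b \<le> n")
          case True
          have "n - ?d' b' = (?d b - ?d' b') + (n - ?d b)" using True le by simp
          then have "hom_part (n - ?d' b') (lookup (U b) b' * p) = lookup (U b) b' * hom_part (n - ?d b) p"
            by (simp only: hom_part_mult_form[OF f])
          then show ?thesis using True le
            by (simp add: lookup_graded_part lookup_free_scale mult.commute)
        next
          case False
          have "hom_part (n - ?d' b') (lookup (U b) b' * p) = 0" if "?d' b' \<le> n"
            using False le that by (intro hom_part_mult_form_less[OF f]) auto
          then show ?thesis using False
            by (simp add: lookup_graded_part lookup_free_scale mult.commute)
        qed
      qed
    qed
  qed
  let ?K = "{u \<in> free_mod V ?B. \<phi> u = 0}"
  have "lifted_cycles (Suc k) ?K"
    unfolding lifted_cycles_def
  proof (intro conjI ballI allI impI)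
    show "0 \<in> ?K" by (simp add: \<phi>_def)
    show "u + v \<in> ?K" if "u \<in> ?K" "v \<in> ?K" for u v using that by (simp add: add free_mod_add)
    show "free_scale p u \<in> ?K" if "p \<in> polys V" "u \<in> ?K" for p u
      using that scaling_0(2)[OF sc] by (simp add: \<phi>_def free_ext_scale[OF sc] free_mod_scale)
    show "graded_part ?d n u \<in> ?K" if "u \<in> ?K" for u n
    proof -
      have "\<phi> (graded_part ?d n u) = graded_part ?d' n 0" using part[of u n] that by simp
      also have "\<dots> = 0" by (rule poly_mapping_eqI) (simp add: lookup_graded_part)
      finally show ?thesis using free_graded_free_mod[OF graded_part_graded] that by blast
    qed
    show "D (Suc (Suc k)) (block m u) = 0" if "1 \<le> m" "u \<in> ?K \<inter> fil V e (Suc (Suc k)) m" for m u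
    proof -
      have "block m (\<phi> u) = D (Suc (Suc k)) (block m u)" using that by (intro lead) auto
      moreover have "\<phi> u = 0" using that by blast
      ultimately show ?thesis by (simp add: block_def fun_eq_iff)
    qed
    show "\<exists>u\<in>?K \<inter> fil V e (Suc (Suc k)) m. block m u = v"
      if m: "1 \<le> m" and v: "v \<in> vecs V (e choose Suc (Suc k))" "D (Suc (Suc k)) v = 0" for m v
    proof -
      obtain n where n: "m = Suc n" using m by (cases m) (auto simp: One_nat_def)
      let ?w = "block_emb (e choose Suc (Suc k)) m v"
      have wf: "?w \<in> fil V e (Suc (Suc k)) m" by (rule fil_block_emb[OF v(1) m])
      have "\<phi> ?w \<in> fil V e (Suc k) n"
      proof (rule fil_Suc)
        show "\<phi> ?w \<in> fil V e (Suc k) (Suc n)" using fil[OF wf] by (simp only: n)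
        have "block m (\<phi> ?w) = 0" by (simp only: lead[OF wf m] block_block_emb[OF v(1)] v(2))
        then show "block (Suc n) (\<phi> ?w) = 0" by (simp only: n)
      qed
      moreover have "\<phi> ?w \<in> Z" by (rule into[OF fil_free_mod[OF wf]])
      \<comment> \<open>A Koszul cycle placed in level m has its image in a lower level of Z. That
        image also comes from a lower level, and the difference of the two preimages is a kernel
        element with leading block v.\<close>
      ultimately obtain y where y: "y \<in> fil V e (Suc (Suc k)) n" "\<phi> y = \<phi> ?w" using onto by blast
      have yf: "y \<in> fil V e (Suc (Suc k)) m" using y(1) by (rule fil_mono) (simp add: n)
      have "block m y = 0" using fil_lookup[OF y(1), of m] by (simp add: block_def fun_eq_iff n)
      then have "block m (?w - y) = v" by (simp add: block_diff block_block_emb[OF v(1)])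
      moreover have "?w - y \<in> fil V e (Suc (Suc k)) m" by (rule fil_diff[OF wf yf])
      moreover have "?w - y \<in> ?K" using fil_free_mod[OF calculation(2)] by (simp add: diff y(2))
      ultimately show ?thesis by blast
    qed
  qed auto
  then show ?thesis using hom img minimal by blast
qed

text \<open>Dependent choice iterates the lifting step; the chosen sets are the successive syzygy
  modules.\<close>

lemma lifted_resolution:
  assumes Z: "lifted_cycles 0 Z"
  shows "\<exists>\<phi>. (\<forall>i\<ge>1. graded_hom V (res_basis e (Suc i)) (res_deg (Suc i)) free_scale
         (free_graded V (res_basis e i) (res_deg i)) (\<phi> i)) \<and>
     Z = \<phi> 1 ` free_mod V (res_basis e 2) \<and>
     (\<forall>i\<ge>1. {u \<in> free_mod V (res_basis e (Suc i)). \<phi> i u = 0} = \<phi> (Suc i) ` free_mod V (res_basis e (Suc (Suc i)))) \<and>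
     (\<forall>i\<ge>1. \<forall>u\<in>free_mod V (res_basis e (Suc i)). \<forall>b. lookup (lookup (\<phi> i u) b) 0 = 0)"
proof -
  define good :: "nat \<Rightarrow> (nat \<times> nat \<Rightarrow>\<^sub>0 'k mpoly) set \<Rightarrow> ((nat \<times> nat \<Rightarrow>\<^sub>0 'k mpoly) \<Rightarrow> nat \<times> nat \<Rightarrow>\<^sub>0 'k mpoly) \<Rightarrow> bool"
    where "good = (\<lambda>k Z \<phi>. graded_hom V (res_basis e (Suc (Suc k))) (res_deg (Suc (Suc k))) free_scale
       (free_graded V (res_basis e (Suc k)) (res_deg (Suc k))) \<phi> \<and>
     Z = \<phi> ` free_mod V (res_basis e (Suc (Suc k))) \<and>
     (\<forall>u\<in>free_mod V (res_basis e (Suc (Suc k))). \<forall>b. lookup (lookup (\<phi> u) b) 0 = 0))"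
  \<comment> \<open>The clause for k = 0 pins the sequence to the given start
    \<open>Z\<close>.\<close>
  have "\<exists>Y :: nat \<Rightarrow> (nat \<times> nat \<Rightarrow>\<^sub>0 'k mpoly) set. \<forall>k. (lifted_cycles k (Y k) \<and> (k = 0 \<longrightarrow> Y k = Z)) \<and>
      (\<exists>\<phi>. good k (Y k) \<phi> \<and> Y (Suc k) = {u \<in> free_mod V (res_basis e (Suc (Suc k))). \<phi> u = 0})"
  proof (rule dependent_nat_choice)
    show "\<exists>Y. lifted_cycles 0 Y \<and> (0 = (0::nat) \<longrightarrow> Y = Z)" using Z by blast
    fix Y k assume "lifted_cycles k Y \<and> (k = 0 \<longrightarrow> Y = Z)"
    then obtain \<phi> where "good k Y \<phi>" "lifted_cycles (Suc k) {u \<in> free_mod V (res_basis e (Suc (Suc k))). \<phi> u = 0}"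
      using lifted_step[of k Y] unfolding good_def by blast
    then show "\<exists>Y'. (lifted_cycles (Suc k) Y' \<and> (Suc k = 0 \<longrightarrow> Y' = Z)) \<and>
        (\<exists>\<phi>. good k Y \<phi> \<and> Y' = {u \<in> free_mod V (res_basis e (Suc (Suc k))). \<phi> u = 0})" by blast
  qed
  then obtain Y where Y: "\<And>k. k = 0 \<longrightarrow> Y k = Z"
    "\<And>k. \<exists>\<phi>. good k (Y k) \<phi> \<and> Y (Suc k) = {u \<in> free_mod V (res_basis e (Suc (Suc k))). \<phi> u = 0}"
    by blast
  then have "\<forall>k. \<exists>\<phi>. good k (Y k) \<phi> \<and> Y (Suc k) = {u \<in> free_mod V (res_basis e (Suc (Suc k))). \<phi> u = 0}"
    by blast
  from choice[OF this] obtain \<psi> where psi: "\<And>k. good k (Y k) (\<psi> k)"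
      "\<And>k. Y (Suc k) = {u \<in> free_mod V (res_basis e (Suc (Suc k))). \<psi> k u = 0}"
    by blast
  let ?\<phi> = "\<lambda>i. \<psi> (i - 1)"
  have Suc_ex: "\<exists>k. i = Suc k" if "1 \<le> i" for i :: nat using that by (cases i) (auto simp: One_nat_def)
  show ?thesis
  proof (intro exI[of _ ?\<phi>] conjI allI impI)
    show "Z = ?\<phi> 1 ` free_mod V (res_basis e 2)" using psi(1)[of 0] Y(1)[of 0] by (simp add: good_def numeral_2_eq_2)
    fix i :: nat assume "1 \<le> i"
    then obtain k where i: "i = Suc k" using Suc_ex by blast
    show "graded_hom V (res_basis e (Suc i)) (res_deg (Suc i)) free_scale (free_graded V (res_basis e i) (res_deg i)) (?\<phi> i)"
      using psi(1)[of k] by (simp add: good_def i One_nat_def)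
    show "{u \<in> free_mod V (res_basis e (Suc i)). ?\<phi> i u = 0} = ?\<phi> (Suc i) ` free_mod V (res_basis e (Suc (Suc i)))"
      using psi(1)[of "Suc k"] psi(2)[of k] by (simp add: good_def i One_nat_def)
    show "\<forall>u\<in>free_mod V (res_basis e (Suc i)). \<forall>b. lookup (lookup (?\<phi> i u) b) 0 = 0"
      using psi(1)[of k] by (simp add: good_def i One_nat_def)
  qed
qed

end

section \<open>The resolution of \<open>I/J\<close>\<close>

definition x0_pow :: "nat \<Rightarrow> ('k::field) mpoly" where
  "x0_pow k = single (single 0 k) 1"

lemma x0_pow_forms: "x0_pow k \<in> forms {0..N} k"
proof -
  have "keys (single (0::nat) k) \<subseteq> {0..N}" by simp
  from forms_single[OF this, of 1] show ?thesis unfolding x0_pow_def by (simp only: mdeg_single)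
qed

lemma x0_coeff_x0_pow_mult: "x0_coeff (k + j) (x0_pow k * f) = x0_coeff j f"
proof (rule poly_mapping_eqI)
  fix m :: "nat \<Rightarrow>\<^sub>0 nat"
  have eq: "m + single 0 (k + j) = single 0 k + (m + single 0 j)"
    by (rule poly_mapping_eqI) (simp add: lookup_add lookup_single when_def)
  show "lookup (x0_coeff (k + j) (x0_pow k * f)) m = lookup (x0_coeff j f) m"
    unfolding lookup_x0_coeff eq x0_pow_def lookup_single_times_add by simp
qed

lemma x0_deg_le_x0_pow_mult: "x0_deg_le j f \<Longrightarrow> x0_deg_le (k + j) (x0_pow k * f)"
  by (rule x0_deg_le_mult) (simp_all add: x0_deg_le_def x0_pow_def)

lemma x0_deg_le_drop:
  assumes "x0_deg_le (Suc m) f" "x0_coeff (Suc m) f = 0"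
  shows "x0_deg_le m f"
  unfolding x0_deg_le_def
proof
  fix k assume k: "k \<in> keys f"
  have "lookup k 0 \<noteq> Suc m"
  proof
    assume e: "lookup k 0 = Suc m"
    then have "Poly_Mapping.update 0 0 k + single 0 (Suc m) = k"
      by (auto intro!: poly_mapping_eqI simp: lookup_add lookup_update lookup_single when_def)
    then have "lookup (x0_coeff (Suc m) f) (Poly_Mapping.update 0 0 k) = lookup f k"
      by (simp add: lookup_x0_coeff lookup_update)
    then show False using assms(2) k by (simp add: in_keys_iff)
  qed
  moreover have "lookup k 0 \<le> Suc m" using assms(1) k by (auto simp: x0_deg_le_def)
  ultimately show "lookup k 0 \<le> m" by simp
qed

lemma x0_coeff_hom_part: "x0_coeff i (hom_part (n + i) f) = hom_part n (x0_coeff i f)"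
  by (rule poly_mapping_eqI) (simp add: lookup_x0_coeff lookup_hom_part mdeg_add)

lemma x0_deg_le_sum: "(\<And>x. x \<in> A \<Longrightarrow> x0_deg_le m (f x)) \<Longrightarrow> x0_deg_le m (sum f A)"
  by (induction A rule: infinite_finite_induct) (auto intro: x0_deg_le_add)

text \<open>Each \<open>q t\<close> is a quadric x_0 l_t + s_t in \<open>I\<close> with s_t free of
  x_0; \<open>elim\<close> says that every level m \<ge> 1 of I/J, filtered by the degree in x_0, is
  the ideal of the l_t.\<close>

locale quadric_lift = filtered_koszul "{1..N}" e l D for N e and l :: "nat \<Rightarrow> ('k::field) mpoly" and D +
  fixes I :: "'k mpoly set" and q :: "nat \<Rightarrow> 'k mpoly"
  assumes I: "homogeneous_ideal {0..N} I"
    and l_forms: "\<And>t. t < e \<Longrightarrow> l t \<in> forms {1..N} 1"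
    and q: "\<And>t. t < e \<Longrightarrow> q t \<in> I" "\<And>t. t < e \<Longrightarrow> q t \<in> forms {0..N} 2"
      "\<And>t. t < e \<Longrightarrow> x0_deg_le 1 (q t)" "\<And>t. t < e \<Longrightarrow> x0_coeff 1 (q t) = l t"
    and elim: "\<And>m. 1 \<le> m \<Longrightarrow> partial_elim N I m = gen {1..N} (l ` {..<e})"
begin

abbreviation "S \<equiv> polys {1..N}"
abbreviation "J \<equiv> I \<inter> polys {1..N}"

lemma R_ideal: "ideal I (poly_ring {0..N})"
  by (rule homogeneous_ideal_ideal[OF I])

text \<open>The element x_0^(m-1) q_t has degree m in x_0, leading coefficient l_t and total degree
  m + 1, so it represents the t-th generator at level m.\<close>

definition aug_gen :: "nat \<times> nat \<Rightarrow> 'k mpoly" where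
  "aug_gen b = x0_pow (fst b - 1) * q (snd b)"

definition aug :: "(nat \<times> nat \<Rightarrow>\<^sub>0 'k mpoly) \<Rightarrow> 'k mpoly" where
  "aug = free_ext (*) aug_gen"

lemma J_ideal: "ideal J (poly_ring {1..N})"
  unfolding ideal_poly_ring_iff
proof (intro conjI ballI)
  show "p * a \<in> J" if "a \<in> J" "p \<in> S" for a p
    using that ideal_mult[OF R_ideal _ polys_S_R] by auto
qed (auto intro: ideal_add[OF R_ideal] ideal_0[OF R_ideal])

lemma aug_gen_props:
  assumes "b \<in> res_basis e (Suc 0)"
  shows "aug_gen b \<in> I" "aug_gen b \<in> forms {0..N} (res_deg (Suc 0) b)"
    "x0_deg_le (fst b) (aug_gen b)" "x0_coeff (fst b) (aug_gen b) = l (snd b)"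
proof -
  obtain m t where b: "b = (Suc m, t)" "t < e"
    using assms by (cases b; cases "fst b") (auto simp: res_basis_def)
  have g: "aug_gen b = x0_pow m * q t" by (simp add: aug_gen_def b)
  have fb: "fst b = m + 1" "snd b = t" by (simp_all add: b)
  show "aug_gen b \<in> I" unfolding g
    using q(1)[OF b(2)] graded_polys[OF x0_pow_forms] by (intro ideal_mult[OF R_ideal])
  show "aug_gen b \<in> forms {0..N} (res_deg (Suc 0) b)"
  proof -
    have "res_deg (Suc 0) b = m + 2" by (simp add: b res_deg_def)
    then show ?thesis using forms_mult[OF x0_pow_forms q(2)[OF b(2)], of m] by (simp only: g)
  qed
  show "x0_deg_le (fst b) (aug_gen b)"
    using x0_deg_le_x0_pow_mult[OF q(3)[OF b(2)], of m] unfolding g fb .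
  show "x0_coeff (fst b) (aug_gen b) = l (snd b)"
    using x0_coeff_x0_pow_mult[of m 1 "q t"] q(4)[OF b(2)] unfolding g fb by (simp only:)
qed

lemma aug_add: "aug (u + v) = aug u + aug v"
  unfolding aug_def by (rule free_ext_add[OF scaling_times])

lemma aug_diff: "aug (u - v) = aug u - aug v"
  unfolding aug_def by (rule free_ext_diff[OF scaling_times])

lemma aug_0 [simp]: "aug 0 = 0"
  by (simp add: aug_def)

lemma aug_mem:
  assumes u: "u \<in> free_mod {1..N} (res_basis e (Suc 0))"
  shows "aug u \<in> I"
  unfolding aug_def
proof (rule free_ext_mem[OF u])
  show "p * aug_gen b \<in> I" if "p \<in> S" "b \<in> res_basis e (Suc 0)" for p b
    using that aug_gen_props(1) by (intro ideal_mult[OF R_ideal] polys_S_R)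
qed (auto intro: ideal_add[OF R_ideal] ideal_0[OF R_ideal])

lemma aug_hom:
  "graded_hom {1..N} (res_basis e (Suc 0)) (res_deg (Suc 0)) (*) (\<lambda>n. I \<inter> forms UNIV n) aug"
  unfolding aug_def
proof (rule graded_hom_free_ext[OF scaling_times])
  fix b n and p :: "'k mpoly" assume b: "b \<in> res_basis e (Suc 0)" and p: "p \<in> graded {1..N} (res_deg (Suc 0) b) n"
  have "p * aug_gen b \<in> graded UNIV (res_deg (Suc 0) b + 0) (n + res_deg (Suc 0) b)"
    by (rule graded_mult[OF graded_mono[OF p] graded_mono[OF aug_gen_props(2)[OF b]]]) auto
  then have "p * aug_gen b \<in> forms UNIV n" by (auto simp: graded_def)
  moreover have "p * aug_gen b \<in> I"
    by (intro ideal_mult[OF R_ideal] aug_gen_props(1)[OF b] polys_S_R graded_polys[OF p])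
  ultimately show "p * aug_gen b \<in> I \<inter> forms UNIV n" by blast
qed (auto intro: ideal_add[OF R_ideal] ideal_0[OF R_ideal])

lemma aug_lead:
  assumes u: "u \<in> fil {1..N} e (Suc 0) m" and m: "1 \<le> m"
  shows "x0_deg_le m (aug u)" "x0_coeff m (aug u) = D 1 (block m u) 0"
proof -
  have kB: "b \<in> res_basis e (Suc 0)" "fst b \<le> m" if "b \<in> keys u" for b
  proof -
    show "b \<in> res_basis e (Suc 0)" using that free_modD(1)[OF fil_free_mod[OF u]] by blast
    show "fst b \<le> m" using that fil_lookup[OF u, of "fst b" "snd b"] by (force simp: in_keys_iff)
  qed
  have pS: "lookup u b \<in> S" for b by (rule free_modD(2)[OF fil_free_mod[OF u]])
  show "x0_deg_le m (aug u)"
    unfolding aug_def free_ext_def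
  proof (rule x0_deg_le_sum)
    fix b assume b: "b \<in> keys u"
    have "x0_deg_le (0 + fst b) (lookup u b * aug_gen b)"
      by (intro x0_deg_le_mult x0_deg_le_polys[OF pS] aug_gen_props(3)[OF kB(1)[OF b]]) simp
    then show "x0_deg_le m (lookup u b * aug_gen b)" using kB(2)[OF b] by (auto intro: x0_deg_le_mono)
  qed
  let ?A = "keys u \<union> Pair m ` {..<e}"
  have S0: "0 \<notin> {1..N}" by simp
  have "x0_coeff m (aug u) = (\<Sum>b\<in>?A. lookup u b * x0_coeff m (aug_gen b))"
    unfolding aug_def free_ext_superset[OF scaling_times, of ?A u aug_gen, simplified] x0_coeff_sum
    by (rule sum.cong[OF refl x0_coeff_mult[OF pS S0]])
  also have "\<dots> = (\<Sum>b\<in>Pair m ` {..<e}. lookup u b * x0_coeff m (aug_gen b))"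
  proof (rule sum.mono_neutral_right)
    show "\<forall>b\<in>?A - Pair m ` {..<e}. lookup u b * x0_coeff m (aug_gen b) = 0"
    proof
      fix b assume b: "b \<in> ?A - Pair m ` {..<e}"
      then have bu: "b \<in> keys u" by blast
      have "fst b \<noteq> m" using b kB(1)[OF bu] by (auto simp: res_basis_def)
      then have "fst b < m" using kB(2)[OF bu] by simp
      then show "lookup u b * x0_coeff m (aug_gen b) = 0"
        using x0_coeff_eq_0[OF aug_gen_props(3)[OF kB(1)[OF bu]]] by simp
    qed
  qed auto
  also have "\<dots> = (\<Sum>t<e. lookup u (m, t) * x0_coeff m (aug_gen (m, t)))"
    by (subst sum.reindex) (auto simp: inj_on_def)
  also have "\<dots> = (\<Sum>t<e. block m u t * l t)"
  proof (rule sum.cong[OF refl])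
    fix t assume "t \<in> {..<e}"
    then have "(m, t) \<in> res_basis e (Suc 0)" using m by (simp add: res_basis_def)
    from aug_gen_props(4)[OF this] show "lookup u (m, t) * x0_coeff m (aug_gen (m, t)) = block m u t * l t"
      by (simp add: block_def)
  qed
  also have "\<dots> = D 1 (block m u) 0"
    using block_vecs[OF fil_free_mod[OF u], of m] by (intro D_aug[symmetric]) simp
  finally show "x0_coeff m (aug u) = D 1 (block m u) 0" .
qed

text \<open>The target of the first Koszul differential has rank 1, so only the entry 0
  counts.\<close>

lemma D_1_eq_0_iff:
  assumes v: "v \<in> vecs {1..N} (e choose Suc 0)"
  shows "D (Suc 0) v = 0 \<longleftrightarrow> D 1 v 0 = 0"
proof
  assume "D 1 v 0 = 0"
  moreover have "D (Suc 0) v \<in> vecs {1..N} 1" using D_into[OF v] by simp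
  ultimately have "D (Suc 0) v s = 0" for s
    using vecsD(2)[of "D (Suc 0) v" "{1..N}" 1 s] by (cases s) (auto simp: One_nat_def)
  then show "D (Suc 0) v = 0" by (simp add: fun_eq_iff)
qed (simp add: One_nat_def)

text \<open>Division along the degree in x_0: the leading coefficient is a combination of the l_t,
  which the generators of level m cancel. At degree 0 the remainder lies in J.\<close>

lemma aug_onto: "f \<in> I \<Longrightarrow> x0_deg_le m f \<Longrightarrow> \<exists>w\<in>fil {1..N} e (Suc 0) m. f - aug w \<in> J"
proof (induction m arbitrary: f)
  case 0
  then have "f \<in> J" using polys_x0_deg_le ideal_polys[OF R_ideal] by blast
  then show ?case by (intro bexI[of _ 0]) auto
next
  case (Suc m)
  have lp: "l ` {..<e} \<subseteq> S" using l_forms graded_polys by blast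
  have "x0_coeff (Suc m) f \<in> partial_elim N I (Suc m)"
    unfolding partial_elim_eq[OF I] using Suc.prems by blast
  also have "\<dots> = gen {1..N} (l ` {..<e})" by (rule elim) simp
  also have "\<dots> = {\<Sum>t\<in>{..<e}. c t * l t | c. \<forall>t. c t \<in> S}"
    using lp by (intro gen_image) auto
  finally obtain c where c: "x0_coeff (Suc m) f = (\<Sum>t<e. c t * l t)" "\<And>t. c t \<in> S" by auto
  let ?c = "vec_fst e c"
  have cv: "?c \<in> vecs {1..N} (e choose Suc 0)" using c(2) by (auto simp: vecs_def vec_fst_def)
  let ?w = "block_emb (e choose Suc 0) (Suc m) ?c"
  have m1: "1 \<le> Suc m" by simp
  have w: "?w \<in> fil {1..N} e (Suc 0) (Suc m)" by (rule fil_block_emb[OF cv m1])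
  have "x0_coeff (Suc m) (aug ?w) = D 1 ?c 0"
    using aug_lead(2)[OF w m1] by (simp only: block_block_emb[OF cv])
  also have "\<dots> = (\<Sum>t<e. ?c t * l t)" using cv by (intro D_aug) simp
  also have "\<dots> = x0_coeff (Suc m) f" unfolding c(1) by (simp add: vec_fst_def)
  finally have "x0_coeff (Suc m) (f - aug ?w) = 0" by (simp add: x0_coeff_diff)
  moreover have "x0_deg_le (Suc m) (f - aug ?w)" by (intro x0_deg_le_diff Suc.prems(2) aug_lead(1)[OF w m1])
  ultimately have "x0_deg_le m (f - aug ?w)" by (rule x0_deg_le_drop[rotated])
  moreover have "f - aug ?w \<in> I" by (intro ideal_diff[OF R_ideal] Suc.prems(1) aug_mem[OF fil_free_mod[OF w]])
  ultimately obtain y where y: "y \<in> fil {1..N} e (Suc 0) m" "f - aug ?w - aug y \<in> J" using Suc.IH by blast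
  have "f - aug (?w + y) \<in> J" using y(2) by (simp only: aug_add diff_diff_eq)
  moreover have "?w + y \<in> fil {1..N} e (Suc 0) (Suc m)" by (rule fil_add[OF w fil_mono[OF y(1)]]) simp
  ultimately show ?case by blast
qed

text \<open>This starts the iteration with the first syzygies, the kernel of the map to I/J; the
  argument is that of the lifting step, with the degree in x_0 as filtration of the target.\<close>

lemma aug_lifted_cycles: "lifted_cycles 0 {u \<in> free_mod {1..N} (res_basis e (Suc 0)). aug u \<in> J}"
  unfolding lifted_cycles_def
proof (intro conjI ballI allI impI)
  let ?Z = "{u \<in> free_mod {1..N} (res_basis e (Suc 0)). aug u \<in> J}"
  show "0 \<in> ?Z" using ideal_0[OF J_ideal] by simp
  show "u + v \<in> ?Z" if "u \<in> ?Z" "v \<in> ?Z" for u v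
    using that ideal_add[OF J_ideal, of "aug u" "aug v"] free_mod_add[of u _ _ v] by (simp add: aug_add)
  show "free_scale p u \<in> ?Z" if "p \<in> S" "u \<in> ?Z" for p u
  proof -
    have "aug (free_scale p u) = p * aug u" unfolding aug_def by (rule free_ext_scale[OF scaling_times])
    moreover have "p * aug u \<in> J" using that by (intro ideal_mult[OF J_ideal]) auto
    ultimately show ?thesis using that free_mod_scale[of p _ u] by simp
  qed
  show "graded_part (res_deg (Suc 0)) n u \<in> ?Z" if u: "u \<in> ?Z" for u n
  proof -
    have uf: "u \<in> free_mod {1..N} (res_basis e (Suc 0))" using u by blast
    have "hom_part n (aug u) = aug (graded_part (res_deg (Suc 0)) n u)"
      unfolding aug_def
    proof (rule free_ext_graded_part[OF scaling_times _ _ _ uf])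
      fix b and p :: "'k mpoly" assume b: "b \<in> res_basis e (Suc 0)"
      let ?d = "res_deg (Suc 0) b"
      note f = aug_gen_props(2)[OF b]
      show "hom_part n (p * aug_gen b) = (if ?d \<le> n then hom_part (n - ?d) p else 0) * aug_gen b"
      proof (cases "?d \<le> n")
        case True
        then have "n = ?d + (n - ?d)" by simp
        then have "hom_part n (aug_gen b * p) = aug_gen b * hom_part (n - ?d) p"
          using hom_part_mult_form[OF f, of "n - ?d" p] by simp
        then show ?thesis using True by (simp add: mult.commute)
      next
        case False
        then have "hom_part n (aug_gen b * p) = 0" by (intro hom_part_mult_form_less[OF f]) simp
        then show ?thesis using False by (simp add: mult.commute)
      qed
    qed (simp_all add: hom_part_add)
    moreover have "hom_part n (aug u) \<in> J"
      using u homogeneous_ideal_hom_part[OF I] hom_part_polys by blast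
    ultimately show ?thesis using free_graded_free_mod[OF graded_part_graded[OF uf]] by simp
  qed
  show "D (Suc 0) (block m u) = 0" if m: "1 \<le> m" and u: "u \<in> ?Z \<inter> fil {1..N} e (Suc 0) m" for m u
  proof -
    have uf: "u \<in> fil {1..N} e (Suc 0) m" and uJ: "aug u \<in> S" using u by auto
    \<comment> \<open>Elements of J are free of x_0, so their coefficient of x_0^m vanishes for
      every m \<ge> 1.\<close>
    have "0 < m" using m by simp
    then have "x0_coeff m (aug u) = 0" by (intro x0_coeff_eq_0[OF x0_deg_le_polys[OF uJ]]) auto
    then have "D 1 (block m u) 0 = 0" by (simp only: aug_lead(2)[OF uf m])
    then show ?thesis using D_1_eq_0_iff[OF block_vecs[OF fil_free_mod[OF uf]]] by blast
  qed
  show "\<exists>u\<in>?Z \<inter> fil {1..N} e (Suc 0) m. block m u = v"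
    if m: "1 \<le> m" and v: "v \<in> vecs {1..N} (e choose Suc 0)" "D (Suc 0) v = 0" for m v
  proof -
    obtain n where n: "m = Suc n" using m by (cases m) (auto simp: One_nat_def)
    let ?w = "block_emb (e choose Suc 0) m v"
    have w: "?w \<in> fil {1..N} e (Suc 0) m" by (rule fil_block_emb[OF v(1) m])
    have "x0_coeff m (aug ?w) = 0"
      using aug_lead(2)[OF w m] v(2) D_1_eq_0_iff[OF v(1)] by (simp only: block_block_emb[OF v(1)])
    \<comment> \<open>A Koszul cycle makes the leading coefficient vanish, so the degree in x_0
      drops below m and a correction from lower levels reaches J.\<close>
    then have "x0_deg_le n (aug ?w)" using aug_lead(1)[OF w m] unfolding n by (rule x0_deg_le_drop[rotated])
    then obtain y where y: "y \<in> fil {1..N} e (Suc 0) n" "aug ?w - aug y \<in> J"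
      using aug_onto[OF aug_mem[OF fil_free_mod[OF w]]] by blast
    have yf: "y \<in> fil {1..N} e (Suc 0) m" using y(1) by (rule fil_mono) (simp add: n)
    have "block m y = 0" using fil_lookup[OF y(1), of m] by (simp add: block_def fun_eq_iff n)
    then have "block m (?w - y) = v" by (simp only: block_diff block_block_emb[OF v(1)] diff_zero)
    moreover have wy: "?w - y \<in> fil {1..N} e (Suc 0) m" by (rule fil_diff[OF w yf])
    moreover have "?w - y \<in> ?Z" using fil_free_mod[OF wy] y(2) by (simp add: aug_diff)
    ultimately show ?thesis by blast
  qed
qed auto

lemma resolution: "\<exists>\<epsilon> \<phi>. minimal_graded_free_resolution {1..N} I J (res_basis e) res_deg \<epsilon> \<phi>"
proof -
  obtain \<phi> where \<phi>: "\<forall>i\<ge>1. graded_hom {1..N} (res_basis e (Suc i)) (res_deg (Suc i)) free_scale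
         (free_graded {1..N} (res_basis e i) (res_deg i)) (\<phi> i)"
     "{u \<in> free_mod {1..N} (res_basis e (Suc 0)). aug u \<in> J} = \<phi> 1 ` free_mod {1..N} (res_basis e 2)"
     "\<forall>i\<ge>1. {u \<in> free_mod {1..N} (res_basis e (Suc i)). \<phi> i u = 0} = \<phi> (Suc i) ` free_mod {1..N} (res_basis e (Suc (Suc i)))"
     "\<forall>i\<ge>1. \<forall>u\<in>free_mod {1..N} (res_basis e (Suc i)). \<forall>b. lookup (lookup (\<phi> i u) b) 0 = 0"
    using lifted_resolution[OF aug_lifted_cycles] by (elim exE conjE) (rule that; assumption)
  have "I = {aug u + g | u g. u \<in> free_mod {1..N} (res_basis e (Suc 0)) \<and> g \<in> J}"
  proof (intro equalityI subsetI)
    fix f assume f: "f \<in> I"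
    obtain m where "x0_deg_le m f" using x0_deg_le_ex by blast
    then obtain w where w: "w \<in> fil {1..N} e (Suc 0) m" "f - aug w \<in> J" using aug_onto[OF f] by blast
    have "f = aug w + (f - aug w)" by simp
    then show "f \<in> {aug u + g | u g. u \<in> free_mod {1..N} (res_basis e (Suc 0)) \<and> g \<in> J}"
      using w(2) fil_free_mod[OF w(1)] by blast
  next
    fix f assume "f \<in> {aug u + g | u g. u \<in> free_mod {1..N} (res_basis e (Suc 0)) \<and> g \<in> J}"
    then show "f \<in> I" using aug_mem ideal_add[OF R_ideal] by blast
  qed
  then have "minimal_graded_free_resolution {1..N} I J (res_basis e) res_deg aug \<phi>"
    unfolding minimal_graded_free_resolution_def using aug_hom \<phi> by (simp only: One_nat_def simp_thms)
  then show ?thesis by blast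
qed

end

section \<open>Application to ideals with bounded generators and to quadrics\<close>

lemma generated_stable:
  assumes def: "defining_ideal N X I" and q: "origin_pt \<in> X"
    and G: "G \<subseteq> (\<Union>n\<le>d. forms {0..N} n)" "I = gen {0..N} G" and i: "d - 1 \<le> i"
  shows "partial_elim N I i = partial_elim N I (d - 1)"
proof -
  have I: "homogeneous_ideal {0..N} I" using def by (simp add: defining_ideal_def)
  have Gp: "G \<subseteq> polys {0..N}" using G(1) graded_polys by blast
  show ?thesis
  proof (rule partial_elim_stable[OF I Gp _ G(2) i])
    fix g assume g: "g \<in> G"
    then obtain n where n: "n \<le> d" "g \<in> forms {0..N} n" using G(1) by blast
    have "g \<in> I" unfolding G(2) by (rule gen_incl[OF Gp g])
    from defining_ideal_form_x0_deg(2)[OF def q this n(2)] n(1)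
    show "x0_deg_le (d - 1) g" by (rule x0_deg_le_mono[OF _ diff_le_mono])
  qed
qed

lemma quadrics_resolution:
  assumes I: "homogeneous_ideal {0..N} I"
    and lp: "linear_pivots {1..N} (chart_ideal N X 0) Q F"
    and elim: "\<And>m. 1 \<le> m \<Longrightarrow> partial_elim N I m = tangent_space_ideal N X"
  shows "(\<exists>l. l ` {1..card Q} \<subseteq> forms {1..N} 1 \<and> tangent_space_ideal N X = gen {1..N} (l ` {1..card Q})) \<and>
    (\<exists>\<epsilon> \<phi>. minimal_graded_free_resolution {1..N} I (I \<inter> polys {1..N}) (res_basis (card Q)) res_deg \<epsilon> \<phi>)"
proof -
  let ?V = "{1..N}" and ?e = "card Q"
  let ?t = "pivot_tail ?V Q F"
  note A = chart_ideal_ideal[of N X]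
  have fV: "finite ?V" by simp
  have Q: "Q \<subseteq> ?V" using lp by (simp add: linear_pivots_def)
  have tp: "\<And>i. i \<in> Q \<Longrightarrow> ?t i \<in> polys (?V - Q)" by (rule pivot_tail_polys)
  obtain h where h: "bij_betw h {0..<?e} Q"
    using ex_bij_betw_nat_finite[OF finite_subset[OF Q fV]] by blast
  define l where "l = (\<lambda>t. var (h t) - ?t (h t))"
  have hQ: "h t \<in> Q" if "t < ?e" for t using h that by (auto simp: bij_betw_def)
  have lf: "l t \<in> forms ?V 1" if "t < ?e" for t
    unfolding l_def using hQ[OF that] Q pivot_tail_forms[of ?V Q F "h t"]
    by (intro graded_diff forms_var) (auto intro: graded_mono)
  have img: "l ` {..<?e} = (\<lambda>p. var p - ?t p) ` Q"
  proof -
    have "h ` {..<?e} = Q" using h by (simp add: bij_betw_def lessThan_atLeast0)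
    then have "(\<lambda>p. var p - ?t p) ` Q = (\<lambda>p. var p - ?t p) ` (h ` {..<?e})" by simp
    then show ?thesis by (simp only: l_def image_image)
  qed
  have T: "tangent_space_ideal N X = gen ?V (l ` {..<?e})"
    unfolding tangent_space_ideal_def img by (rule gen_linear_parts[OF lp A fV])
  have "\<exists>D. koszul_complex ?V ?e l D"
  \<comment> \<open>The pivot forms are a regular sequence in any enumeration \<open>h\<close> of
    the pivots; injectivity of \<open>h\<close> keeps the next pivot out of the earlier
    ones.\<close>
  proof (rule koszul_complex_exists[OF lf])
    fix j s assume j: "j < ?e" and s: "s \<in> polys ?V" and mem: "l j * s \<in> gen ?V (l ` {..<j})"
    have im: "l ` {..<j} = (\<lambda>p. var p - ?t p) ` (h ` {..<j})" by (auto simp: l_def)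
    have R: "h ` {..<j} \<subseteq> Q" using hQ j by auto
    have nR: "h j \<notin> h ` {..<j}"
    proof
      assume "h j \<in> h ` {..<j}"
      then obtain i where i: "i < j" "h j = h i" by auto
      have "inj_on h {0..<?e}" using h by (simp add: bij_betw_def)
      then show False using i j by (auto dest!: inj_onD[of h _ j i])
    qed
    show "s \<in> gen ?V (l ` {..<j})"
      unfolding im
    proof (rule pivot_forms_regular[OF Q tp R hQ[OF j] nR s])
      show "(var (h j) - ?t (h j)) * s \<in> gen ?V ((\<lambda>p. var p - ?t p) ` (h ` {..<j}))"
        using mem unfolding im by (simp only: l_def)
    qed
  qed
  then obtain D where D: "koszul_complex ?V ?e l D" by blast
  \<comment> \<open>As l_t lies in K_1(I), it is the leading coefficient of some element of I; since
    x_0 l_t has degree 2, the degree 2 part of that element has the same one.\<close>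
  have "\<exists>g. g \<in> I \<and> g \<in> forms {0..N} 2 \<and> x0_deg_le 1 g \<and> x0_coeff 1 g = l t" if t: "t < ?e" for t
  proof -
    have lV: "l ` {..<?e} \<subseteq> polys ?V" using lf graded_polys by blast
    have "l t \<in> partial_elim N I 1" unfolding elim[OF order_refl] T using t by (intro gen_incl[OF lV]) auto
    then obtain f where f: "f \<in> I" "x0_deg_le 1 f" "x0_coeff 1 f = l t" unfolding partial_elim_eq[OF I] by auto
    have "x0_coeff 1 (hom_part (1 + 1) f) = l t"
      unfolding x0_coeff_hom_part f(3) using hom_part_of_form[OF lf[OF t]] by simp
    moreover have "hom_part 2 f \<in> forms {0..N} 2"
      by (rule hom_part_forms[OF ideal_polys[OF homogeneous_ideal_ideal[OF I] f(1)]])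
    ultimately show ?thesis
      using homogeneous_ideal_hom_part[OF I f(1)] x0_deg_le_hom_part[OF f(2)]
      by (intro exI[of _ "hom_part 2 f"]) (simp add: one_add_one)
  qed
  then obtain q where q: "\<And>t. t < ?e \<Longrightarrow> q t \<in> I \<and> q t \<in> forms {0..N} 2 \<and> x0_deg_le 1 (q t) \<and> x0_coeff 1 (q t) = l t"
    by metis
  interpret quadric_lift N ?e l D I q
    by unfold_locales (use D I lf q elim T in auto)
  have "(\<lambda>t. l (t - 1)) ` {1..?e} = l ` {..<?e}"
  proof -
    have "{1..?e} = Suc ` {..<?e}" by (auto simp: One_nat_def image_Suc_lessThan)
    then show ?thesis by (simp add: image_image)
  qed
  then show ?thesis using T lf resolution
    by (intro conjI exI[of _ "\<lambda>t. l (t - 1)"]) auto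
qed

theorem proposition2p5:
  fixes N :: nat
    and X :: "(nat \<Rightarrow> 'k::{alg_closed_field, field_char_0}) set"
    and I :: "'k mpoly set"
  assumes "proj_closed N X"
    and "defining_ideal N X I"
    and "origin_pt \<in> X"
  shows "(\<forall>d. property_N N I d 1 \<longrightarrow>
            (\<forall>i\<ge>d - 1. partial_elim N I i = partial_elim N I (d - 1)) \<and>
            partial_elim N I (d - 1) = tangent_cone_ideal N X \<and>
            (smooth_at_origin N X \<longrightarrow>
              (\<exists>L \<subseteq> forms {1..N} 1. partial_elim N I (d - 1) = genideal (poly_ring {1..N}) L) \<and>
              partial_elim N I (d - 1) = tangent_space_ideal N X))
       \<and> (generated_by_quadrics N I \<and> smooth_at_origin N X \<longrightarrow>
            (let e = codim N X; J = I \<inter> polys {1..N} in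
              (\<exists>l. l ` {1..e} \<subseteq> forms {1..N} 1 \<and>
                partial_elim N I 1 = genideal (poly_ring {1..N}) (l ` {1..e}) \<and>
                partial_elim N I 1 = tangent_space_ideal N X) \<and>
              J = partial_elim N I 0 \<and>
              partial_elim N I 0 \<subseteq> partial_elim N I 1 \<and>
              (\<forall>i\<ge>1. partial_elim N I i = partial_elim N I 1) \<and>
              (\<exists>\<epsilon> \<phi>. minimal_graded_free_resolution {1..N} I J
                 (\<lambda>i. {(m, t). 1 \<le> m \<and> t < e choose i}) (\<lambda>i (m, t). i + m) \<epsilon> \<phi>)))"
proof (intro conjI allI impI)
  have I: "homogeneous_ideal {0..N} I" using assms(2) by (simp add: defining_ideal_def)
  fix d assume p: "property_N N I d 1"
  let ?G = "\<Union>n\<le>d. I \<inter> forms {0..N} n"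
  have stable: "partial_elim N I i = partial_elim N I (d - 1)" if "d - 1 \<le> i" for i
    by (rule generated_stable[OF assms(2,3) _ property_N_generators[OF I p] that]) auto
  then show "partial_elim N I i = partial_elim N I (d - 1)" if "d - 1 \<le> i" for i using that .
  show cone: "partial_elim N I (d - 1) = tangent_cone_ideal N X"
    by (rule tangent_cone_eq_partial_elim[OF assms(2) stable])
  assume smooth: "smooth_at_origin N X"
  show space: "partial_elim N I (d - 1) = tangent_space_ideal N X"
    unfolding cone by (rule tangent_cone_smooth[OF assms(1,3) smooth])
  show "\<exists>L \<subseteq> forms {1..N} 1. partial_elim N I (d - 1) = genideal (poly_ring {1..N}) L"
  proof (intro exI conjI)
    show "hom_part 1 ` chart_ideal N X 0 \<subseteq> forms {1..N} 1"
      using hom_part_forms ideal_polys[OF chart_ideal_ideal] by blast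
    show "partial_elim N I (d - 1) = genideal (poly_ring {1..N}) (hom_part 1 ` chart_ideal N X 0)"
      unfolding space tangent_space_ideal_def ..
  qed
next
  have I: "homogeneous_ideal {0..N} I" using assms(2) by (simp add: defining_ideal_def)
  assume "generated_by_quadrics N I \<and> smooth_at_origin N X"
  then obtain G where G: "G \<subseteq> forms {0..N} 2" "I = gen {0..N} G" and smooth: "smooth_at_origin N X"
    by (auto simp: generated_by_quadrics_def)
  have stable: "partial_elim N I i = partial_elim N I 1" if "1 \<le> i" for i
  proof -
    \<comment> \<open>Quadrics are the case d = 2, where the stable index d - 1 is 1.\<close>
    have "G \<subseteq> (\<Union>n\<le>2. forms {0..N} n)" using G(1) by blast
    moreover have "(2::nat) - 1 = 1" by (simp add: One_nat_def)
    ultimately show ?thesis using generated_stable[OF assms(2,3) _ G(2), of 2 i] that by (simp only:)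
  qed
  have "partial_elim N I 1 = tangent_cone_ideal N X"
    by (rule tangent_cone_eq_partial_elim[OF assms(2) stable])
  also have "\<dots> = tangent_space_ideal N X" by (rule tangent_cone_smooth[OF assms(1,3) smooth])
  finally have space: "partial_elim N I 1 = tangent_space_ideal N X" .
  obtain Q F where lp: "linear_pivots {1..N} (chart_ideal N X 0) Q F"
    using linear_pivots_exist[OF chart_ideal_ideal] by blast
  have e: "codim N X = card Q" by (rule smooth_dims(2)[OF lp smooth])
  have "partial_elim N I m = tangent_space_ideal N X" if "1 \<le> m" for m
    unfolding stable[OF that] by (rule space)
  note res = quadrics_resolution[OF I lp this]
  have "res_basis (card Q) = (\<lambda>i. {(m, t). 1 \<le> m \<and> t < card Q choose i})" "res_deg = (\<lambda>i (m, t). i + m)"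
    by (simp_all add: res_basis_def res_deg_def fun_eq_iff)
  with res have "\<exists>\<epsilon> \<phi>. minimal_graded_free_resolution {1..N} I (I \<inter> polys {1..N})
      (\<lambda>i. {(m, t). 1 \<le> m \<and> t < card Q choose i}) (\<lambda>i (m, t). i + m) \<epsilon> \<phi>" by simp
  then show "let e = codim N X; J = I \<inter> polys {1..N} in
      (\<exists>l. l ` {1..e} \<subseteq> forms {1..N} 1 \<and>
        partial_elim N I 1 = genideal (poly_ring {1..N}) (l ` {1..e}) \<and>
        partial_elim N I 1 = tangent_space_ideal N X) \<and>
      J = partial_elim N I 0 \<and>
      partial_elim N I 0 \<subseteq> partial_elim N I 1 \<and>
      (\<forall>i\<ge>1. partial_elim N I i = partial_elim N I 1) \<and>
      (\<exists>\<epsilon> \<phi>. minimal_graded_free_resolution {1..N} I J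
         (\<lambda>i. {(m, t). 1 \<le> m \<and> t < e choose i}) (\<lambda>i (m, t). i + m) \<epsilon> \<phi>)"
    unfolding Let_def e
    using res space stable partial_elim_0[OF I] partial_elim_mono[OF I zero_le_one] by metis
qed

end
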